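(* The set $\{I(\xi_n),\ n\in\mathbb Z\}$ is an orthonormal basis of $\mathcal G$. Moreover, $$\mathbb E\left[I(\xi_n)\,\middle|\,\mathscr F_{(-\infty,0]}\right]=\begin{cases} I(\xi_n), & n<0,\\ 0, & n\ge 0,\end{cases}$$ so that $\{I(\xi_n),\ n<0\}$ spans the past (its closed linear span is $\mathcal G_{(-\infty,0]}$) and $\{I(\xi_n),\ n\ge 0\}$ spans its orthogonal complement in $\mathcal G$.
   Context: Fourier convention: $\widehat f(\gamma)=\int_{\mathbb R}f(t)e^{i\gamma t}\,dt$. $H^{2+}$ and $H^{2-}$ are the Hardy spaces of the upper and lower half-plane, viewed as closed subspaces of $L_2(\mathbb R,d\gamma)$; they are the Fourier transforms of $L_2([0,\infty))$ and $L_2((-\infty,0])$ respectively. A function $h\in H^{2+}$ is outer if the closed linear span in $L_2(d\gamma)$ of $\{e^{i\gamma t}\overline{h(\gamma)},\ t<0\}$ is $H^{2-}$. Spectral measure: $d\Delta(\gamma)=\Delta'(\gamma)\,d\gamma$ is an even, absolutely continuous positive measure on $\mathbb R$ with $$\int_{\mathbb R}\frac{\Delta'(\gamma)}{1+\gamma^2}\,d\gamma<\infty,\qquad \int_{\mathbb R}\frac{\log\Delta'(\gamma)}{1+\gamma^2}\,d\gamma>-\infty .$$ Under these conditions one can write $\frac{\Delta'(\gamma)}{1+\gamma^2}=|h(\gamma)|^2$ with $h\in H^{2+}$ outer and $h(-\gamma)=-\overline{h(\gamma)}$; fix such an $h$. Process and spaces: $X=\{X(t),\,t\in\mathbb R\}$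 is a real, zero-mean Gaussian process with stationary increments with covariance $\mathbb E[X(t)X(s)]=\int_{\mathbb R}z_t(\gamma)\overline{z_s(\gamma)}\,d\Delta(\gamma)$, where $z_t(\gamma)=\frac{e^{i\gamma t}-1}{i\gamma}$. $\mathcal G$ is the closed (complex) linear span of $\{X(t),\,t\in\mathbb R\}$ in $L_2(\Omega,\mathscr F,\mathbb P)$, $\mathcal G_{(-\infty,0]}$ is the closed linear span of $\{X(t),\,t\le 0\}$, and $\mathscr F_{(-\infty,0]}$ is the $\sigma$-field generated by $\{X(t),\,t\le0\}$. $\mathbf L_\Delta$ is the completion of the pre-Hilbert space of functions $f\in L_2(\mathbb R)$ with $\int|\widehat f|^2d\Delta<\infty$ under the inner product $(f,g)_\Delta=\int\widehat f\,\overline{\widehat g}\,d\Delta$; the Fourier transform extends to an isometry of $\mathbf L_\Delta$ onto $L_2(d\Delta)$, still denoted $f\mapsto\widehat f$. Put $\mathbf 1_t=\mathbf 1_{[0,t]}$ for $t\ge0$ and $\mathbf 1_t=-\mathbf 1_{[t,0]}$ for $t<0$, so $\widehat{\mathbf 1_t}=z_t$. $I:\mathbf L_\Delta\to\mathcal G$ is the unitary map (stochastic integral) determined by $I(\mathbf 1_t)=X(t)$, $t\in\mathbb R$. For $n\in\mathbb Z$ let $e_n(\gamma)=\frac1{\sqrt\pi}\frac1{1-i\gamma}\left(\frac{1+i\gamma}{1-i\gamma}\right)^n$; these form an orthonormal basis of $L_2(\mathbb R,d\gamma)$. Let $\xi_n\in\mathbf L_\Delta$ be the element whose image in $L_2(d\Delta)$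 under the (extended) Fourier transform is $$\widehat{\xi_n}(\gamma)=\frac{e_n(\gamma)}{(\gamma-i)\,\overline{h(\gamma)}} .$$ *)

theory Defs
  imports "HOL-Probability.Probability"
begin

section \<open>Complex \<open>L\<^sub>2\<close> spaces of a measure\<close>

text \<open>Elements of \<open>L\<^sub>2\<close> are represented by square integrable functions; equality of elements is equality
  almost everywhere.  Distances are taken in \<^typ>\<open>ennreal\<close>, because the Bochner integral of a
  non-integrable function is \<open>0\<close>.\<close>

definition L2 :: "'a measure \<Rightarrow> ('a \<Rightarrow> complex) set" where
  "L2 M = {f \<in> borel_measurable M. integrable M (\<lambda>x. (cmod (f x))\<^sup>2)}"

definition L2_inner :: "'a measure \<Rightarrow> ('a \<Rightarrow> complex) \<Rightarrow> ('a \<Rightarrow> complex) \<Rightarrow> complex" where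
  "L2_inner M f g = (\<integral>x. f x * cnj (g x) \<partial>M)"

definition L2_dist_sq :: "'a measure \<Rightarrow> ('a \<Rightarrow> complex) \<Rightarrow> ('a \<Rightarrow> complex) \<Rightarrow> ennreal" where
  "L2_dist_sq M f g = (\<integral>\<^sup>+x. ennreal ((cmod (f x - g x))\<^sup>2) \<partial>M)"

definition L2_closed_span :: "'a measure \<Rightarrow> ('a \<Rightarrow> complex) set \<Rightarrow> ('a \<Rightarrow> complex) set" where
  "L2_closed_span M S =
     {f \<in> L2 M. \<forall>\<epsilon>>0. \<exists>F c. finite F \<and> F \<subseteq> S \<and> L2_dist_sq M f (\<lambda>x. \<Sum>g\<in>F. c g * g x) < \<epsilon>}"

definition orthonormal_basis_of ::
    "'a measure \<Rightarrow> ('a \<Rightarrow> complex) set \<Rightarrow> ('i \<Rightarrow> 'a \<Rightarrow> complex) \<Rightarrow> bool" where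
  "orthonormal_basis_of M V b \<longleftrightarrow>
     (\<forall>i. b i \<in> V) \<and>
     (\<forall>i j. L2_inner M (b i) (b j) = (if i = j then 1 else 0)) \<and>
     L2_closed_span M (range b) = V"

definition orthogonal_complement_in ::
    "'a measure \<Rightarrow> ('a \<Rightarrow> complex) set \<Rightarrow> ('a \<Rightarrow> complex) set \<Rightarrow> ('a \<Rightarrow> complex) set" where
  "orthogonal_complement_in M V W = {f \<in> V. \<forall>g\<in>W. L2_inner M f g = 0}"

section \<open>Fourier transform and Hardy spaces\<close>

definition fourier :: "(real \<Rightarrow> complex) \<Rightarrow> real \<Rightarrow> complex" where
  "fourier f \<gamma> = (\<integral>t. f t * exp (\<i> * of_real \<gamma> * of_real t) \<partial>lborel)"

text \<open>The \<open>L\<^sub>2\<close> transform: the \<open>L\<^sub>2\<close> limit (which exists by Plancherel's theorem, and is unique up to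
  null sets) of the transforms of the truncations of \<open>f\<close> to \<open>[-N, N]\<close>.\<close>

definition fourier_L2 :: "(real \<Rightarrow> complex) \<Rightarrow> real \<Rightarrow> complex" where
  "fourier_L2 f = (SOME F. F \<in> L2 lborel \<and>
     (\<lambda>N::nat. L2_dist_sq lborel (fourier (\<lambda>t. indicator {- real N..real N} t * f t)) F) \<longlonglongrightarrow> 0)"

text \<open>The Hardy spaces of the half-planes, through their boundary functions, as the Fourier
  transforms of \<open>L\<^sub>2([0,\<infinity>))\<close> and \<open>L\<^sub>2((-\<infinity>,0])\<close>.\<close>

definition hardy_upper :: "(real \<Rightarrow> complex) set" where
  "hardy_upper = {F \<in> L2 lborel. \<exists>f\<in>L2 lborel. (\<forall>t<0. f t = 0) \<and>
     (AE \<gamma> in lborel. F \<gamma> = fourier_L2 f \<gamma>)}"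

definition hardy_lower :: "(real \<Rightarrow> complex) set" where
  "hardy_lower = {F \<in> L2 lborel. \<exists>f\<in>L2 lborel. (\<forall>t>0. f t = 0) \<and>
     (AE \<gamma> in lborel. F \<gamma> = fourier_L2 f \<gamma>)}"

definition outer_function :: "(real \<Rightarrow> complex) \<Rightarrow> bool" where
  "outer_function h \<longleftrightarrow> h \<in> hardy_upper \<and>
     L2_closed_span lborel {\<lambda>\<gamma>. exp (\<i> * of_real \<gamma> * of_real t) * cnj (h \<gamma>) |t. t < 0} = hardy_lower"

section \<open>The spectral measure\<close>

text \<open>The spectral measure is given by its density \<open>D\<close>.  Since \<open>ln x < x\<close>, the positive part of
  \<open>ln D(\<gamma>) / (1 + \<gamma>\<^sup>2)\<close> is integrable once \<open>D(\<gamma>) / (1 + \<gamma>\<^sup>2)\<close> is, so that its integral exceeds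
  \<open>-\<infinity>\<close> iff its negative part has finite integral.  The logarithm of \<open>0\<close> is \<open>-\<infinity>\<close> here, whereas
  \<^term>\<open>ln (0::real)\<close> is \<open>0\<close>.\<close>

definition neg_part_ln :: "real \<Rightarrow> ennreal" where
  "neg_part_ln x = (if x \<le> 0 then \<infinity> else ennreal (max 0 (- ln x)))"

definition spectral_density :: "(real \<Rightarrow> real) \<Rightarrow> bool" where
  "spectral_density D \<longleftrightarrow>
     D \<in> borel_measurable borel \<and> (\<forall>\<gamma>. 0 \<le> D \<gamma>) \<and> (AE \<gamma> in lborel. D (- \<gamma>) = D \<gamma>) \<and>
     integrable lborel (\<lambda>\<gamma>. D \<gamma> / (1 + \<gamma>\<^sup>2)) \<and>
     (\<integral>\<^sup>+\<gamma>. neg_part_ln (D \<gamma>) / ennreal (1 + \<gamma>\<^sup>2) \<partial>lborel) < \<infinity>"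

definition spectral_measure :: "(real \<Rightarrow> real) \<Rightarrow> real measure" where
  "spectral_measure D = density lborel (\<lambda>\<gamma>. ennreal (D \<gamma>))"

text \<open>At \<open>\<gamma> = 0\<close> the quotient takes the value \<open>0\<close> instead of its limit \<open>t\<close>; this concerns a single
  point, a null set of every measure considered.\<close>

definition z :: "real \<Rightarrow> real \<Rightarrow> complex" where
  "z t \<gamma> = (exp (\<i> * of_real \<gamma> * of_real t) - 1) / (\<i> * of_real \<gamma>)"

section \<open>Gaussian processes with stationary increments\<close>

text \<open>Almost surely constant variables count as Gaussian.\<close>

definition gaussian_rv :: "'w measure \<Rightarrow> ('w \<Rightarrow> real) \<Rightarrow> bool" where
  "gaussian_rv P Y \<longleftrightarrow> Y \<in> borel_measurable P \<and>
     ((\<exists>\<mu>. AE \<omega> in P. Y \<omega> = \<mu>) \<or>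
      (\<exists>\<mu> \<sigma>. \<sigma> > 0 \<and> distributed P lborel Y (\<lambda>x. ennreal (normal_density \<mu> \<sigma> x))))"

definition gaussian_process :: "'w measure \<Rightarrow> (real \<Rightarrow> 'w \<Rightarrow> real) \<Rightarrow> bool" where
  "gaussian_process P X \<longleftrightarrow> (\<forall>t. X t \<in> borel_measurable P) \<and>
     (\<forall>J a. finite J \<longrightarrow> gaussian_rv P (\<lambda>\<omega>. \<Sum>t\<in>J. a t * X t \<omega>))"

definition stationary_increments :: "'w measure \<Rightarrow> (real \<Rightarrow> 'w \<Rightarrow> real) \<Rightarrow> bool" where
  "stationary_increments P X \<longleftrightarrow>
     (\<forall>\<tau> J. finite J \<longrightarrow>
        distr P (Pi\<^sub>M J (\<lambda>_. borel)) (\<lambda>\<omega>. \<lambda>t\<in>J. X (t + \<tau>) \<omega> - X \<tau> \<omega>) =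
        distr P (Pi\<^sub>M J (\<lambda>_. borel)) (\<lambda>\<omega>. \<lambda>t\<in>J. X t \<omega> - X 0 \<omega>))"

definition process_span :: "'w measure \<Rightarrow> (real \<Rightarrow> 'w \<Rightarrow> real) \<Rightarrow> real set \<Rightarrow> ('w \<Rightarrow> complex) set" where
  "process_span P X T = L2_closed_span P ((\<lambda>t \<omega>. of_real (X t \<omega>)) ` T)"

definition process_sigma :: "'w measure \<Rightarrow> (real \<Rightarrow> 'w \<Rightarrow> real) \<Rightarrow> real set \<Rightarrow> 'w measure" where
  "process_sigma P X T = sigma (space P) {X t -` B \<inter> space P |t B. t \<in> T \<and> B \<in> sets borel}"

definition complex_cond_exp :: "'w measure \<Rightarrow> 'w measure \<Rightarrow> ('w \<Rightarrow> complex) \<Rightarrow> 'w \<Rightarrow> complex" where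
  "complex_cond_exp P F Y \<omega> =
     Complex (real_cond_exp P F (\<lambda>\<omega>. Re (Y \<omega>)) \<omega>) (real_cond_exp P F (\<lambda>\<omega>. Im (Y \<omega>)) \<omega>)"

section \<open>The space \<open>L\<^sub>\<Delta>\<close> and the stochastic integral\<close>

definition pre_L :: "(real \<Rightarrow> real) \<Rightarrow> (real \<Rightarrow> complex) set" where
  "pre_L D = {f \<in> L2 lborel. fourier_L2 f \<in> L2 (spectral_measure D)}"

definition pre_inner :: "(real \<Rightarrow> real) \<Rightarrow> (real \<Rightarrow> complex) \<Rightarrow> (real \<Rightarrow> complex) \<Rightarrow> complex" where
  "pre_inner D f g = L2_inner (spectral_measure D) (fourier_L2 f) (fourier_L2 g)"

definition pre_norm_sq :: "(real \<Rightarrow> real) \<Rightarrow> (real \<Rightarrow> complex) \<Rightarrow> ennreal" where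
  "pre_norm_sq D f = (\<integral>\<^sup>+\<gamma>. ennreal ((cmod (fourier_L2 f \<gamma>))\<^sup>2) \<partial>spectral_measure D)"

text \<open>The completion.  Its elements are represented by Cauchy sequences in the pre-Hilbert space;
  as for \<open>L\<^sub>2\<close>, two representatives at distance \<open>0\<close> stand for the same element.\<close>

definition L_space :: "(real \<Rightarrow> real) \<Rightarrow> (nat \<Rightarrow> real \<Rightarrow> complex) set" where
  "L_space D = {\<xi>. (\<forall>k. \<xi> k \<in> pre_L D) \<and>
     (\<forall>\<epsilon>>0. \<exists>N. \<forall>m\<ge>N. \<forall>n\<ge>N. pre_norm_sq D (\<lambda>t. \<xi> m t - \<xi> n t) < \<epsilon>)}"

definition L_inner ::
    "(real \<Rightarrow> real) \<Rightarrow> (nat \<Rightarrow> real \<Rightarrow> complex) \<Rightarrow> (nat \<Rightarrow> real \<Rightarrow> complex) \<Rightarrow> complex" where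
  "L_inner D \<xi> \<eta> = lim (\<lambda>k. pre_inner D (\<xi> k) (\<eta> k))"

definition L_add ::
    "(nat \<Rightarrow> real \<Rightarrow> complex) \<Rightarrow> (nat \<Rightarrow> real \<Rightarrow> complex) \<Rightarrow> nat \<Rightarrow> real \<Rightarrow> complex" where
  "L_add \<xi> \<eta> = (\<lambda>k t. \<xi> k t + \<eta> k t)"

definition L_scale :: "complex \<Rightarrow> (nat \<Rightarrow> real \<Rightarrow> complex) \<Rightarrow> nat \<Rightarrow> real \<Rightarrow> complex" where
  "L_scale c \<xi> = (\<lambda>k t. c * \<xi> k t)"

definition L_embed :: "(real \<Rightarrow> complex) \<Rightarrow> nat \<Rightarrow> real \<Rightarrow> complex" where
  "L_embed f = (\<lambda>_. f)"

text \<open>\<open>L_fourier D \<xi> F\<close>: the extended Fourier transform of \<open>\<xi>\<close> is the element \<open>F\<close> of \<open>L\<^sub>2(\<Delta>)\<close>.\<close>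

definition L_fourier ::
    "(real \<Rightarrow> real) \<Rightarrow> (nat \<Rightarrow> real \<Rightarrow> complex) \<Rightarrow> (real \<Rightarrow> complex) \<Rightarrow> bool" where
  "L_fourier D \<xi> F \<longleftrightarrow> F \<in> L2 (spectral_measure D) \<and>
     (\<lambda>k. L2_dist_sq (spectral_measure D) (fourier_L2 (\<xi> k)) F) \<longlonglongrightarrow> 0"

definition signed_indicator :: "real \<Rightarrow> real \<Rightarrow> complex" where
  "signed_indicator t = (if t \<ge> 0 then indicator {0..t} else (\<lambda>s. - indicator {t..0} s))"

text \<open>A unitary map of \<open>L\<^sub>\<Delta>\<close> onto the closed subspace \<open>V\<close> of \<open>L\<^sub>2(P)\<close>.\<close>

definition unitary_onto :: "(real \<Rightarrow> real) \<Rightarrow> 'w measure \<Rightarrow> ('w \<Rightarrow> complex) set \<Rightarrow>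
    ((nat \<Rightarrow> real \<Rightarrow> complex) \<Rightarrow> 'w \<Rightarrow> complex) \<Rightarrow> bool" where
  "unitary_onto D P V I \<longleftrightarrow>
     (\<forall>\<xi>\<in>L_space D. I \<xi> \<in> V) \<and>
     (\<forall>\<xi>\<in>L_space D. \<forall>\<eta>\<in>L_space D. AE \<omega> in P. I (L_add \<xi> \<eta>) \<omega> = I \<xi> \<omega> + I \<eta> \<omega>) \<and>
     (\<forall>c. \<forall>\<xi>\<in>L_space D. AE \<omega> in P. I (L_scale c \<xi>) \<omega> = c * I \<xi> \<omega>) \<and>
     (\<forall>\<xi>\<in>L_space D. \<forall>\<eta>\<in>L_space D. L2_inner P (I \<xi>) (I \<eta>) = L_inner D \<xi> \<eta>) \<and>
     (\<forall>Y\<in>V. \<exists>\<xi>\<in>L_space D. AE \<omega> in P. I \<xi> \<omega> = Y \<omega>)"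

definition stochastic_integral :: "(real \<Rightarrow> real) \<Rightarrow> 'w measure \<Rightarrow> (real \<Rightarrow> 'w \<Rightarrow> real) \<Rightarrow>
    ((nat \<Rightarrow> real \<Rightarrow> complex) \<Rightarrow> 'w \<Rightarrow> complex) \<Rightarrow> bool" where
  "stochastic_integral D P X I \<longleftrightarrow>
     unitary_onto D P (process_span P X UNIV) I \<and>
     (\<forall>t. AE \<omega> in P. I (L_embed (signed_indicator t)) \<omega> = of_real (X t \<omega>))"

definition e :: "int \<Rightarrow> real \<Rightarrow> complex" where
  "e n \<gamma> = 1 / of_real (sqrt pi) * (1 / (1 - \<i> * of_real \<gamma>)) *
     ((1 + \<i> * of_real \<gamma>) / (1 - \<i> * of_real \<gamma>)) powi n"

end

theory Submission
  imports Defs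
begin

text \<open>Multiplication by \<open>(\<gamma> - \<i>) cnj (h \<gamma>)\<close> carries \<open>L\<^sub>2(\<Delta>)\<close> isometrically into \<open>L\<^sub>2(d\<gamma>)\<close>, takes
  the transform of \<open>\<xi> n\<close> to \<open>e n\<close> and that of \<open>\<one>\<^sub>t\<close> to \<open>(\<gamma> - \<i>) z t cnj h\<close>.  The claims about spans thus
  become claims in \<open>L\<^sub>2(d\<gamma>)\<close>: the \<open>e n\<close> form an orthonormal basis, those with \<open>n < 0\<close> span
  \<open>H\<^sup>2\<^sup>-\<close> (they are transforms of functions supported on the negative half-line, and \<open>H\<^sup>2\<^sup>-\<close> is
  orthogonal to the others), and the weighted \<open>z t\<close> with \<open>t \<le> 0\<close> have the same closed span as
  \<open>exp (\<i> \<gamma> t) cnj h\<close>, \<open>t < 0\<close>, which is \<open>H\<^sup>2\<^sup>-\<close> because \<open>h\<close> is outer: both spans are invariant under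
  multiplication by \<open>exp (\<i> \<gamma> t)\<close>, \<open>t \<le> 0\<close>, hence by the resolvents \<open>1 / (\<epsilon> + \<i> \<gamma>)\<close>, which recover the
  exponentials from the increments of \<open>z t\<close> and conversely.
  For the conditional expectation, uncorrelated jointly Gaussian variables are independent.\<close>

section \<open>Square integrable functions and closed spans\<close>

text \<open>Nothing in the definition of \<open>hardy_lower\<close>, as transforms of functions on a
  half-line, makes it closed. Closedness is read off from the outer function hypothesis, which
  equates it with a closed span. That the \<open>e n\<close> with n < 0 lie in it then only asks for
  explicit functions with the right transforms; the converse combines orthogonality of opposite
  supports with completeness of all the \<open>e n\<close>. Three span claims share one mechanism:
  bounded functions that map a closed span into itself form an algebra stable under bounded
  pointwise limits. A few unimodular functions in it already generate indicators (completeness of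
  the \<open>e n\<close>, events of the past) or resolvents (the span of the weighted
  \<open>z t\<close>). Independence enters in the form of an identity: for jointly Gaussian Y and Z
  of mean 0, E[Y exp (\<i> Z)] is a multiple of E[Y Z]. Hence an element of the span orthogonal to
  the past values is orthogonal to the exponentials of all their real combinations, and these
  exponentials generate the \<sigma>-field.\<close>

lemma LIMSEQ_inverse_Suc: "(\<lambda>n. 1 / real (Suc n)) \<longlonglongrightarrow> 0"
  using LIMSEQ_inverse_real_of_nat by (simp add: inverse_eq_divide)

text \<open>Fixes the step sizes 1/(n+1), since dominated convergence and the limits of multipliers
  are formulated for sequences.\<close>

lemma DERIV_LIMSEQ:
  fixes f :: "'a :: real_normed_field \<Rightarrow> 'a"
  assumes "(f has_field_derivative D) (at 0)"
  shows "(\<lambda>n. (f (of_real (1 / real (Suc n))) - f 0) / of_real (1 / real (Suc n))) \<longlonglongrightarrow> D"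
proof -
  have l: "((\<lambda>w. (f (0 + w) - f 0) / w) \<longlongrightarrow> D) (at 0)" using assms by (simp add: DERIV_def)
  have "filterlim (\<lambda>n. of_real (1 / real (Suc n)) :: 'a) (at 0) sequentially"
  proof (rule filterlim_atI)
    show "(\<lambda>n. of_real (1 / real (Suc n)) :: 'a) \<longlonglongrightarrow> 0"
      using tendsto_of_real[OF LIMSEQ_inverse_Suc, where 'a = 'a] by simp
  qed (simp del: of_nat_Suc)
  from filterlim_compose[OF l this] show ?thesis by simp
qed

lemma L2_iff: "f \<in> L2 M \<longleftrightarrow> f \<in> borel_measurable M \<and> (\<integral>\<^sup>+x. ennreal ((cmod (f x))\<^sup>2) \<partial>M) < \<infinity>"
  by (auto simp: L2_def integrable_iff_bounded)

lemma L2_measurable [measurable_dest]: "f \<in> L2 M \<Longrightarrow> f \<in> borel_measurable M"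
  by (simp add: L2_def)

lemma L2_integrable: "f \<in> L2 M \<Longrightarrow> integrable M (\<lambda>x. (cmod (f x))\<^sup>2)"
  by (simp add: L2_def)

lemma L2_bound:
  assumes "f \<in> borel_measurable M" "integrable M w" "AE x in M. (cmod (f x))\<^sup>2 \<le> w x"
  shows "f \<in> L2 M"
proof -
  have "integrable M (\<lambda>x. (cmod (f x))\<^sup>2)"
    by (rule Bochner_Integration.integrable_bound[OF assms(2)]) (use assms in auto)
  then show ?thesis using assms by (simp add: L2_def)
qed

lemma L2_zero [simp]: "(\<lambda>x. 0) \<in> L2 M"
  by (simp add: L2_def)

lemma cmod_add_sq_le: "(cmod (a + b))\<^sup>2 \<le> 2 * (cmod a)\<^sup>2 + 2 * (cmod b)\<^sup>2"
proof -
  have "(cmod (a + b))\<^sup>2 \<le> (cmod a + cmod b)\<^sup>2"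
    by (simp add: norm_triangle_ineq power_mono)
  also have "\<dots> \<le> 2 * (cmod a)\<^sup>2 + 2 * (cmod b)\<^sup>2"
    using sum_squares_bound[of "cmod a" "cmod b"] by (simp add: power2_sum)
  finally show ?thesis .
qed

lemma L2_add: "f \<in> L2 M \<Longrightarrow> g \<in> L2 M \<Longrightarrow> (\<lambda>x. f x + g x) \<in> L2 M"
  by (rule L2_bound[where w = "\<lambda>x. 2 * (cmod (f x))\<^sup>2 + 2 * (cmod (g x))\<^sup>2"])
    (auto simp: L2_def intro: cmod_add_sq_le)

lemma L2_scale: "f \<in> L2 M \<Longrightarrow> (\<lambda>x. c * f x) \<in> L2 M"
  by (auto simp: L2_def norm_mult power_mult_distrib)

lemma L2_diff: "f \<in> L2 M \<Longrightarrow> g \<in> L2 M \<Longrightarrow> (\<lambda>x. f x - g x) \<in> L2 M"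
  using L2_add[of f M "\<lambda>x. (-1) * g x"] L2_scale[of g M "-1"] by simp

lemma L2_sum: "(\<And>i. i \<in> K \<Longrightarrow> b i \<in> L2 M) \<Longrightarrow> (\<lambda>x. \<Sum>i\<in>K. c i * b i x) \<in> L2 M"
  by (induction K rule: infinite_finite_induct) (auto intro!: L2_add L2_scale)

lemma borel_measurable_cnj [measurable]: "cnj \<in> borel_measurable borel"
  by (intro borel_measurable_continuous_onI continuous_intros)

lemma L2_cnj: "f \<in> L2 M \<Longrightarrow> (\<lambda>x. cnj (f x)) \<in> L2 M"
  by (auto simp: L2_def)

lemma L2_cong_AE:
  assumes "f \<in> L2 M" "g \<in> borel_measurable M" "AE x in M. f x = g x"
  shows "g \<in> L2 M"
  by (rule L2_bound[where w = "\<lambda>x. (cmod (f x))\<^sup>2"]) (use assms in \<open>auto simp: L2_integrable\<close>)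

lemma L2_inner_integrable:
  assumes "f \<in> L2 M" "g \<in> L2 M"
  shows "integrable M (\<lambda>x. f x * cnj (g x))"
proof (rule Bochner_Integration.integrable_bound)
  show "integrable M (\<lambda>x. (cmod (f x))\<^sup>2 + (cmod (g x))\<^sup>2)"
    using assms by (simp add: L2_def)
  show "(\<lambda>x. f x * cnj (g x)) \<in> borel_measurable M"
    using assms L2_cnj[OF assms(2)] by (auto dest!: L2_measurable)
  show "AE x in M. norm (f x * cnj (g x)) \<le> norm ((cmod (f x))\<^sup>2 + (cmod (g x))\<^sup>2)"
  proof (intro AE_I2)
    fix x
    have "2 * (cmod (f x) * cmod (g x)) \<le> (cmod (f x))\<^sup>2 + (cmod (g x))\<^sup>2"
      using sum_squares_bound[of "cmod (f x)" "cmod (g x)"] by simp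
    moreover have "0 \<le> cmod (f x) * cmod (g x)" by simp
    ultimately have "cmod (f x) * cmod (g x) \<le> (cmod (f x))\<^sup>2 + (cmod (g x))\<^sup>2" by linarith
    then show "norm (f x * cnj (g x)) \<le> norm ((cmod (f x))\<^sup>2 + (cmod (g x))\<^sup>2)"
      by (simp add: norm_mult)
  qed
qed

lemma L2_inner_commute: "L2_inner M g f = cnj (L2_inner M f g)"
proof -
  have "cnj (L2_inner M f g) = (\<integral>x. cnj (f x * cnj (g x)) \<partial>M)"
    unfolding L2_inner_def by (rule Bochner_Integration.integral_cnj[symmetric])
  then show ?thesis by (simp add: L2_inner_def mult.commute)
qed

lemma L2_inner_diff_left:
  "f \<in> L2 M \<Longrightarrow> g \<in> L2 M \<Longrightarrow> k \<in> L2 M \<Longrightarrow>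
    L2_inner M (\<lambda>x. f x - g x) k = L2_inner M f k - L2_inner M g k"
  unfolding L2_inner_def using L2_inner_integrable[of f M k] L2_inner_integrable[of g M k]
  by (simp add: left_diff_distrib)

lemma L2_inner_diff_right:
  "f \<in> L2 M \<Longrightarrow> g \<in> L2 M \<Longrightarrow> k \<in> L2 M \<Longrightarrow>
    L2_inner M k (\<lambda>x. f x - g x) = L2_inner M k f - L2_inner M k g"
  unfolding L2_inner_commute[of M k] by (simp add: L2_inner_diff_left)

lemma L2_inner_sum_left:
  fixes c :: "_ \<Rightarrow> complex"
  assumes "\<And>i. i \<in> K \<Longrightarrow> b i \<in> L2 M" "k \<in> L2 M"
  shows "L2_inner M (\<lambda>x. \<Sum>i\<in>K. c i * b i x) k = (\<Sum>i\<in>K. c i * L2_inner M (b i) k)"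
proof -
  have "L2_inner M (\<lambda>x. \<Sum>i\<in>K. c i * b i x) k = (\<integral>x. (\<Sum>i\<in>K. c i * (b i x * cnj (k x))) \<partial>M)"
    by (simp add: L2_inner_def sum_distrib_right mult.assoc)
  also have "\<dots> = (\<Sum>i\<in>K. c i * L2_inner M (b i) k)"
    using assms L2_inner_integrable
    by (subst Bochner_Integration.integral_sum)
      (auto simp: L2_inner_def intro!: integrable_mult_right)
  finally show ?thesis .
qed

lemma L2_inner_sum_right:
  fixes c :: "_ \<Rightarrow> complex"
  assumes "\<And>i. i \<in> K \<Longrightarrow> b i \<in> L2 M" "k \<in> L2 M"
  shows "L2_inner M k (\<lambda>x. \<Sum>i\<in>K. c i * b i x) = (\<Sum>i\<in>K. cnj (c i) * L2_inner M k (b i))"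
proof -
  have "L2_inner M k (\<lambda>x. \<Sum>i\<in>K. c i * b i x) = cnj (\<Sum>i\<in>K. c i * L2_inner M (b i) k)"
    using L2_inner_commute[of M k] L2_inner_sum_left[of K b M k c] assms by metis
  also have "\<dots> = (\<Sum>i\<in>K. cnj (c i) * cnj (L2_inner M (b i) k))" by simp
  also have "\<dots> = (\<Sum>i\<in>K. cnj (c i) * L2_inner M k (b i))"
    by (intro sum.cong refl arg_cong2[where f = "(*)"] L2_inner_commute[symmetric])
  finally show ?thesis .
qed

lemma L2_inner_self: "L2_inner M f f = of_real (\<integral>x. (cmod (f x))\<^sup>2 \<partial>M)"
proof -
  have "f x * cnj (f x) = of_real ((cmod (f x))\<^sup>2)" for x
    by (rule complex_norm_square[symmetric])
  then show ?thesis unfolding L2_inner_def by (simp only: integral_complex_of_real)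
qed

lemma L2_dist_sq_eq_inner:
  assumes "f \<in> L2 M" "g \<in> L2 M"
  shows "L2_dist_sq M f g = ennreal (Re (L2_inner M (\<lambda>x. f x - g x) (\<lambda>x. f x - g x)))"
  unfolding L2_inner_self L2_dist_sq_def
  using L2_diff[OF assms] by (simp add: nn_integral_eq_integral L2_integrable)

lemma L2_dist_sq_commute: "L2_dist_sq M f g = L2_dist_sq M g f"
  by (simp add: L2_dist_sq_def norm_minus_commute)

lemma L2_dist_sq_self [simp]: "L2_dist_sq M f f = 0"
  by (simp add: L2_dist_sq_def)

lemma L2_dist_sq_cong_AE:
  assumes "AE x in M. f x = f' x" "AE x in M. g x = g' x"
  shows "L2_dist_sq M f g = L2_dist_sq M f' g'"
  unfolding L2_dist_sq_def by (rule nn_integral_cong_AE) (use assms in auto)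

lemma L2_inner_cong_AE:
  assumes "AE x in M. f x = f' x" "AE x in M. g x = g' x"
    "f \<in> borel_measurable M" "g \<in> borel_measurable M"
    "f' \<in> borel_measurable M" "g' \<in> borel_measurable M"
  shows "L2_inner M f g = L2_inner M f' g'"
  unfolding L2_inner_def
  by (rule integral_cong_AE) (use assms in auto)

text \<open>Distances stay squared throughout, which costs a factor 2 in the triangle inequality and
  leaves convergence arguments unaffected.\<close>

lemma L2_dist_sq_triangle:
  assumes [measurable]: "f \<in> borel_measurable M" "g \<in> borel_measurable M" "k \<in> borel_measurable M"
  shows "L2_dist_sq M f k \<le> 2 * L2_dist_sq M f g + 2 * L2_dist_sq M g k"
proof -
  have "L2_dist_sq M f k \<le> (\<integral>\<^sup>+x. 2 * ennreal ((cmod (f x - g x))\<^sup>2) + 2 * ennreal ((cmod (g x - k x))\<^sup>2) \<partial>M)"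
    unfolding L2_dist_sq_def
  proof (rule nn_integral_mono)
    fix x
    have "(cmod (f x - k x))\<^sup>2 \<le> 2 * (cmod (f x - g x))\<^sup>2 + 2 * (cmod (g x - k x))\<^sup>2"
      using cmod_add_sq_le[of "f x - g x" "g x - k x"] by simp
    then have "ennreal ((cmod (f x - k x))\<^sup>2) \<le> ennreal (2 * (cmod (f x - g x))\<^sup>2 + 2 * (cmod (g x - k x))\<^sup>2)"
      by (rule ennreal_leI)
    then show "ennreal ((cmod (f x - k x))\<^sup>2) \<le> 2 * ennreal ((cmod (f x - g x))\<^sup>2) + 2 * ennreal ((cmod (g x - k x))\<^sup>2)"
      by (simp add: ennreal_mult' ennreal_plus)
  qed
  also have "\<dots> = 2 * L2_dist_sq M f g + 2 * L2_dist_sq M g k"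
    by (simp add: L2_dist_sq_def nn_integral_add nn_integral_cmult)
  finally show ?thesis .
qed

lemma L2_dominated:
  assumes [measurable]: "\<And>n. s n \<in> borel_measurable M" "f \<in> borel_measurable M"
    and w: "integrable M w"
    and bound: "\<And>n. AE x in M. (cmod (s n x))\<^sup>2 \<le> w x"
    and lim: "AE x in M. (\<lambda>n. s n x) \<longlonglongrightarrow> f x"
  shows "f \<in> L2 M" "(\<lambda>n. L2_dist_sq M f (s n)) \<longlonglongrightarrow> 0"
proof -
  have bound': "AE x in M. \<forall>n. (cmod (s n x))\<^sup>2 \<le> w x"
    using bound by (simp add: AE_all_countable)
  have fw: "AE x in M. (cmod (f x))\<^sup>2 \<le> w x"
    using bound' lim
  proof eventually_elim
    case (elim x)
    show ?case
      by (rule LIMSEQ_le_const2[of "\<lambda>n. (cmod (s n x))\<^sup>2"]) (use elim in \<open>auto intro!: tendsto_intros\<close>)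
  qed
  show f: "f \<in> L2 M" by (rule L2_bound[OF _ w fw]) simp
  have wm [measurable]: "w \<in> borel_measurable M" using w by auto
  have "(\<lambda>n. \<integral>\<^sup>+x. ennreal ((cmod (f x - s n x))\<^sup>2) \<partial>M) \<longlonglongrightarrow> (\<integral>\<^sup>+x. 0 \<partial>M)"
  \<comment> \<open>The limit inherits the bound w, so |f - s n|^2 \<le> 2 |f|^2 + 2 |s n|^2 \<le> 4
    w.\<close>
  proof (rule nn_integral_dominated_convergence[where w = "\<lambda>x. ennreal (4 * w x)"])
    show "AE x in M. ennreal ((cmod (f x - s n x))\<^sup>2) \<le> ennreal (4 * w x)" for n
      using bound' fw
    proof eventually_elim
      case (elim x)
      have "(cmod (f x - s n x))\<^sup>2 \<le> 2 * (cmod (f x))\<^sup>2 + 2 * (cmod (s n x))\<^sup>2"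
        using cmod_add_sq_le[of "f x" "- s n x"] by simp
      also have "\<dots> \<le> 4 * w x" using elim(1)[rule_format, of n] elim(2) by linarith
      finally show ?case by (rule ennreal_leI)
    qed
    have "integrable M (\<lambda>x. 4 * w x)" using w by simp
    then show "(\<integral>\<^sup>+x. ennreal (4 * w x) \<partial>M) < \<infinity>"
      unfolding real_integrable_def by (simp add: less_top)
    show "AE x in M. (\<lambda>n. ennreal ((cmod (f x - s n x))\<^sup>2)) \<longlonglongrightarrow> 0"
      using lim
    proof eventually_elim
      case (elim x)
      have "(\<lambda>n. (cmod (f x - s n x))\<^sup>2) \<longlonglongrightarrow> (cmod (f x - f x))\<^sup>2"
        by (intro tendsto_intros elim)
      then show ?case using tendsto_ennrealI by fastforce
    qed
  qed auto
  then show "(\<lambda>n. L2_dist_sq M f (s n)) \<longlonglongrightarrow> 0" by (simp add: L2_dist_sq_def)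
qed

section \<open>Closed linear spans\<close>

lemma L2_closed_span_subset: "L2_closed_span M S \<subseteq> L2 M"
  by (auto simp: L2_closed_span_def)

lemma span_combination_in_L2_closed_span:
  assumes "S \<subseteq> L2 M" "finite F" "F \<subseteq> S"
  shows "(\<lambda>x. \<Sum>g\<in>F. c g * g x) \<in> L2_closed_span M S"
  using assms L2_sum[of F "\<lambda>g. g" M c] unfolding L2_closed_span_def
  by (auto intro!: exI[of _ F] exI[of _ c])

lemma L2_closed_span_superset: "S \<subseteq> L2 M \<Longrightarrow> f \<in> S \<Longrightarrow> f \<in> L2_closed_span M S"
  using span_combination_in_L2_closed_span[of S M "{f}" "\<lambda>_. 1"] by simp

text \<open>Quarters absorb the factor 2 of the squared triangle inequality on each of its two
  terms. Infinite \<epsilon> is included because closed spans quantify over all positive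
  \<open>ennreal\<close>.\<close>

lemma ennreal_quarter_bound:
  assumes "(a::ennreal) < \<epsilon> / 4" "b < \<epsilon> / 4" "\<epsilon> > 0"
  shows "2 * a + 2 * b < \<epsilon>"
proof (cases "\<epsilon> = top")
  case True
  then show ?thesis using assms
    by (simp add: ennreal_mult_less_top less_top ennreal_top_divide)
next
  case False
  then obtain e where e: "\<epsilon> = ennreal e" "e > 0" using assms(3)
    by (cases \<epsilon>) (auto simp: )
  have e4: "\<epsilon> / 4 = ennreal (e/4)" using e
    by (simp add: ennreal_divide_numeral)
  obtain a' b' where "a = ennreal a'" "b = ennreal b'" "a' \<ge> 0" "b' \<ge> 0"
    using assms e4 by (metis ennreal_cases ennreal_less_top not_less_iff_gr_or_eq order_less_trans)
  then show ?thesis using assms e unfolding e4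
    by (simp add: ennreal_less_iff flip: ennreal_numeral ennreal_mult ennreal_plus)
qed

lemma L2_closed_span_closed:
  assumes S: "S \<subseteq> L2 M" and f: "f \<in> L2 M"
    and approx: "\<And>\<epsilon>::ennreal. \<epsilon> > 0 \<Longrightarrow> \<exists>g\<in>L2_closed_span M S. L2_dist_sq M f g < \<epsilon>"
  shows "f \<in> L2_closed_span M S"
  unfolding L2_closed_span_def
proof (intro CollectI conjI f allI impI)
  fix \<epsilon> :: ennreal assume \<epsilon>: "0 < \<epsilon>"
  then have \<epsilon>4: "\<epsilon> / 4 > 0" by (simp add: ennreal_zero_less_divide)
  obtain g where g: "g \<in> L2_closed_span M S" "L2_dist_sq M f g < \<epsilon> / 4"
    using approx[OF \<epsilon>4] by auto
  obtain F c where F: "finite F" "F \<subseteq> S" "L2_dist_sq M g (\<lambda>x. \<Sum>g\<in>F. c g * g x) < \<epsilon> / 4"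
    using g(1) \<epsilon>4 unfolding L2_closed_span_def by auto
  have "(\<lambda>x. \<Sum>g\<in>F. c g * g x) \<in> L2 M" by (rule L2_sum) (use F S in auto)
  then have "L2_dist_sq M f (\<lambda>x. \<Sum>g\<in>F. c g * g x)
      \<le> 2 * L2_dist_sq M f g + 2 * L2_dist_sq M g (\<lambda>x. \<Sum>g\<in>F. c g * g x)"
    using f g L2_closed_span_subset by (intro L2_dist_sq_triangle) (auto dest: L2_measurable)
  also have "\<dots> < \<epsilon>" by (rule ennreal_quarter_bound) (use g F \<epsilon> in auto)
  finally show "\<exists>F c. finite F \<and> F \<subseteq> S \<and> L2_dist_sq M f (\<lambda>x. \<Sum>g\<in>F. c g * g x) < \<epsilon>"
    using F by auto
qed

lemma L2_closed_span_lim: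
  assumes S: "S \<subseteq> L2 M" and f: "f \<in> L2 M"
    and "\<And>n. s n \<in> L2_closed_span M S" and lim: "(\<lambda>n. L2_dist_sq M f (s n)) \<longlonglongrightarrow> 0"
  shows "f \<in> L2_closed_span M S"
proof (rule L2_closed_span_closed[OF S f])
  fix \<epsilon> :: ennreal assume "\<epsilon> > 0"
  then have "\<forall>\<^sub>F n in sequentially. L2_dist_sq M f (s n) < \<epsilon>" using lim by (rule order_tendstoD(2)[rotated])
  then show "\<exists>g\<in>L2_closed_span M S. L2_dist_sq M f g < \<epsilon>"
    using assms(3) by (auto simp: eventually_sequentially)
qed

lemma L2_closed_span_cong_AE:
  assumes S: "S \<subseteq> L2 M" and "f \<in> L2_closed_span M S" "g \<in> borel_measurable M" "AE x in M. f x = g x"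
  shows "g \<in> L2_closed_span M S"
proof (rule L2_closed_span_lim[OF S, where s = "\<lambda>_. f"])
  show "g \<in> L2 M" using assms L2_cong_AE L2_closed_span_subset by blast
  have "L2_dist_sq M g f = L2_dist_sq M g g" by (rule L2_dist_sq_cong_AE) (use assms in auto)
  then show "(\<lambda>n. L2_dist_sq M g f) \<longlonglongrightarrow> 0" by simp
qed (use assms in auto)

text \<open>Combinations in the definition run over sets of functions, while Gram matrices need
  indices. The family b may repeat functions, so coefficients have to be redistributed.\<close>

lemma L2_closed_span_image_iff:
  "f \<in> L2_closed_span M (b ` J) \<longleftrightarrow> f \<in> L2 M \<and>
    (\<forall>\<epsilon>>0. \<exists>K c. finite K \<and> K \<subseteq> J \<and> L2_dist_sq M f (\<lambda>x. \<Sum>i\<in>K. c i * b i x) < \<epsilon>)"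
proof -
  have "(\<exists>F c. finite F \<and> F \<subseteq> b ` J \<and> L2_dist_sq M f (\<lambda>x. \<Sum>g\<in>F. c g * g x) < \<epsilon>) \<longleftrightarrow>
        (\<exists>K c. finite K \<and> K \<subseteq> J \<and> L2_dist_sq M f (\<lambda>x. \<Sum>i\<in>K. c i * b i x) < \<epsilon>)" for \<epsilon>
  proof
    assume "\<exists>F c. finite F \<and> F \<subseteq> b ` J \<and> L2_dist_sq M f (\<lambda>x. \<Sum>g\<in>F. c g * g x) < \<epsilon>"
    then obtain F c where F: "finite F" "F \<subseteq> b ` J" "L2_dist_sq M f (\<lambda>x. \<Sum>g\<in>F. c g * g x) < \<epsilon>" by auto
    \<comment> \<open>One index is kept per function, so that b is injective on K and the
      coefficients can be pulled back.\<close>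
    then obtain K where K: "K \<subseteq> J" "finite K" "F = b ` K" "inj_on b K"
      unfolding subset_image_inj using finite_imageD by blast
    then show "\<exists>K c. finite K \<and> K \<subseteq> J \<and> L2_dist_sq M f (\<lambda>x. \<Sum>i\<in>K. c i * b i x) < \<epsilon>"
      using F by (intro exI[of _ K] exI[of _ "c \<circ> b"]) (auto simp: sum.reindex)
  next
    assume "\<exists>K c. finite K \<and> K \<subseteq> J \<and> L2_dist_sq M f (\<lambda>x. \<Sum>i\<in>K. c i * b i x) < \<epsilon>"
    then obtain K c where K: "finite K" "K \<subseteq> J" "L2_dist_sq M f (\<lambda>x. \<Sum>i\<in>K. c i * b i x) < \<epsilon>" by auto
    \<comment> \<open>Indices that carry the same function pool their coefficients.\<close>
    have "(\<Sum>i\<in>K. c i * b i x) = (\<Sum>g\<in>b ` K. (\<Sum>i\<in>{i\<in>K. b i = g}. c i) * g x)" for x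
      unfolding sum.image_gen[OF K(1), of "\<lambda>i. c i * b i x" b]
      by (auto simp: sum_distrib_right intro!: sum.cong)
    then show "\<exists>F c. finite F \<and> F \<subseteq> b ` J \<and> L2_dist_sq M f (\<lambda>x. \<Sum>g\<in>F. c g * g x) < \<epsilon>"
      using K by (intro exI[of _ "b ` K"] exI[of _ "\<lambda>g. \<Sum>i\<in>{i\<in>K. b i = g}. c i"]) auto
  qed
  then show ?thesis by (simp add: L2_closed_span_def)
qed

lemma ennreal_tendsto_0_le:
  assumes "f \<longlonglongrightarrow> (0::ennreal)" "\<And>n. g n \<le> f n"
  shows "g \<longlonglongrightarrow> 0"
  by (rule tendsto_sandwich[OF _ _ tendsto_const assms(1)]) (use assms(2) in auto)

lemma L2_closed_span_sequence:
  assumes "f \<in> L2_closed_span M (b ` J)"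
  obtains K c where "\<And>n::nat. finite (K n)" "\<And>n. K n \<subseteq> J"
    "(\<lambda>n. L2_dist_sq M f (\<lambda>x. \<Sum>i\<in>K n. c n i * b i x)) \<longlonglongrightarrow> 0"
proof -
  have "\<forall>n. \<exists>K c. finite K \<and> K \<subseteq> J \<and> L2_dist_sq M f (\<lambda>x. \<Sum>i\<in>K. c i * b i x) < ennreal (1 / Suc n)"
    using assms unfolding L2_closed_span_image_iff by auto
  then obtain K c where K: "\<And>n. finite (K n)" "\<And>n. K n \<subseteq> J"
      "\<And>n. L2_dist_sq M f (\<lambda>x. \<Sum>i\<in>K n. c n i * b i x) < ennreal (1 / Suc n)"
    by metis
  have "(\<lambda>n. ennreal (1 / Suc n)) \<longlonglongrightarrow> 0"
    using tendsto_ennrealI[OF LIMSEQ_inverse_Suc] by simp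
  from ennreal_tendsto_0_le[OF this less_imp_le[OF K(3)]] show ?thesis by (rule that[OF K(1,2)])
qed

lemma L2_bounded_mult:
  assumes f: "f \<in> L2 M" and [measurable]: "m \<in> borel_measurable M" and B: "\<And>x. x \<in> space M \<Longrightarrow> cmod (m x) \<le> B"
  shows "(\<lambda>x. m x * f x) \<in> L2 M"
proof (rule L2_bound[where w = "\<lambda>x. B\<^sup>2 * (cmod (f x))\<^sup>2"])
  show "(\<lambda>x. m x * f x) \<in> borel_measurable M" using L2_measurable[OF f] by simp
  show "integrable M (\<lambda>x. B\<^sup>2 * (cmod (f x))\<^sup>2)" using L2_integrable[OF f] by simp
  show "AE x in M. (cmod (m x * f x))\<^sup>2 \<le> B\<^sup>2 * (cmod (f x))\<^sup>2"
    using B by (auto simp: norm_mult power_mult_distrib intro!: mult_right_mono power_mono)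
qed

text \<open>Multiplication by m is bounded on L2 with constant B, hence continuous, so membership
  only has to be checked on finite combinations.\<close>

lemma L2_closed_span_bounded_image:
  assumes S: "S \<subseteq> L2 M" and T: "T \<subseteq> L2 M"
    and m [measurable]: "m \<in> borel_measurable M" and B: "\<And>x. x \<in> space M \<Longrightarrow> cmod (m x) \<le> B"
    and gen: "\<And>F c. finite F \<Longrightarrow> F \<subseteq> S \<Longrightarrow> (\<lambda>x. m x * (\<Sum>g\<in>F. c g * g x)) \<in> L2_closed_span M T"
    and f: "f \<in> L2_closed_span M S"
  shows "(\<lambda>x. m x * f x) \<in> L2_closed_span M T"
proof -
  have fL: "f \<in> L2 M" using f L2_closed_span_subset by auto
  obtain F c where F: "\<And>n. finite (F n)" "\<And>n. F n \<subseteq> S"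
      "(\<lambda>n. L2_dist_sq M f (\<lambda>x. \<Sum>g\<in>F n. c n g * g x)) \<longlonglongrightarrow> 0"
    using L2_closed_span_sequence[of f M "\<lambda>g. g" S] f by auto
  let ?s = "\<lambda>n x. \<Sum>g\<in>F n. c n g * g x"
  have "?s n \<in> L2 M" for n by (rule L2_sum) (use F S in auto)
  then have [measurable]: "?s n \<in> borel_measurable M" "f \<in> borel_measurable M" for n
    using fL by (auto dest: L2_measurable)
  show ?thesis
  proof (rule L2_closed_span_lim[OF T L2_bounded_mult[OF fL m B] gen[OF F(1,2)]])
    have le: "L2_dist_sq M (\<lambda>x. m x * f x) (\<lambda>x. m x * ?s n x) \<le> ennreal (B\<^sup>2) * L2_dist_sq M f (?s n)" for n
    proof -
      have "L2_dist_sq M (\<lambda>x. m x * f x) (\<lambda>x. m x * ?s n x) \<le> (\<integral>\<^sup>+x. ennreal (B\<^sup>2) * ennreal ((cmod (f x - ?s n x))\<^sup>2) \<partial>M)"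
        unfolding L2_dist_sq_def
      proof (rule nn_integral_mono)
        fix x assume "x \<in> space M"
        then have "(cmod (m x * f x - m x * ?s n x))\<^sup>2 \<le> B\<^sup>2 * (cmod (f x - ?s n x))\<^sup>2"
          using power_mono[OF B norm_ge_zero, of x 2]
          by (simp add: norm_mult power_mult_distrib mult_right_mono flip: right_diff_distrib)
        then show "ennreal ((cmod (m x * f x - m x * ?s n x))\<^sup>2) \<le> ennreal (B\<^sup>2) * ennreal ((cmod (f x - ?s n x))\<^sup>2)"
          by (subst ennreal_mult[symmetric]) (auto intro: ennreal_leI)
      qed
      then show ?thesis unfolding L2_dist_sq_def by (simp add: nn_integral_cmult)
    qed
    have "(\<lambda>n. ennreal (B\<^sup>2) * L2_dist_sq M f (?s n)) \<longlonglongrightarrow> ennreal (B\<^sup>2) * 0"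
      by (intro ennreal_tendsto_cmult F(3)) simp
    then show "(\<lambda>n. L2_dist_sq M (\<lambda>x. m x * f x) (\<lambda>x. m x * ?s n x)) \<longlonglongrightarrow> 0"
      unfolding mult_zero_right using le by (rule ennreal_tendsto_0_le)
  qed
qed

lemma L2_closed_span_scale:
  assumes S: "S \<subseteq> L2 M" and f: "f \<in> L2_closed_span M S"
  shows "(\<lambda>x. c * f x) \<in> L2_closed_span M S"
proof (rule L2_closed_span_bounded_image[OF S S _ _ _ f])
  show "(\<lambda>x. c * (\<Sum>g\<in>F. d g * g x)) \<in> L2_closed_span M S" if "finite F" "F \<subseteq> S" for F d
    using span_combination_in_L2_closed_span[OF S that, of "\<lambda>g. c * d g"] by (simp add: sum_distrib_left mult.assoc)
qed auto

text \<open>A common index collects both coefficients. The same rewriting later adjoins one more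
  variable to a combination of process values.\<close>

lemma sum_Un_coefficients:
  fixes f :: "'a \<Rightarrow> 'b :: comm_semiring_1"
  assumes "finite K" "finite L"
  shows "(\<Sum>t\<in>K \<union> L. ((if t \<in> K then a t else 0) + (if t \<in> L then b t else 0)) * f t) = (\<Sum>t\<in>K. a t * f t) + (\<Sum>t\<in>L. b t * f t)"
proof -
  have "(\<Sum>t\<in>K \<union> L. ((if t \<in> K then a t else 0) + (if t \<in> L then b t else 0)) * f t) =
      (\<Sum>t\<in>K \<union> L. if t \<in> K then a t * f t else 0) + (\<Sum>t\<in>K \<union> L. if t \<in> L then b t * f t else 0)"
    unfolding sum.distrib[symmetric] by (rule sum.cong) (auto simp: algebra_simps)
  also have "\<dots> = (\<Sum>t\<in>K. a t * f t) + (\<Sum>t\<in>L. b t * f t)"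
    using assms by (intro arg_cong2[where f = "(+)"] sum.mono_neutral_cong_right) auto
  finally show ?thesis .
qed

lemma L2_closed_span_add:
  assumes S: "S \<subseteq> L2 M" and f: "f \<in> L2_closed_span M S" and g: "g \<in> L2_closed_span M S"
  shows "(\<lambda>x. f x + g x) \<in> L2_closed_span M S"
proof (rule L2_closed_span_closed[OF S])
  have L: "f \<in> L2 M" "g \<in> L2 M" using f g L2_closed_span_subset by auto
  show "(\<lambda>x. f x + g x) \<in> L2 M" using L by (rule L2_add)
  fix \<epsilon> :: ennreal assume \<epsilon>: "\<epsilon> > 0"
  then have \<epsilon>4: "\<epsilon> / 4 > 0" by (simp add: ennreal_zero_less_divide)
  obtain F c where F: "finite F" "F \<subseteq> S" "L2_dist_sq M f (\<lambda>x. \<Sum>k\<in>F. c k * k x) < \<epsilon> / 4"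
    using f \<epsilon>4 unfolding L2_closed_span_def by auto
  obtain G d where G: "finite G" "G \<subseteq> S" "L2_dist_sq M g (\<lambda>x. \<Sum>k\<in>G. d k * k x) < \<epsilon> / 4"
    using g \<epsilon>4 unfolding L2_closed_span_def by auto
  let ?f = "\<lambda>x. \<Sum>k\<in>F. c k * k x" and ?g = "\<lambda>x. \<Sum>k\<in>G. d k * k x"
  have L': "?f \<in> L2 M" "?g \<in> L2 M" by (rule L2_sum; use F G S in auto)+
  have [measurable]: "f \<in> borel_measurable M" "g \<in> borel_measurable M"
      "?f \<in> borel_measurable M" "?g \<in> borel_measurable M"
    using L L' by (auto dest: L2_measurable)
  let ?c = "\<lambda>k. (if k \<in> F then c k else 0) + (if k \<in> G then d k else 0)"
  have "L2_dist_sq M (\<lambda>x. f x + g x) (\<lambda>x. ?f x + ?g x) \<le>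
     2 * L2_dist_sq M (\<lambda>x. f x + g x) (\<lambda>x. ?f x + g x) + 2 * L2_dist_sq M (\<lambda>x. ?f x + g x) (\<lambda>x. ?f x + ?g x)"
    by (rule L2_dist_sq_triangle) auto
  also have "\<dots> = 2 * L2_dist_sq M f ?f + 2 * L2_dist_sq M g ?g"
    by (simp add: L2_dist_sq_def)
  also have "\<dots> < \<epsilon>" by (rule ennreal_quarter_bound) (use F G \<epsilon> in auto)
  finally show "\<exists>k\<in>L2_closed_span M S. L2_dist_sq M (\<lambda>x. f x + g x) k < \<epsilon>"
    using span_combination_in_L2_closed_span[OF S, of "F \<union> G" ?c] F G
    unfolding sum_Un_coefficients[OF F(1) G(1)] by auto
qed

lemma L2_closed_span_sum:
  assumes S: "S \<subseteq> L2 M" and "\<And>i. i \<in> K \<Longrightarrow> b i \<in> L2_closed_span M S"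
  shows "(\<lambda>x. \<Sum>i\<in>K. c i * b i x) \<in> L2_closed_span M S"
  using assms(2)
proof (induction K rule: infinite_finite_induct)
  case (infinite K)
  then show ?case using span_combination_in_L2_closed_span[OF S, of "{}"] by simp
next
  case empty
  then show ?case using span_combination_in_L2_closed_span[OF S, of "{}"] by simp
next
  case (insert i K)
  then show ?case by (simp add: L2_closed_span_add[OF S] L2_closed_span_scale[OF S])
qed

lemma L2_closed_span_diff:
  assumes S: "S \<subseteq> L2 M" and f: "f \<in> L2_closed_span M S" and g: "g \<in> L2_closed_span M S"
  shows "(\<lambda>x. f x - g x) \<in> L2_closed_span M S"
  using L2_closed_span_add[OF S f L2_closed_span_scale[OF S g, of "-1"]] by simp

lemma L2_closed_span_minimal:
  assumes T: "T \<subseteq> L2 M" and S: "S \<subseteq> L2_closed_span M T"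
  shows "L2_closed_span M S \<subseteq> L2_closed_span M T"
proof
  fix f assume f: "f \<in> L2_closed_span M S"
  show "f \<in> L2_closed_span M T"
  proof (rule L2_closed_span_closed[OF T])
    show "f \<in> L2 M" using f L2_closed_span_subset by auto
    fix \<epsilon> :: ennreal assume "\<epsilon> > 0"
    then obtain F c where F: "finite F" "F \<subseteq> S" "L2_dist_sq M f (\<lambda>x. \<Sum>k\<in>F. c k * k x) < \<epsilon>"
      using f unfolding L2_closed_span_def by auto
    then show "\<exists>g\<in>L2_closed_span M T. L2_dist_sq M f g < \<epsilon>"
      using L2_closed_span_sum[OF T, of F "\<lambda>k. k" c] S by auto
  qed
qed

lemma L2_closed_span_mono:
  assumes T: "T \<subseteq> L2 M" and "S \<subseteq> T"
  shows "L2_closed_span M S \<subseteq> L2_closed_span M T"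
  using assms by (intro L2_closed_span_minimal) (auto intro: L2_closed_span_superset)

section \<open>Gram matrices, continuity of the inner product, orthonormal families\<close>

lemma L2_dist_sq_combination:
  assumes f: "f \<in> L2 M" and b: "\<And>i. i \<in> K \<Longrightarrow> b i \<in> L2 M"
  shows "L2_dist_sq M f (\<lambda>x. \<Sum>i\<in>K. c i * b i x) =
    ennreal (Re (L2_inner M f f - (\<Sum>i\<in>K. cnj (c i) * L2_inner M f (b i)) - (\<Sum>i\<in>K. c i * L2_inner M (b i) f)
       + (\<Sum>i\<in>K. c i * (\<Sum>j\<in>K. cnj (c j) * L2_inner M (b i) (b j)))))"
proof -
  let ?g = "\<lambda>x. \<Sum>i\<in>K. c i * b i x"
  have g: "?g \<in> L2 M" by (rule L2_sum) (use b in auto)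
  have "L2_inner M (\<lambda>x. f x - ?g x) (\<lambda>x. f x - ?g x) =
      L2_inner M f f - L2_inner M f ?g - L2_inner M ?g f + L2_inner M ?g ?g"
    by (simp add: L2_inner_diff_left L2_inner_diff_right L2_diff f g)
  moreover have "L2_inner M f ?g = (\<Sum>i\<in>K. cnj (c i) * L2_inner M f (b i))"
    by (rule L2_inner_sum_right) (use f b in auto)
  moreover have "L2_inner M ?g f = (\<Sum>i\<in>K. c i * L2_inner M (b i) f)"
    by (rule L2_inner_sum_left) (use f b in auto)
  moreover have "L2_inner M ?g ?g = (\<Sum>i\<in>K. c i * (\<Sum>j\<in>K. cnj (c j) * L2_inner M (b i) (b j)))"
    using b g by (simp add: L2_inner_sum_left L2_inner_sum_right cong: sum.cong)
  ultimately show ?thesis by (simp add: L2_dist_sq_eq_inner[OF f g])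
qed

text \<open>Distances between linear combinations are determined by the Gram matrix, so no linear map
  between the two spaces is needed.\<close>

lemma L2_closed_span_gram_transfer:
  assumes "\<And>i. b i \<in> L2 M" "\<And>i. b' i \<in> L2 N"
    and "\<And>i j. L2_inner M (b i) (b j) = L2_inner N (b' i) (b' j)"
  shows "b i \<in> L2_closed_span M (b ` J) \<longleftrightarrow> b' i \<in> L2_closed_span N (b' ` J)"
  by (simp add: L2_closed_span_image_iff L2_dist_sq_combination assms)

text \<open>The modulus of the inner product is dominated by the integral of |f| |g|; the inequality
  for nonnegative integrals is then applied to squares in \<open>ennreal\<close>.\<close>

lemma L2_inner_Cauchy_Schwarz:
  assumes f: "f \<in> L2 M" and g: "g \<in> L2 M"
  shows "cmod (L2_inner M f g) \<le> sqrt (\<integral>x. (cmod (f x))\<^sup>2 \<partial>M) * sqrt (\<integral>x. (cmod (g x))\<^sup>2 \<partial>M)"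
proof -
  let ?N = "\<lambda>f. \<integral>x. (cmod (f x))\<^sup>2 \<partial>M"
  have N: "(\<integral>\<^sup>+x. (ennreal (cmod (k x)))\<^sup>2 \<partial>M) = ennreal (?N k)" if "k \<in> L2 M" for k
    using nn_integral_eq_integral[OF L2_integrable[OF that]] by (simp add: ennreal_power)
  have [measurable]: "f \<in> borel_measurable M" "g \<in> borel_measurable M" using f g by (auto dest: L2_measurable)
  have "ennreal (cmod (L2_inner M f g)) \<le> (\<integral>\<^sup>+x. ennreal (cmod (f x)) * ennreal (cmod (g x)) \<partial>M)"
    using integral_norm_bound_ennreal[OF L2_inner_integrable[OF f g]] by (simp add: L2_inner_def norm_mult ennreal_mult)
  then have "(ennreal (cmod (L2_inner M f g)))\<^sup>2 \<le> (\<integral>\<^sup>+x. ennreal (cmod (f x)) * ennreal (cmod (g x)) \<partial>M)\<^sup>2"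
    by (rule power_mono) simp
  also have "\<dots> \<le> ennreal (?N f) * ennreal (?N g)"
    unfolding N[OF f, symmetric] N[OF g, symmetric] by (rule Cauchy_Schwarz_nn_integral) simp_all
  finally have "(cmod (L2_inner M f g))\<^sup>2 \<le> ?N f * ?N g"
    by (simp add: ennreal_power flip: ennreal_mult)
  then show ?thesis unfolding real_sqrt_mult[symmetric] by (rule real_le_rsqrt)
qed

lemma L2_inner_tendsto:
  assumes s: "\<And>n. s n \<in> L2 M" and f: "f \<in> L2 M" and t: "\<And>n. t n \<in> L2 M" and g: "g \<in> L2 M"
    and lims: "(\<lambda>n. L2_dist_sq M (s n) f) \<longlonglongrightarrow> 0" and limt: "(\<lambda>n. L2_dist_sq M (t n) g) \<longlonglongrightarrow> 0"
  shows "(\<lambda>n. L2_inner M (s n) (t n)) \<longlonglongrightarrow> L2_inner M f g"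
proof (rule LIM_zero_cancel, rule Lim_null_comparison)
  let ?N = "\<lambda>f. sqrt (\<integral>x. (cmod (f x))\<^sup>2 \<partial>M)"
  let ?a = "\<lambda>n x. s n x - f x" and ?b = "\<lambda>n x. t n x - g x"
  have a: "?a n \<in> L2 M" and b: "?b n \<in> L2 M" for n using assms by (auto intro: L2_diff)
  \<comment> \<open>Expansion about the limit: each of the three terms contains a difference that
    tends to 0, and Cauchy-Schwarz bounds it.\<close>
  have "L2_inner M (s n) (t n) - L2_inner M f g = L2_inner M (?a n) (?b n) + L2_inner M f (?b n) + L2_inner M (?a n) g" for n
    using a b by (simp add: L2_inner_diff_left L2_inner_diff_right assms)
  then show "\<forall>\<^sub>F n in sequentially. norm (L2_inner M (s n) (t n) - L2_inner M f g) \<le> ?N (?a n) * ?N (?b n) + ?N f * ?N (?b n) + ?N (?a n) * ?N g"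
    using a b f g by (auto intro!: always_eventually norm_triangle_mono L2_inner_Cauchy_Schwarz)
  have N: "(\<lambda>n. ?N (\<lambda>x. u n x - k x)) \<longlonglongrightarrow> 0"
    if "\<And>n. u n \<in> L2 M" "k \<in> L2 M" "(\<lambda>n. L2_dist_sq M (u n) k) \<longlonglongrightarrow> 0" for u k
    using that tendsto_ennreal_iff[of "\<lambda>n. \<integral>x. (cmod (u n x - k x))\<^sup>2 \<partial>M" sequentially 0] tendsto_real_sqrt
    by (fastforce simp: L2_dist_sq_eq_inner L2_inner_self)
  have "(\<lambda>n. ?N (?a n) * ?N (?b n) + ?N f * ?N (?b n) + ?N (?a n) * ?N g) \<longlonglongrightarrow> 0 * 0 + ?N f * 0 + 0 * ?N g"
    by (intro tendsto_intros N assms)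
  then show "(\<lambda>n. ?N (?a n) * ?N (?b n) + ?N f * ?N (?b n) + ?N (?a n) * ?N g) \<longlonglongrightarrow> 0" by simp
qed

lemma L2_closed_span_inner_zero:
  assumes f: "f \<in> L2 M" and S: "S \<subseteq> L2 M" "\<And>g. g \<in> S \<Longrightarrow> L2_inner M f g = 0"
    and g: "g \<in> L2_closed_span M S"
  shows "L2_inner M f g = 0"
proof -
  obtain F c where F: "\<And>n. finite (F n)" "\<And>n. F n \<subseteq> S" "(\<lambda>n. L2_dist_sq M g (\<lambda>x. \<Sum>k\<in>F n. c n k * k x)) \<longlonglongrightarrow> 0"
    using L2_closed_span_sequence[of g M "\<lambda>g. g" S] g by auto
  let ?s = "\<lambda>n x. \<Sum>k\<in>F n. c n k * k x"
  have L: "?s n \<in> L2 M" for n by (rule L2_sum) (use F S in auto)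
  have "L2_inner M f (?s n) = (\<Sum>k\<in>F n. cnj (c n k) * L2_inner M f k)" for n
    by (rule L2_inner_sum_right) (use F S f in auto)
  moreover have "L2_inner M f k = 0" if "k \<in> F n" for k n using F(2) S(2) that by blast
  ultimately have zero: "L2_inner M f (?s n) = 0" for n by simp
  have "(\<lambda>n. L2_inner M f (?s n)) \<longlonglongrightarrow> L2_inner M f g"
    using F(3) g L2_closed_span_subset
    by (intro L2_inner_tendsto L f) (auto simp: L2_dist_sq_commute[of M _ g])
  then show ?thesis by (simp add: zero LIMSEQ_const_iff)
qed

text \<open>Dropping the terms orthogonal to \<open>f\<close> from a linear combination decreases its distance to \<open>f\<close>.\<close>

lemma L2_closed_span_orthonormal_restrict:
  assumes b: "\<And>i. b i \<in> L2 M" and on: "\<And>i j. L2_inner M (b i) (b j) = (if i = j then 1 else 0)"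
    and f: "f \<in> L2_closed_span M (b ` J)" and orth: "\<And>i. i \<in> J - J' \<Longrightarrow> L2_inner M f (b i) = 0"
  shows "f \<in> L2_closed_span M (b ` J')"
  unfolding L2_closed_span_image_iff
proof (intro conjI allI impI)
  show fL: "f \<in> L2 M" using f L2_closed_span_subset by auto
  fix \<epsilon> :: ennreal assume "\<epsilon> > 0"
  then obtain K c where K: "finite K" "K \<subseteq> J" "L2_dist_sq M f (\<lambda>x. \<Sum>i\<in>K. c i * b i x) < \<epsilon>"
    using f unfolding L2_closed_span_image_iff by auto
  have orth': "L2_inner M (b i) f = 0" if "i \<in> J - J'" for i
    using orth[OF that] by (subst L2_inner_commute) simp
  \<comment> \<open>Orthonormality collapses the double sum to the squared moduli of the
    coefficients, so an omitted index outside J' only removes a nonnegative term.\<close>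
  have dist: "L2_dist_sq M f (\<lambda>x. \<Sum>i\<in>K. c i * b i x) =
    ennreal (Re (L2_inner M f f - (\<Sum>i\<in>K. cnj (c i) * L2_inner M f (b i)) - (\<Sum>i\<in>K. c i * L2_inner M (b i) f)
       + (\<Sum>i\<in>K. c i * cnj (c i))))" if "finite K" for K
    using that by (subst L2_dist_sq_combination) (auto simp: fL b on if_distrib[where f="\<lambda>x. _ * x"] cong: if_cong)
  let ?K = "K \<inter> J'"
  have s1: "(\<Sum>i\<in>?K. cnj (c i) * L2_inner M f (b i)) = (\<Sum>i\<in>K. cnj (c i) * L2_inner M f (b i))"
    by (rule sum.mono_neutral_left) (use K orth in auto)
  have s2: "(\<Sum>i\<in>?K. c i * L2_inner M (b i) f) = (\<Sum>i\<in>K. c i * L2_inner M (b i) f)"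
    by (rule sum.mono_neutral_left) (use K orth' in auto)
  have s3: "Re (\<Sum>i\<in>?K. c i * cnj (c i)) \<le> Re (\<Sum>i\<in>K. c i * cnj (c i))"
    unfolding Re_sum by (rule sum_mono2) (use K in auto)
  have "L2_dist_sq M f (\<lambda>x. \<Sum>i\<in>?K. c i * b i x) \<le> L2_dist_sq M f (\<lambda>x. \<Sum>i\<in>K. c i * b i x)"
  proof -
    have "finite ?K" using K by simp
    from s3 show ?thesis unfolding dist[OF K(1)] dist[OF \<open>finite ?K\<close>] s1 s2
      by (intro ennreal_leI) simp
  qed
  with K show "\<exists>K c. finite K \<and> K \<subseteq> J' \<and> L2_dist_sq M f (\<lambda>x. \<Sum>i\<in>K. c i * b i x) < \<epsilon>"
    by (intro exI[of _ ?K] exI[of _ c]) auto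
qed

text \<open>Riesz-Fischer. A subsequence with squared distances below (1/8)^k is summed with weights
  4^k: the total stays finite, and its finiteness at a point forces geometric decay of the
  increments there. Fatou's lemma then compares every member of the sequence with the pointwise
  limit.\<close>

lemma L2_complete:
  assumes s: "\<And>n. s n \<in> L2 M"
    and cauchy: "\<And>\<epsilon>::ennreal. \<epsilon> > 0 \<Longrightarrow> \<exists>N. \<forall>m\<ge>N. \<forall>n\<ge>N. L2_dist_sq M (s m) (s n) < \<epsilon>"
  shows "\<exists>F\<in>L2 M. (\<lambda>n. L2_dist_sq M (s n) F) \<longlonglongrightarrow> 0"
proof -
  have sm [measurable]: "s n \<in> borel_measurable M" for n using s by (rule L2_measurable)
  have "\<forall>k. \<exists>N. \<forall>m\<ge>N. \<forall>n\<ge>N. L2_dist_sq M (s m) (s n) < ennreal ((1/8)^k)"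
    by (intro allI cauchy) simp
  then obtain N where N: "\<And>k m n. m \<ge> N k \<Longrightarrow> n \<ge> N k \<Longrightarrow> L2_dist_sq M (s m) (s n) < ennreal ((1/8)^k)"
    by metis
  \<comment> \<open>The sum dominates N k while keeping r monotone; the summand k makes r tend to
    infinity.\<close>
  define r where "r k = k + (\<Sum>i\<le>k. N i)" for k
  have rN: "N k \<le> r k" for k unfolding r_def by (rule trans_le_add2, rule member_le_sum) auto
  have rk: "k \<le> r k" for k by (simp add: r_def)
  have rr: "r k \<le> r (Suc k)" for k by (simp add: r_def)
  define d where "d k x = s (r (Suc k)) x - s (r k) x" for k x
  have [measurable]: "d k \<in> borel_measurable M" for k unfolding d_def[abs_def] by measurable
  have "(\<integral>\<^sup>+x. (\<Sum>k. ennreal (4^k) * ennreal ((cmod (d k x))\<^sup>2)) \<partial>M) = (\<Sum>k. ennreal (4^k) * L2_dist_sq M (s (r (Suc k))) (s (r k)))"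
    by (subst nn_integral_suminf) (auto simp: nn_integral_cmult L2_dist_sq_def d_def)
  also have "\<dots> \<le> (\<Sum>k. ennreal ((1/2)^k))"
  proof (rule suminf_le)
    fix k
    have "L2_dist_sq M (s (r (Suc k))) (s (r k)) \<le> ennreal ((1/8)^k)"
      using rN[of k] rr[of k] by (intro less_imp_le[OF N[of k]]) auto
    then have "ennreal (4^k) * L2_dist_sq M (s (r (Suc k))) (s (r k)) \<le> ennreal (4^k) * ennreal ((1/8)^k)"
      by (rule mult_left_mono) simp
    also have "\<dots> = ennreal ((1/2)^k)"
      by (subst ennreal_mult[symmetric]) (auto simp flip: power_mult_distrib)
    finally show "ennreal (4^k) * L2_dist_sq M (s (r (Suc k))) (s (r k)) \<le> ennreal ((1/2)^k)" .
  qed auto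
  also have "\<dots> = ennreal (\<Sum>k. (1/2)^k)" by (rule suminf_ennreal2) (auto intro: summable_geometric)
  finally have "(\<integral>\<^sup>+x. (\<Sum>k. ennreal (4^k) * ennreal ((cmod (d k x))\<^sup>2)) \<partial>M) < \<infinity>"
    by (rule le_less_trans) simp
  then have "(\<integral>\<^sup>+x. (\<Sum>k. ennreal (4^k) * ennreal ((cmod (d k x))\<^sup>2)) \<partial>M) \<noteq> \<infinity>" by simp
  then have "AE x in M. (\<Sum>k. ennreal (4^k) * ennreal ((cmod (d k x))\<^sup>2)) \<noteq> \<infinity>"
    by (intro nn_integral_PInf_AE) simp_all
  then have conv: "AE x in M. convergent (\<lambda>k. s (r k) x)"
  proof eventually_elim
    case (elim x)
    then obtain c where c: "(\<Sum>k. ennreal (4^k) * ennreal ((cmod (d k x))\<^sup>2)) = ennreal c" "c \<ge> 0"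
      by (cases "\<Sum>k. ennreal (4^k) * ennreal ((cmod (d k x))\<^sup>2)") auto
    have "cmod (d k x) \<le> sqrt c * (1/2)^k" for k
    proof -
      have "ennreal (4^k) * ennreal ((cmod (d k x))\<^sup>2) \<le> ennreal c"
        using ennreal_suminf_lessD[of _ "ennreal c" k] sum_le_suminf[of "\<lambda>k. ennreal (4^k) * ennreal ((cmod (d k x))\<^sup>2)" "{k}"] c by auto
      then have "4^k * (cmod (d k x))\<^sup>2 \<le> c" using c by (simp flip: ennreal_mult)
      moreover have "(2::real)^k * 2^k = 4^k" by (simp flip: power_mult_distrib)
      then have "(2^k * cmod (d k x))\<^sup>2 = 4^k * (cmod (d k x))\<^sup>2" by (simp add: power2_eq_square algebra_simps)
      ultimately have "(2^k * cmod (d k x))\<^sup>2 \<le> c" by simp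
      then have "2^k * cmod (d k x) \<le> sqrt c" by (rule real_le_rsqrt)
      then show ?thesis by (simp add: power_one_over field_simps)
    qed
    then have "summable (\<lambda>k. d k x)"
      by (intro summable_comparison_test'[of "\<lambda>k. sqrt c * (1/2)^k" 0 "\<lambda>k. d k x"] summable_mult summable_geometric) auto
    then have "convergent (\<lambda>n. \<Sum>k<n. d k x)" by (simp add: summable_iff_convergent)
    moreover have "(\<Sum>k<n. d k x) = s (r n) x - s (r 0) x" for n
      unfolding d_def by (rule sum_lessThan_telescope)
    ultimately have "convergent (\<lambda>n. s (r n) x - s (r 0) x)" by simp
    from convergent_add[OF this convergent_const[of "s (r 0) x"]] show ?case by simp
  qed
  define F where "F x = lim (\<lambda>k. s (r k) x)" for x
  have [measurable]: "F \<in> borel_measurable M" unfolding F_def[abs_def] by measurable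
  have lim: "AE x in M. (\<lambda>k. s (r k) x) \<longlonglongrightarrow> F x"
    using conv unfolding F_def by eventually_elim (simp add: convergent_LIMSEQ_iff)
  have dist: "\<exists>N. \<forall>n\<ge>N. L2_dist_sq M (s n) F \<le> \<epsilon>" if \<epsilon>: "\<epsilon> > 0" for \<epsilon> :: ennreal
  proof -
    obtain K where K: "\<And>m n. m \<ge> K \<Longrightarrow> n \<ge> K \<Longrightarrow> L2_dist_sq M (s m) (s n) < \<epsilon>" using cauchy[OF \<epsilon>] by auto
    have "L2_dist_sq M (s n) F \<le> \<epsilon>" if n: "n \<ge> K" for n
    proof -
      have "L2_dist_sq M (s n) F = (\<integral>\<^sup>+x. liminf (\<lambda>k. ennreal ((cmod (s n x - s (r k) x))\<^sup>2)) \<partial>M)"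
        unfolding L2_dist_sq_def
      proof (rule nn_integral_cong_AE)
        show "AE x in M. ennreal ((cmod (s n x - F x))\<^sup>2) = liminf (\<lambda>k. ennreal ((cmod (s n x - s (r k) x))\<^sup>2))"
          using lim
        proof eventually_elim
          case (elim x)
          have "(\<lambda>k. ennreal ((cmod (s n x - s (r k) x))\<^sup>2)) \<longlonglongrightarrow> ennreal ((cmod (s n x - F x))\<^sup>2)"
            by (intro tendsto_ennrealI tendsto_intros elim)
          then show ?case by (intro lim_imp_Liminf[symmetric]) auto
        qed
      qed
      also have "\<dots> \<le> liminf (\<lambda>k. L2_dist_sq M (s n) (s (r k)))"
        unfolding L2_dist_sq_def by (rule nn_integral_liminf) simp
      also have "\<dots> \<le> \<epsilon>"
      proof (rule Liminf_le)
        show "\<forall>\<^sub>F k in sequentially. L2_dist_sq M (s n) (s (r k)) \<le> \<epsilon>"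
          unfolding eventually_sequentially
          using K[OF n] rk by (intro exI[of _ K]) (meson less_imp_le order_trans)
      qed auto
      finally show ?thesis .
    qed
    then show ?thesis by blast
  qed
  \<comment> \<open>A single finite distance puts s n - F, and hence F, into L2.\<close>
  obtain n where n: "L2_dist_sq M (s n) F \<le> 1" using dist[of 1] by auto
  have "(\<lambda>x. s n x - F x) \<in> L2 M"
    using n unfolding L2_iff L2_dist_sq_def by (auto intro: le_less_trans)
  from L2_diff[OF s[of n] this] have "F \<in> L2 M" by simp
  moreover have "(\<lambda>n. L2_dist_sq M (s n) F) \<longlonglongrightarrow> 0"
  proof (rule order_tendstoI)
    fix \<epsilon> :: ennreal assume "0 < \<epsilon>"
    then obtain \<delta> where \<delta>: "0 < \<delta>" "\<delta> < \<epsilon>" using dense by auto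
    then show "\<forall>\<^sub>F n in sequentially. L2_dist_sq M (s n) F < \<epsilon>"
      using dist[OF \<delta>(1)] unfolding eventually_sequentially by (meson le_less_trans)
  qed simp
  ultimately show ?thesis by blast
qed

lemma L2_limit_unique:
  assumes "\<And>n. s n \<in> L2 M" "F \<in> L2 M" "G \<in> L2 M"
    and "(\<lambda>n. L2_dist_sq M (s n) F) \<longlonglongrightarrow> 0" "(\<lambda>n. L2_dist_sq M (s n) G) \<longlonglongrightarrow> 0"
  shows "AE x in M. F x = G x"
proof -
  have [measurable]: "F \<in> borel_measurable M" "G \<in> borel_measurable M" "\<And>n. s n \<in> borel_measurable M"
    using assms by (auto dest: L2_measurable)
  have "L2_dist_sq M F G \<le> 2 * L2_dist_sq M (s n) F + 2 * L2_dist_sq M (s n) G" for n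
    using L2_dist_sq_triangle[of F M "s n" G] by (simp add: L2_dist_sq_commute[of M F])
  moreover have "(\<lambda>n. 2 * L2_dist_sq M (s n) F + 2 * L2_dist_sq M (s n) G) \<longlonglongrightarrow> 2 * 0 + 2 * 0"
    by (intro tendsto_add ennreal_tendsto_cmult assms) auto
  ultimately have "L2_dist_sq M F G \<le> 0"
    by (intro LIMSEQ_le_const[of _ "0::ennreal"]) auto
  then have "(\<integral>\<^sup>+x. ennreal ((cmod (F x - G x))\<^sup>2) \<partial>M) = 0" by (simp add: L2_dist_sq_def)
  then have "AE x in M. ennreal ((cmod (F x - G x))\<^sup>2) = 0"
    by (subst (asm) nn_integral_0_iff_AE) auto
  then show ?thesis by eventually_elim simp
qed

section \<open>Bounded multipliers of a closed span\<close>

lemma L2_closed_span_bounded_lim: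
  assumes S: "S \<subseteq> L2 M" and f: "f \<in> L2 M"
    and m: "\<And>n. m n \<in> borel_measurable M" "\<And>n x. x \<in> space M \<Longrightarrow> cmod (m n x) \<le> B"
    and m': "m' \<in> borel_measurable M" and lim: "AE x in M. (\<lambda>n. m n x) \<longlonglongrightarrow> m' x"
    and span: "\<And>n. (\<lambda>x. m n x * f x) \<in> L2_closed_span M S"
  shows "(\<lambda>x. m' x * f x) \<in> L2_closed_span M S"
proof -
  have fm: "f \<in> borel_measurable M" by (rule L2_measurable[OF f])
  have w: "integrable M (\<lambda>x. B\<^sup>2 * (cmod (f x))\<^sup>2)" using L2_integrable[OF f] by simp
  have b: "AE x in M. (cmod (m n x * f x))\<^sup>2 \<le> B\<^sup>2 * (cmod (f x))\<^sup>2" for n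
    using m(2) by (auto simp: norm_mult power_mult_distrib intro!: mult_right_mono power_mono)
  have l: "AE x in M. (\<lambda>n. m n x * f x) \<longlonglongrightarrow> m' x * f x"
    using lim by eventually_elim (intro tendsto_mult tendsto_const)
  have meas: "(\<lambda>x. m n x * f x) \<in> borel_measurable M" "(\<lambda>x. m' x * f x) \<in> borel_measurable M" for n
    using m(1) m' fm by auto
  show ?thesis
    by (rule L2_closed_span_lim[OF S L2_dominated(1)[OF meas w b l] span L2_dominated(2)[OF meas w b l]])
qed

text \<open>Boundedness makes the multiplication continuous on L2, so that invariance passes from
  generators to the closed span and survives bounded pointwise limits.\<close>

definition multiplier :: "'a measure \<Rightarrow> ('a \<Rightarrow> complex) set \<Rightarrow> ('a \<Rightarrow> complex) \<Rightarrow> bool" where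
  "multiplier M E f \<longleftrightarrow> f \<in> borel_measurable M \<and> (\<exists>B. \<forall>x\<in>space M. cmod (f x) \<le> B) \<and>
     (\<forall>g\<in>E. (\<lambda>x. f x * g x) \<in> E)"

lemma multiplierI:
  assumes "f \<in> borel_measurable M" "\<And>x. x \<in> space M \<Longrightarrow> cmod (f x) \<le> B"
    "\<And>g. g \<in> E \<Longrightarrow> (\<lambda>x. f x * g x) \<in> E"
  shows "multiplier M E f"
  unfolding multiplier_def using assms by blast

lemma multiplierE:
  assumes "multiplier M E f"
  obtains B where "f \<in> borel_measurable M" "\<And>x. x \<in> space M \<Longrightarrow> cmod (f x) \<le> B"
    "\<And>g. g \<in> E \<Longrightarrow> (\<lambda>x. f x * g x) \<in> E"
  using assms unfolding multiplier_def by blast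

lemma multiplierD: "multiplier M E f \<Longrightarrow> g \<in> E \<Longrightarrow> (\<lambda>x. f x * g x) \<in> E"
  unfolding multiplier_def by blast

lemma multiplier_mult:
  assumes f: "multiplier M E f" and g: "multiplier M E g"
  shows "multiplier M E (\<lambda>x. f x * g x)"
proof -
  obtain B where B: "f \<in> borel_measurable M" "\<And>x. x \<in> space M \<Longrightarrow> cmod (f x) \<le> B"
      "\<And>g. g \<in> E \<Longrightarrow> (\<lambda>x. f x * g x) \<in> E" using multiplierE[OF f] by blast
  obtain C where C: "g \<in> borel_measurable M" "\<And>x. x \<in> space M \<Longrightarrow> cmod (g x) \<le> C"
      "\<And>f. f \<in> E \<Longrightarrow> (\<lambda>x. g x * f x) \<in> E" using multiplierE[OF g] by blast
  show ?thesis
  proof (rule multiplierI[where B = "B * C"])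
    show "cmod (f x * g x) \<le> B * C" if "x \<in> space M" for x
      unfolding norm_mult using B(2) C(2) that by (intro mult_mono') auto
    show "(\<lambda>x. f x * g x * k x) \<in> E" if "k \<in> E" for k
      unfolding mult.assoc by (intro B(3) C(3) that)
  qed (use B C in auto)
qed

context
  fixes M :: "'a measure" and S :: "('a \<Rightarrow> complex) set"
  assumes S: "S \<subseteq> L2 M"
begin

private abbreviation (input) "E \<equiv> L2_closed_span M S"

lemma multiplier_const: "multiplier M E (\<lambda>x. c)"
  by (rule multiplierI) (auto intro: L2_closed_span_scale[OF S])

lemma multiplier_add:
  assumes f: "multiplier M E f" and g: "multiplier M E g"
  shows "multiplier M E (\<lambda>x. f x + g x)"
proof -
  obtain B where B: "f \<in> borel_measurable M" "\<And>x. x \<in> space M \<Longrightarrow> cmod (f x) \<le> B"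
      "\<And>g. g \<in> E \<Longrightarrow> (\<lambda>x. f x * g x) \<in> E" using multiplierE[OF f] by blast
  obtain C where C: "g \<in> borel_measurable M" "\<And>x. x \<in> space M \<Longrightarrow> cmod (g x) \<le> C"
      "\<And>f. f \<in> E \<Longrightarrow> (\<lambda>x. g x * f x) \<in> E" using multiplierE[OF g] by blast
  show ?thesis
  proof (rule multiplierI[where B = "B + C"])
    show "cmod (f x + g x) \<le> B + C" if "x \<in> space M" for x
      using B(2) C(2) that by (intro order_trans[OF norm_triangle_ineq] add_mono) auto
    show "(\<lambda>x. (f x + g x) * k x) \<in> E" if "k \<in> E" for k
      unfolding distrib_right by (intro L2_closed_span_add[OF S] B(3) C(3) that)
  qed (use B C in auto)
qed

lemma multiplier_diff: "multiplier M E f \<Longrightarrow> multiplier M E g \<Longrightarrow> multiplier M E (\<lambda>x. f x - g x)"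
  using multiplier_add[of f "\<lambda>x. (-1) * g x"] multiplier_mult[OF multiplier_const[of "-1"], of g] by simp

lemma multiplier_cong:
  assumes f: "multiplier M E f" and eq: "\<And>x. x \<in> space M \<Longrightarrow> f x = g x"
  shows "multiplier M E g"
proof -
  obtain B where B: "f \<in> borel_measurable M" "\<And>x. x \<in> space M \<Longrightarrow> cmod (f x) \<le> B"
      "\<And>g. g \<in> E \<Longrightarrow> (\<lambda>x. f x * g x) \<in> E" using multiplierE[OF f] by blast
  have gm [measurable]: "g \<in> borel_measurable M" using B(1) eq measurable_cong[of M f g borel] by simp
  show ?thesis
  proof (rule multiplierI[OF gm])
    show "cmod (g x) \<le> B" if "x \<in> space M" for x using B(2) eq that by metis
    show "(\<lambda>x. g x * k x) \<in> E" if k: "k \<in> E" for k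
    proof (rule L2_closed_span_cong_AE[OF S B(3)[OF k]])
      have [measurable]: "k \<in> borel_measurable M" using k L2_closed_span_subset by (auto dest: L2_measurable)
      show "(\<lambda>x. g x * k x) \<in> borel_measurable M" by measurable
    qed (use eq in auto)
  qed
qed

text \<open>The common bound B supplies the dominating function B^2 |k|^2 for each k in the
  span.\<close>

lemma multiplier_lim:
  assumes f: "\<And>n. multiplier M E (f n)" and bound: "\<And>n x. x \<in> space M \<Longrightarrow> cmod (f n x) \<le> B"
    and lim: "\<And>x. x \<in> space M \<Longrightarrow> (\<lambda>n. f n x) \<longlonglongrightarrow> g x"
  shows "multiplier M E g"
proof (rule multiplierI)
  have fm: "f n \<in> borel_measurable M" for n using f by (auto simp: multiplier_def)
  show gm: "g \<in> borel_measurable M" by (rule borel_measurable_LIMSEQ_metric[OF fm lim])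
  show "cmod (g x) \<le> B" if "x \<in> space M" for x
    by (rule LIMSEQ_le_const2[of "\<lambda>n. cmod (f n x)"]) (use bound lim that in \<open>auto intro: tendsto_norm\<close>)
  fix k assume k: "k \<in> E"
  then have kL: "k \<in> L2 M" using L2_closed_span_subset by auto
  show "(\<lambda>x. g x * k x) \<in> E"
  proof (rule L2_closed_span_bounded_lim[OF S kL fm bound gm])
    show "AE x in M. (\<lambda>n. f n x) \<longlonglongrightarrow> g x" using lim by (rule AE_I2)
  qed (use f k in \<open>auto simp: multiplier_def\<close>)
qed

lemma multiplier_of_generators:
  assumes m [measurable]: "m \<in> borel_measurable M" and B: "\<And>x. x \<in> space M \<Longrightarrow> cmod (m x) \<le> B"
    and gen: "\<And>s. s \<in> S \<Longrightarrow> (\<lambda>x. m x * s x) \<in> E"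
  shows "multiplier M E m"
proof (rule multiplierI[OF m B])
  fix k assume k: "k \<in> E"
  show "(\<lambda>x. m x * k x) \<in> E"
  proof (rule L2_closed_span_bounded_image[OF S S m B _ k])
    fix F c assume "finite F" "F \<subseteq> S"
    then have "(\<lambda>x. \<Sum>g\<in>F. c g * (m x * g x)) \<in> E"
      by (intro L2_closed_span_sum[OF S]) (use gen in auto)
    then show "(\<lambda>x. m x * (\<Sum>g\<in>F. c g * g x)) \<in> E"
      by (simp add: sum_distrib_left mult.left_commute)
  qed
qed

text \<open>A real multiplier has its values in some [-R, R]. Polynomials in it are multipliers, and
  by Weierstrass they approximate \<phi> uniformly on that interval.\<close>

lemma multiplier_continuous:
  fixes v :: "'a \<Rightarrow> real" and \<phi> :: "real \<Rightarrow> real"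
  assumes v: "multiplier M E (\<lambda>x. of_real (v x))" and \<phi>: "continuous_on UNIV \<phi>"
  shows "multiplier M E (\<lambda>x. of_real (\<phi> (v x)))"
proof -
  obtain R where R: "\<And>x. x \<in> space M \<Longrightarrow> \<bar>v x\<bar> \<le> R" using v by (auto simp: multiplier_def)
  have poly: "multiplier M E (\<lambda>x. of_real (p (v x)))" if "real_polynomial_function p" for p :: "real \<Rightarrow> real"
    using that
  proof (induction p rule: real_polynomial_function.induct)
    case (linear f)
    then obtain c where "f = (\<lambda>x. x * c)" by (auto simp: real_bounded_linear)
    then show ?case using multiplier_mult[OF v multiplier_const[of "of_real c"]] by simp
  next
    case (const c)
    show ?case using multiplier_const[of "of_real c"] by simp
  next
    case (add f g)
    then show ?case using multiplier_add by fastforce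
  next
    case (mult f g)
    then show ?case using multiplier_mult by fastforce
  qed
  have "\<exists>p. real_polynomial_function p \<and> (\<forall>x\<in>{-R..R}. \<bar>\<phi> x - p x\<bar> < 1 / Suc n)" for n :: nat
    by (rule Stone_Weierstrass_real_polynomial_function[of "{-R..R}" \<phi> "1 / Suc n"])
      (use \<phi> in \<open>auto intro: continuous_on_subset\<close>)
  then obtain p where p: "\<And>n. real_polynomial_function (p n)"
      "\<And>n x. x \<in> {-R..R} \<Longrightarrow> \<bar>\<phi> x - p n x\<bar> < 1 / Suc n"
    by metis
  have p': "\<bar>\<phi> (v x) - p n (v x)\<bar> < 1 / Suc n" if "x \<in> space M" for n x using R[OF that] p(2) by (auto simp: abs_le_iff)
  have "compact (\<phi> ` {-R..R})" by (intro compact_continuous_image) (use \<phi> in \<open>auto intro: continuous_on_subset\<close>)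
  then have "bounded (\<phi> ` {-R..R})" by (rule compact_imp_bounded)
  then obtain C where "\<And>y. y \<in> \<phi> ` {-R..R} \<Longrightarrow> \<bar>y\<bar> \<le> C"
    unfolding bounded_iff real_norm_def by blast
  then have C: "\<bar>\<phi> (v x)\<bar> \<le> C" if "x \<in> space M" for x using R[OF that] by (auto simp: abs_le_iff)
  show ?thesis
  \<comment> \<open>The approximants stay within 1/(n+1) \<le> 1 of a function bounded by C.\<close>
  proof (rule multiplier_lim[where f = "\<lambda>n x. of_real (p n (v x))" and B = "C + 1"])
    show "multiplier M E (\<lambda>x. of_real (p n (v x)))" for n using p(1) by (rule poly)
    fix x assume x: "x \<in> space M"
    show "cmod (of_real (p n (v x))) \<le> C + 1" for n
    proof -
      have "1 / real (Suc n) \<le> 1" by simp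
      then show ?thesis using p'[OF x, of n] C[OF x] by (simp only: norm_of_real)
    qed
    have "(\<lambda>n. p n (v x)) \<longlonglongrightarrow> \<phi> (v x)"
    proof (rule LIM_zero_cancel, rule Lim_null_comparison)
      show "\<forall>\<^sub>F n in sequentially. norm (p n (v x) - \<phi> (v x)) \<le> inverse (real (Suc n))"
        using p'[OF x] by (auto intro!: always_eventually less_imp_le simp: abs_minus_commute inverse_eq_divide)
      show "(\<lambda>n. inverse (real (Suc n))) \<longlonglongrightarrow> 0" by (rule LIMSEQ_inverse_real_of_nat)
    qed
    then show "(\<lambda>n. complex_of_real (p n (v x))) \<longlonglongrightarrow> of_real (\<phi> (v x))" by (intro tendsto_of_real)
  qed
qed

text \<open>The continuous ramps equal 1 where v \<le> 0 and, for n > 0, vanish where v \<ge> 1/n;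
  they converge pointwise to the indicator.\<close>

lemma multiplier_indicator_nonpos:
  assumes v: "multiplier M E (\<lambda>x. of_real (v x))"
  shows "multiplier M E (\<lambda>x. indicator {x. v x \<le> 0} x)"
proof (rule multiplier_lim[where B = 1 and f = "\<lambda>n x. of_real (max 0 (1 - real n * max (v x) 0))"])
  show "multiplier M E (\<lambda>x. of_real (max 0 (1 - real n * max (v x) 0)))" for n
    by (rule multiplier_continuous[OF v, of "\<lambda>y. max 0 (1 - real n * max y 0)"]) (intro continuous_intros)
  show "cmod (of_real (max 0 (1 - real n * max (v x) 0))) \<le> 1" for n x
    by simp
  fix x
  have "(\<lambda>n. max 0 (1 - real n * max (v x) 0)) \<longlonglongrightarrow> indicator {x. v x \<le> 0} x"
  proof (cases "v x \<le> 0")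
    case True
    then show ?thesis by simp
  next
    case False
    obtain N where N: "1 / v x < real N" using reals_Archimedean2 by auto
    have "max 0 (1 - real n * max (v x) 0) = 0" if "n \<ge> N" for n
    proof -
      have "1 / v x < real n" using N that by linarith
      then show ?thesis using False by (simp add: field_simps)
    qed
    then have "\<forall>\<^sub>F n in sequentially. max 0 (1 - real n * max (v x) 0) = 0" by (auto simp: eventually_sequentially)
    then show ?thesis using False by (simp add: tendsto_eventually)
  qed
  then have "(\<lambda>n. complex_of_real (max 0 (1 - real n * max (v x) 0))) \<longlonglongrightarrow> of_real (indicator {x. v x \<le> 0} x)"
    by (rule tendsto_of_real)
  then show "(\<lambda>n. complex_of_real (max 0 (1 - real n * max (v x) 0))) \<longlonglongrightarrow> indicator {x. v x \<le> 0} x"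
    by (simp add: of_real_indicator)
qed

text \<open>Events whose indicators are multipliers form a \<sigma>-algebra: products give
  intersections and bounded limits give countable unions, so G may be any family.\<close>

lemma multiplier_sigma_sets:
  assumes "A \<in> sigma_sets (space M) G" and G: "\<And>B. B \<in> G \<Longrightarrow> multiplier M E (indicator B)"
  shows "multiplier M E (indicator A)"
  using assms(1)
proof induction
  case (Compl A)
  have "multiplier M E (\<lambda>x. 1 - indicator A x)" by (intro multiplier_diff multiplier_const Compl)
  then show ?case by (rule multiplier_cong) (simp add: indicator_def)
next
  case (Union A)
  have "multiplier M E (indicator (\<Union>i<n. A i))" for n
  proof (induction n)
    case (Suc n)
    \<comment> \<open>The union is A n together with the part of the earlier union outside A n, so
      that overlaps are counted once.\<close>
    have "multiplier M E (\<lambda>x. indicator (A n) x + (1 - indicator (A n) x) * indicator (\<Union>i<n. A i) x)"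
      by (intro multiplier_add multiplier_mult multiplier_diff multiplier_const Union Suc)
    then show ?case by (rule multiplier_cong) (auto simp: indicator_def less_Suc_eq)
  qed (use multiplier_const[of 0] in simp)
  then show ?case
    by (rule multiplier_lim[where B = 1, OF _ _ LIMSEQ_indicator_UN]) (simp add: indicator_def)
qed (use G multiplier_const[of 0] in auto)

lemma multiplier_vimage:
  assumes half: "\<And>c. multiplier M E (indicator (X -` {..c::real} \<inter> space M))" and B: "B \<in> sets borel"
  shows "multiplier M E (indicator (X -` B \<inter> space M))"
proof (rule multiplier_sigma_sets)
  have "B \<in> sigma_sets UNIV (range (\<lambda>a::real. {..a}))"
    using B by (subst (asm) borel_eq_atMost) (simp add: sets_measure_of)
  then show "X -` B \<inter> space M \<in> sigma_sets (space M) {X -` A \<inter> space M |A. A \<in> range (\<lambda>a::real. {..a})}"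
    by (subst sigma_sets_vimage_commute[of X "space M" UNIV, symmetric]) auto
qed (use half in auto)

lemma multiplier_bounded:
  assumes sets: "\<And>A. A \<in> sets M \<Longrightarrow> multiplier M E (indicator A)"
    and f: "f \<in> borel_measurable M" and B: "\<And>x. x \<in> space M \<Longrightarrow> cmod (f x) \<le> B"
  shows "multiplier M E f"
proof -
  obtain s where s: "\<And>i. simple_function M (s i)" "\<And>x. x \<in> space M \<Longrightarrow> (\<lambda>i. s i x) \<longlonglongrightarrow> f x"
      "\<And>i x. x \<in> space M \<Longrightarrow> dist (s i x) 0 \<le> 2 * dist (f x) 0"
    using borel_measurable_implies_sequence_metric[OF f, of 0] by blast
  have simple: "multiplier M E (s i)" for i
  proof -
    have fin: "finite (s i ` space M)" and sm: "s i -` {y} \<inter> space M \<in> sets M" if "y \<in> s i ` space M" for y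
      using s(1)[of i] that by (auto simp: simple_function_def)
    have "multiplier M E (\<lambda>x. \<Sum>y\<in>Y. y * indicator (s i -` {y} \<inter> space M) x)" if "Y \<subseteq> s i ` space M" for Y
      using that
    proof (induction Y rule: infinite_finite_induct)
      case (insert y Y)
      then have "multiplier M E (\<lambda>x. y * indicator (s i -` {y} \<inter> space M) x + (\<Sum>y\<in>Y. y * indicator (s i -` {y} \<inter> space M) x))"
        by (intro multiplier_add multiplier_mult multiplier_const sets sm) auto
      then show ?case using insert.hyps by (simp only: sum.insert not_False_eq_True)
    qed (use multiplier_const[of 0] in auto)
    from this[OF order_refl] show ?thesis
    proof (rule multiplier_cong)
      fix x assume x: "x \<in> space M"
      then have "finite (s i ` space M)" using s(1)[of i] by (simp add: simple_function_def)
      then show "(\<Sum>y\<in>s i ` space M. y * indicator (s i -` {y} \<inter> space M) x) = s i x"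
        using x by (subst sum.remove[of _ "s i x"]) (auto simp: indicator_def intro!: sum.neutral)
    qed
  qed
  show ?thesis
  proof (rule multiplier_lim[OF simple _ s(2), where B = "2 * B"])
    show "cmod (s i x) \<le> 2 * B" if "x \<in> space M" for i x using s(3)[OF that, of i] B[OF that] by simp
  qed
qed

text \<open>w is a cyclic vector: f is w times f / w, and this quotient becomes a bounded multiplier
  once it is set to 0 where its modulus exceeds n.\<close>

lemma L2_closed_span_eq_L2:
  assumes sets: "\<And>A. A \<in> sets M \<Longrightarrow> multiplier M E (indicator A)" and w: "w \<in> E" "\<And>x. w x \<noteq> 0"
  shows "E = L2 M"
proof (intro equalityI L2_closed_span_subset subsetI)
  fix f assume f: "f \<in> L2 M"
  have [measurable]: "f \<in> borel_measurable M" "w \<in> borel_measurable M"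
    using f w(1) L2_closed_span_subset[of M S] by (auto intro: L2_measurable)
  define m where "m n x = (if cmod (f x / w x) \<le> real n then 1 else 0 :: complex)" for n x
  have [measurable]: "m n \<in> borel_measurable M" for n unfolding m_def[abs_def] by measurable
  have "(\<lambda>x. 1 * f x) \<in> E"
  proof (rule L2_closed_span_bounded_lim[OF S f, where m = m and B = 1])
    show "AE x in M. (\<lambda>n. m n x) \<longlonglongrightarrow> 1"
    proof (intro AE_I2 tendsto_eventually)
      fix x
      obtain N where "cmod (f x / w x) \<le> real N" using real_arch_simple by blast
      then have "m n x = 1" if "n \<ge> N" for n using that by (simp add: m_def)
      then show "\<forall>\<^sub>F n in sequentially. m n x = 1" by (auto simp: eventually_sequentially)
    qed
    fix n
    have "multiplier M E (\<lambda>x. m n x * (f x / w x))"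
      by (rule multiplier_bounded[OF sets, where B = "real n"]) (auto simp: m_def)
    then have "(\<lambda>x. m n x * (f x / w x) * w x) \<in> E" using w(1) by (rule multiplierD)
    then show "(\<lambda>x. m n x * f x) \<in> E" using w(2) by simp
  qed (auto simp: m_def)
  then show "f \<in> E" by simp
qed

end

section \<open>The rational basis \<open>e n\<close>\<close>

text \<open>The Cayley transform, from the line onto the unit circle without -1; \<open>e n\<close>
  is \<open>e 0\<close> times its n-th power.\<close>

definition cayley :: "real \<Rightarrow> complex" where
  "cayley \<gamma> = (1 + \<i> * of_real \<gamma>) / (1 - \<i> * of_real \<gamma>)"

lemma one_plus_minus_i_nonzero [simp]:
  "1 - \<i> * of_real \<gamma> \<noteq> 0" "1 + \<i> * of_real \<gamma> \<noteq> 0"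
  by (auto simp: complex_eq_iff)

lemma cmod_one_plus_minus_i:
  "(cmod (1 - \<i> * of_real \<gamma>))\<^sup>2 = 1 + \<gamma>\<^sup>2" "(cmod (1 + \<i> * of_real \<gamma>))\<^sup>2 = 1 + \<gamma>\<^sup>2"
  by (simp_all add: cmod_power2)

lemma one_plus_minus_i_mult: "(1 + \<i> * of_real \<gamma>) * (1 - \<i> * of_real \<gamma>) = of_real (1 + \<gamma>\<^sup>2)"
  by (simp add: algebra_simps power2_eq_square)

lemma cmod_cayley [simp]: "cmod (cayley \<gamma>) = 1"
proof -
  have "(cmod (cayley \<gamma>))\<^sup>2 = 1"
    using sum_power2_gt_zero_iff[of 1 \<gamma>]
    by (simp add: cayley_def norm_divide power_divide cmod_one_plus_minus_i)
  then show ?thesis by (simp add: power2_eq_1_iff) (use norm_ge_zero[of "cayley \<gamma>"] in linarith)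
qed

lemma cayley_nonzero [simp]: "cayley \<gamma> \<noteq> 0"
  using cmod_cayley[of \<gamma>] by fastforce

lemma cnj_cayley: "cnj (cayley \<gamma>) = inverse (cayley \<gamma>)"
  by (simp add: cayley_def)

lemma borel_measurable_cayley [measurable]: "cayley \<in> borel_measurable borel"
  unfolding cayley_def[abs_def]
  by (intro borel_measurable_continuous_onI continuous_intros) simp

lemma e_eq: "e n \<gamma> = 1 / of_real (sqrt pi) * (1 / (1 - \<i> * of_real \<gamma>)) * cayley \<gamma> powi n"
  by (simp add: e_def cayley_def)

lemma cmod_e_sq: "(cmod (e n \<gamma>))\<^sup>2 = 1 / (pi * (1 + \<gamma>\<^sup>2))"
  by (simp add: e_eq norm_mult norm_divide norm_power_int power_mult_distrib power_divide cmod_one_plus_minus_i)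

lemma borel_measurable_e [measurable]: "e n \<in> borel_measurable borel"
  unfolding e_eq[abs_def] cayley_def
  by (intro borel_measurable_continuous_onI continuous_intros) auto

lemma integrable_cauchy: "integrable lborel (\<lambda>x::real. 1 / (1 + x\<^sup>2))"
  and integral_cauchy: "(\<integral>x. 1 / (1 + x\<^sup>2) \<partial>lborel) = pi"
  using integrable_inverse_1_plus_square LBINT_inverse_1_plus_square
  by (simp_all add: set_integrable_def interval_lebesgue_integral_def set_lebesgue_integral_def divide_inverse)

lemma e_L2: "e n \<in> L2 lborel"
  unfolding L2_def using integrable_mult_right[OF integrable_cauchy, of "1/pi"]
  by (simp add: cmod_e_sq field_simps)

lemma e_mult_cnj: "e n \<gamma> * cnj (e m \<gamma>) = of_real (1 / pi) * (cayley \<gamma> powi (n - m) * of_real (1 / (1 + \<gamma>\<^sup>2)))"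
proof -
  have 1: "cnj (cayley \<gamma> powi m) = inverse (cayley \<gamma> powi m)"
    by (simp add: cnj_cayley power_int_inverse)
  have 2: "cayley \<gamma> powi (n - m) = cayley \<gamma> powi n * inverse (cayley \<gamma> powi m)"
    by (simp add: power_int_diff divide_inverse)
  have 3: "(1 / complex_of_real (sqrt pi)) * (1 / of_real (sqrt pi)) = of_real (1 / pi)"
    by (simp flip: of_real_mult)
  have 4: "(1 / (1 - \<i> * of_real \<gamma>)) * (1 / (1 + \<i> * of_real \<gamma>)) = complex_of_real (1 / (1 + \<gamma>\<^sup>2))"
    unfolding of_real_divide one_plus_minus_i_mult[symmetric] by simp
  have "e n \<gamma> * cnj (e m \<gamma>) = ((1 / complex_of_real (sqrt pi)) * (1 / of_real (sqrt pi))) *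
     ((cayley \<gamma> powi n * inverse (cayley \<gamma> powi m)) * ((1 / (1 - \<i> * of_real \<gamma>)) * (1 / (1 + \<i> * of_real \<gamma>))))"
    unfolding e_eq complex_cnj_mult 1 by simp
  then show ?thesis unfolding 2 3 4 .
qed

text \<open>The angular speed on the circle is 2 / (1 + \<gamma>^2). This makes a nonzero power of
  \<open>cayley\<close> times 1 / (1 + \<gamma>^2) an exact derivative.\<close>

lemma cayley_deriv:
  "(cayley has_vector_derivative (2 * \<i> * of_real (1 / (1 + \<gamma>\<^sup>2)) * cayley \<gamma>)) (at \<gamma>)"
proof -
  have "((\<lambda>w. (1 + \<i> * w) / (1 - \<i> * w)) has_field_derivative
      ((\<i> * (1 - \<i> * of_real \<gamma>) - (1 + \<i> * of_real \<gamma>) * (- \<i>)) / ((1 - \<i> * of_real \<gamma>) * (1 - \<i> * of_real \<gamma>)))) (at (of_real \<gamma>))"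
    by (intro DERIV_divide) (auto intro!: derivative_eq_intros)
  moreover have "(\<i> * (1 - \<i> * of_real \<gamma>) - (1 + \<i> * of_real \<gamma>) * (- \<i>)) / ((1 - \<i> * of_real \<gamma>) * (1 - \<i> * of_real \<gamma>)) =
     2 * \<i> * of_real (1 / (1 + \<gamma>\<^sup>2)) * cayley \<gamma>"
  proof -
    define p q where "p = 1 + \<i> * complex_of_real \<gamma>" and "q = 1 - \<i> * complex_of_real \<gamma>"
    have pq: "p \<noteq> 0" "q \<noteq> 0" "\<i> * q - p * (- \<i>) = 2 * \<i>" by (simp_all add: p_def q_def algebra_simps)
    show ?thesis
      unfolding of_real_divide one_plus_minus_i_mult[symmetric] cayley_def p_def[symmetric] q_def[symmetric] pq(3)
      using pq by simp
  qed
  ultimately have "((\<lambda>w. (1 + \<i> * w) / (1 - \<i> * w)) has_field_derivative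
     2 * \<i> * of_real (1 / (1 + \<gamma>\<^sup>2)) * cayley \<gamma>) (at (of_real \<gamma>))" by simp
  from has_vector_derivative_real_field[OF this] show ?thesis
    by (simp add: cayley_def[abs_def])
qed

lemma cayley_tendsto: "((\<lambda>\<gamma>. cayley \<gamma>) \<longlongrightarrow> -1) at_infinity"
proof -
  have eq: "cayley \<gamma> = 2 / (1 - \<i> * of_real \<gamma>) + (-1)" for \<gamma>
    by (simp add: cayley_def divide_simps)
  have "((\<lambda>\<gamma>. 2 / (1 - \<i> * of_real \<gamma>)) \<longlongrightarrow> 0) at_infinity"
  proof (rule Lim_null_comparison)
    show "\<forall>\<^sub>F \<gamma> in at_infinity. norm (2 / (1 - \<i> * of_real \<gamma>)) \<le> norm (2 * inverse \<gamma>)"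
      unfolding eventually_at_infinity
    proof (intro exI[of _ 1] allI impI)
      fix \<gamma> :: real assume "1 \<le> norm \<gamma>"
      then have "\<bar>\<gamma>\<bar> > 0" by simp
      moreover have "\<bar>\<gamma>\<bar> \<le> cmod (1 - \<i> * of_real \<gamma>)"
        using abs_Im_le_cmod[of "1 - \<i> * of_real \<gamma>"] by simp
      ultimately have "2 / cmod (1 - \<i> * of_real \<gamma>) \<le> 2 / \<bar>\<gamma>\<bar>"
        by (intro divide_left_mono) auto
      then show "norm (2 / (1 - \<i> * of_real \<gamma>)) \<le> norm (2 * inverse \<gamma>)"
        by (simp add: norm_divide norm_inverse abs_mult divide_inverse)
    qed
    show "((\<lambda>\<gamma>::real. norm (2 * inverse \<gamma>)) \<longlongrightarrow> 0) at_infinity"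
      using tendsto_mult_left[OF tendsto_inverse_0, of 2] by (intro tendsto_norm_zero) simp
  qed
  from tendsto_add[OF this tendsto_const[of "-1"]] show ?thesis unfolding eq by simp
qed

text \<open>For n \<noteq> m the integrand has an antiderivative proportional to the power n - m of
  \<open>cayley\<close>, which has the same limit at both ends of the line because
  \<open>cayley\<close> tends to -1 at both. For n = m the integrand is the Cauchy density.\<close>

lemma e_orthonormal: "L2_inner lborel (e n) (e m) = (if n = m then 1 else 0)"
proof (cases "n = m")
  case True
  have "L2_inner lborel (e n) (e m) = (\<integral>\<gamma>. of_real (1 / pi * (1 / (1 + \<gamma>\<^sup>2))) \<partial>lborel)"
    unfolding L2_inner_def e_mult_cnj using True by simp
  also have "\<dots> = of_real (1 / pi * (\<integral>\<gamma>. 1 / (1 + \<gamma>\<^sup>2) \<partial>lborel))"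
    by (simp only: integral_complex_of_real integral_mult_right_zero)
  finally show ?thesis using True by (simp only: integral_cauchy) simp
next
  case False
  define k where "k = n - m"
  have k: "k \<noteq> 0" using False by (simp add: k_def)
  let ?f = "\<lambda>\<gamma>. cayley \<gamma> powi k * of_real (1 / (1 + \<gamma>\<^sup>2))"
  let ?F = "\<lambda>\<gamma>. cayley \<gamma> powi k / (2 * \<i> * of_int k)"
  have int: "integrable lborel ?f"
  proof (rule Bochner_Integration.integrable_bound[OF integrable_cauchy])
    have "?f \<in> borel_measurable borel"
      unfolding cayley_def
      by (intro borel_measurable_continuous_onI continuous_intros) (auto simp: add_nonneg_eq_0_iff)
    then show "?f \<in> borel_measurable lborel" by simp
    have "norm (?f x) = 1 / (1 + x\<^sup>2)" for x
      by (simp only: norm_mult norm_power_int cmod_cayley norm_of_real) simp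
    then show "AE x in lborel. norm (?f x) \<le> norm (1 / (1 + x\<^sup>2))" by simp
  qed
  have "(LBINT x=-\<infinity>..\<infinity>. ?f x) = (-1) powi k / (2 * \<i> * of_int k) - (-1) powi k / (2 * \<i> * of_int k)"
  proof (rule interval_integral_FTC_integrable[where F = ?F])
    have lim: "(?F \<longlongrightarrow> (-1) powi k / (2 * \<i> * of_int k)) at_infinity"
      using k by (intro tendsto_divide tendsto_power_int cayley_tendsto tendsto_const) auto
    show "((?F \<circ> real_of_ereal) \<longlongrightarrow> (-1) powi k / (2 * \<i> * of_int k)) (at_right (-\<infinity>))"
      unfolding ereal_tendsto_simps using lim by (rule tendsto_mono[rotated]) (rule at_bot_le_at_infinity)
    show "((?F \<circ> real_of_ereal) \<longlongrightarrow> (-1) powi k / (2 * \<i> * of_int k)) (at_left \<infinity>)"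
      unfolding ereal_tendsto_simps using lim by (rule tendsto_mono[rotated]) (rule at_top_le_at_infinity)
    show "set_integrable lborel (einterval (-\<infinity>) \<infinity>) ?f" using int by (simp add: set_integrable_def)
    fix x :: real
    show "isCont ?f x" unfolding cayley_def
      by (intro continuous_intros) (auto simp: add_nonneg_eq_0_iff)
    have "((\<lambda>w. w powi k / (2 * \<i> * of_int k)) has_field_derivative
        (of_int k * cayley x powi (k - 1) * 1 / (2 * \<i> * of_int k))) (at (cayley x))"
      by (intro DERIV_cdivide DERIV_power_int DERIV_ident) simp
    from field_vector_diff_chain_at[OF cayley_deriv this]
    have "(?F has_vector_derivative 2 * \<i> * of_real (1 / (1 + x\<^sup>2)) * cayley x *
        (of_int k * cayley x powi (k - 1) * 1 / (2 * \<i> * of_int k))) (at x)"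
      by (simp add: o_def)
    moreover have "2 * \<i> * of_real (1 / (1 + x\<^sup>2)) * cayley x *
        (of_int k * cayley x powi (k - 1) * 1 / (2 * \<i> * of_int k)) = ?f x"
    proof -
      have P: "cayley x powi k = cayley x * cayley x powi (k - 1)"
        using power_int_add_1'[of "cayley x" "k - 1"] by simp
      have Q: "2 * \<i> * a * c * (K * p * 1 / (2 * \<i> * K)) = (c * p) * a" if "K \<noteq> 0" for a c p K :: complex
        using that by (simp add: field_simps)
      show ?thesis unfolding P using k by (subst Q) auto
    qed
    ultimately show "(?F has_vector_derivative ?f x) (at x)" by (simp only:)
  qed simp
  then have "(\<integral>\<gamma>. ?f \<gamma> \<partial>lborel) = 0"
    by (simp add: interval_lebesgue_integral_def set_lebesgue_integral_def)
  then show ?thesis using False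
    unfolding L2_inner_def e_mult_cnj k_def integral_mult_right_zero by simp
qed

text \<open>Multiplication by a power of \<open>cayley\<close> shifts the index, so these powers are
  multipliers of the span. They generate the indicators of half-lines, and \<open>e 0\<close> is a
  cyclic vector since it vanishes nowhere.\<close>

lemma e_span_eq_L2: "L2_closed_span lborel (range e) = L2 lborel"
proof (rule L2_closed_span_eq_L2[where w = "e 0"])
  show S: "range e \<subseteq> L2 lborel" using e_L2 by auto
  let ?E = "L2_closed_span lborel (range e)"
  have eE: "e n \<in> ?E" for n by (rule L2_closed_span_superset[OF S]) simp
  then show "e 0 \<in> ?E" .
  show "e 0 x \<noteq> 0" for x by (simp add: e_eq)
  have c: "multiplier lborel ?E (\<lambda>x. cayley x powi k)" for k
  proof (rule multiplier_of_generators[OF S, where B = 1])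
    show "(\<lambda>x. cayley x powi k) \<in> borel_measurable lborel"
      unfolding cayley_def by (simp, intro borel_measurable_continuous_onI continuous_intros) auto
    fix s assume "s \<in> range e"
    then obtain n where s: "s = e n" by auto
    have "(\<lambda>x. cayley x powi k * s x) = e (n + k)"
      by (simp add: fun_eq_iff s e_eq power_int_add)
    then show "(\<lambda>x. cayley x powi k * s x) \<in> ?E" using eE by simp
  qed (auto simp: norm_power_int)
  have half: "multiplier lborel ?E (indicator {..a})" for a
  proof -
    \<comment> \<open>v is bounded and has the sign of x - a. With r = 1 / (1 - \<i> x) = (cayley +
      1) / 2 and r' = 1 / (1 + \<i> x) it equals (r - r') / (2 \<i>) - a r r', a polynomial in
      \<open>cayley\<close> and its inverse.\<close>
    let ?v = "\<lambda>x::real. (x - a) / (1 + x\<^sup>2)"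
    let ?r = "\<lambda>x. 1 / 2 * (cayley x powi 1 + 1)" and ?r' = "\<lambda>x. 1 / 2 * (cayley x powi (-1) + 1)"
    have v: "complex_of_real (?v x) = 1 / (2 * \<i>) * (?r x - ?r' x) - of_real a * (?r x * ?r' x)" for x
    proof -
      define p q where "p = 1 + \<i> * complex_of_real x" and "q = 1 - \<i> * complex_of_real x"
      have pq: "p \<noteq> 0" "q \<noteq> 0" by (simp_all add: p_def q_def)
      have 2: "p + q = 2" "complex_of_real x = (p - q) / (2 * \<i>)" by (simp_all add: p_def q_def)
      have "?r x = 1 / 2 * ((p + q) / q)" "?r' x = 1 / 2 * ((p + q) / p)"
        using pq by (simp_all add: cayley_def power_int_minus add_divide_distrib flip: p_def q_def)
      then have r: "?r x = 1 / q" "?r' x = 1 / p" unfolding 2 by simp_all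
      have D: "complex_of_real (?v x) = ((p - q) / (2 * \<i>) - of_real a) / (p * q)"
        unfolding of_real_divide one_plus_minus_i_mult[symmetric] of_real_diff 2(2)[symmetric] by (simp add: p_def q_def)
      show ?thesis unfolding D r using pq by (simp add: field_simps)
    qed
    have "multiplier lborel ?E (\<lambda>x. of_real (?v x))"
      unfolding v
      by (intro multiplier_diff[OF S] multiplier_mult multiplier_add[OF S] multiplier_const[OF S] c)
    then have "multiplier lborel ?E (indicator {x. ?v x \<le> 0})"
      by (rule multiplier_indicator_nonpos[OF S])
    moreover have "{x. ?v x \<le> 0} = {..a}"
      by (auto simp: divide_le_0_iff) (smt (verit) zero_le_power2)+
    ultimately show ?thesis by simp
  qed
  fix A :: "real set" assume "A \<in> sets lborel"
  then show "multiplier lborel ?E (indicator A)"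
    using multiplier_vimage[OF S, of "\<lambda>x. x" A] half by simp
qed

section \<open>Plancherel's inequality and the Hardy spaces\<close>

lemma gaussian_fourier:
  assumes \<sigma>: "\<sigma> > 0"
  shows "(\<integral>\<gamma>. exp (\<i> * of_real \<gamma> * of_real \<tau>) * of_real (exp (- (\<sigma> * \<gamma>)\<^sup>2 / 2)) \<partial>lborel) =
    of_real (2 * pi * normal_density 0 \<sigma> \<tau>)"
proof -
  let ?f = "\<lambda>\<gamma>. exp (\<i> * of_real \<gamma> * of_real \<tau>) * complex_of_real (exp (- (\<sigma> * \<gamma>)\<^sup>2 / 2))"
  \<comment> \<open>After rescaling by \<sigma> the weight is sqrt (2 pi) times the standard normal
    density, whose characteristic function is known.\<close>
  have "(\<integral>\<gamma>. ?f \<gamma> \<partial>lborel) = \<bar>1 / \<sigma>\<bar> *\<^sub>R (\<integral>x. ?f (0 + 1 / \<sigma> * x) \<partial>lborel)"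
    by (rule lborel_integral_real_affine) (use \<sigma> in simp)
  also have "(\<lambda>x. ?f (0 + 1 / \<sigma> * x)) = (\<lambda>x. of_real (sqrt (2 * pi)) * (std_normal_density x *\<^sub>R iexp (\<tau> / \<sigma> * x)))"
    using \<sigma> by (auto simp: fun_eq_iff std_normal_density_def scaleR_conv_of_real mult_ac)
  also have "(\<integral>x. of_real (sqrt (2 * pi)) * (std_normal_density x *\<^sub>R iexp (\<tau> / \<sigma> * x)) \<partial>lborel) =
      of_real (sqrt (2 * pi)) * char std_normal_distribution (\<tau> / \<sigma>)"
    unfolding char_def integral_mult_right_zero by (subst integral_density) (auto simp: normal_density_nonneg)
  also have "\<dots> = of_real (sqrt (2 * pi) * exp (- ((\<tau> / \<sigma>)\<^sup>2) / 2))"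
    by (simp add: char_std_normal_distribution)
  also have "\<bar>1 / \<sigma>\<bar> *\<^sub>R complex_of_real (sqrt (2 * pi) * exp (- ((\<tau> / \<sigma>)\<^sup>2) / 2)) =
      of_real (2 * pi * normal_density 0 \<sigma> \<tau>)"
  proof -
    have "sqrt (2 * pi) * sqrt (2 * pi) = 2 * pi" by simp
    moreover have "sqrt (2 * pi * \<sigma>\<^sup>2) = sqrt (2 * pi) * \<sigma>" using \<sigma> by (simp add: real_sqrt_mult)
    ultimately have "\<bar>1 / \<sigma>\<bar> * (sqrt (2 * pi) * exp (- ((\<tau> / \<sigma>)\<^sup>2) / 2)) = 2 * pi * normal_density 0 \<sigma> \<tau>"
      using \<sigma> by (simp add: normal_density_def power_divide field_simps)
    then show ?thesis unfolding scaleR_conv_of_real of_real_mult[symmetric] by (rule arg_cong)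
  qed
  finally show ?thesis .
qed

interpretation lborel_pair: pair_sigma_finite "lborel :: real measure" "lborel :: real measure" ..

lemma product_integral:
  fixes f g :: "real \<Rightarrow> complex"
  assumes f: "integrable lborel f" and g: "integrable lborel g"
  shows "integrable (lborel \<Otimes>\<^sub>M lborel) (\<lambda>p. f (fst p) * g (snd p))" (is ?A)
    and "(\<integral>p. f (fst p) * g (snd p) \<partial>(lborel \<Otimes>\<^sub>M lborel)) = (\<integral>x. f x \<partial>lborel) * (\<integral>y. g y \<partial>lborel)" (is ?B)
proof -
  have [measurable]: "f \<in> borel_measurable borel" "g \<in> borel_measurable borel" using f g by auto
  show ?A
  proof (rule lborel_pair.Fubini_integrable)
    show "integrable lborel (\<lambda>x. \<integral>y. norm (f (fst (x, y)) * g (snd (x, y))) \<partial>lborel)"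
      using f by (simp add: norm_mult)
  qed (use g in auto)
  from lborel_pair.integral_fst'[OF this] show ?B by simp
qed

lemma borel_measurable_fourier [measurable]:
  assumes [measurable]: "f \<in> borel_measurable borel"
  shows "fourier f \<in> borel_measurable borel"
  unfolding fourier_def[abs_def] by measurable

lemma fourier_integrable:
  assumes "integrable lborel f"
  shows "integrable lborel (\<lambda>t. f t * exp (\<i> * of_real \<gamma> * of_real t))"
  by (rule Bochner_Integration.integrable_bound[OF assms])
    (use assms norm_exp_i_times[of "\<gamma> * t" for t] in \<open>auto simp: norm_mult mult.assoc\<close>)

lemma cmod_fourier_le: "cmod (fourier f \<gamma>) \<le> (\<integral>t. cmod (f t) \<partial>lborel)"
proof -
  have "cmod (fourier f \<gamma>) \<le> (\<integral>t. cmod (f t * exp (\<i> * of_real \<gamma> * of_real t)) \<partial>lborel)"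
    unfolding fourier_def by (rule integral_norm_bound)
  also have "\<dots> = (\<integral>t. cmod (f t) \<partial>lborel)"
    using norm_exp_i_times[of "\<gamma> * t" for t] by (simp add: norm_mult mult.assoc)
  finally show ?thesis .
qed

lemma fourier_diff:
  assumes "integrable lborel f" "integrable lborel g"
  shows "fourier (\<lambda>t. f t - g t) \<gamma> = fourier f \<gamma> - fourier g \<gamma>"
  unfolding fourier_def left_diff_distrib
  by (rule Bochner_Integration.integral_diff) (intro fourier_integrable assms)+

lemma integrable_gaussian_weight:
  assumes "(\<sigma>::real) > 0"
  shows "integrable lborel (\<lambda>\<gamma>. exp (- (\<sigma> * \<gamma>)\<^sup>2 / 2))"
proof -
  have "exp (- (\<sigma> * \<gamma>)\<^sup>2 / 2) = sqrt (2 * pi * (1 / \<sigma>)\<^sup>2) * normal_density 0 (1 / \<sigma>) \<gamma>" for \<gamma> :: real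
    using assms by (simp add: normal_density_def power_mult_distrib power_divide field_simps)
  then show ?thesis using integrable_normal_density[of "1 / \<sigma>" 0] assms by simp
qed

text \<open>A regularised Parseval identity. The Gaussian weight makes the triple integral
  absolutely convergent; integrating out \<gamma> first leaves a normal density of width \<sigma> in
  the difference of the time variables. Letting \<sigma> tend to 0 yields both Plancherel's
  inequality and the orthogonality of separated supports.\<close>

lemma fourier_gaussian_identity:
  assumes f: "integrable lborel f" and g: "integrable lborel g" and \<sigma>: "\<sigma> > 0"
  shows "(\<integral>\<gamma>. fourier f \<gamma> * cnj (fourier g \<gamma>) * of_real (exp (- (\<sigma> * \<gamma>)\<^sup>2 / 2)) \<partial>lborel) =
    (\<integral>p. f (fst p) * cnj (g (snd p)) * of_real (2 * pi * normal_density 0 \<sigma> (fst p - snd p)) \<partial>(lborel \<Otimes>\<^sub>M lborel))"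
proof -
  have [measurable]: "f \<in> borel_measurable borel" "g \<in> borel_measurable borel" using f g by auto
  let ?w = "\<lambda>\<gamma>. complex_of_real (exp (- (\<sigma> * \<gamma>)\<^sup>2 / 2))"
  let ?M = "lborel \<Otimes>\<^sub>M lborel :: (real \<times> real) measure"
  interpret P: pair_sigma_finite ?M "lborel :: real measure"
    by (intro pair_sigma_finite.intro lborel_pair.P.sigma_finite_measure_axioms lborel.sigma_finite_measure_axioms)
  define H where "H p = f (fst p) * cnj (g (snd p))" for p
  have gc: "integrable lborel (\<lambda>t. cnj (g t))" using g by (rule integrable_cnj)
  have H: "integrable ?M H" unfolding H_def[abs_def] by (rule product_integral(1)[OF f gc])
  then have [measurable]: "H \<in> borel_measurable ?M" by auto
  define K where "K p \<gamma> = H p * (exp (\<i> * of_real \<gamma> * of_real (fst p - snd p)) * ?w \<gamma>)" for p \<gamma>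
  have nK: "norm (K p \<gamma>) = cmod (H p) * exp (- (\<sigma> * \<gamma>)\<^sup>2 / 2)" for p \<gamma>
    using norm_exp_i_times[of "\<gamma> * (fst p - snd p)"] by (simp add: K_def norm_mult mult.assoc)
  have Km: "case_prod K \<in> borel_measurable (?M \<Otimes>\<^sub>M lborel)"
    unfolding K_def by measurable
  have Kint: "integrable (?M \<Otimes>\<^sub>M lborel) (case_prod K)"
  proof (rule P.Fubini_integrable[OF Km])
    show "integrable ?M (\<lambda>p. \<integral>\<gamma>. norm (case_prod K (p, \<gamma>)) \<partial>lborel)"
      using H by (simp add: nK)
    show "AE p in ?M. integrable lborel (\<lambda>\<gamma>. case_prod K (p, \<gamma>))"
    proof (intro AE_I2)
      fix p
      have "integrable lborel (\<lambda>\<gamma>. cmod (H p) * exp (- (\<sigma> * \<gamma>)\<^sup>2 / 2))"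
        using integrable_gaussian_weight[OF \<sigma>] by (rule integrable_mult_right)
      then show "integrable lborel (\<lambda>\<gamma>. case_prod K (p, \<gamma>))"
        by (rule Bochner_Integration.integrable_bound) (simp_all only: case_prod_conv nK, simp_all add: K_def abs_mult)
    qed
  qed
  have "(\<integral>\<gamma>. fourier f \<gamma> * cnj (fourier g \<gamma>) * ?w \<gamma> \<partial>lborel) = (\<integral>\<gamma>. (\<integral>p. K p \<gamma> \<partial>?M) \<partial>lborel)"
  proof (rule Bochner_Integration.integral_cong[OF refl])
    fix \<gamma> :: real
    let ?f = "\<lambda>t. f t * exp (\<i> * of_real \<gamma> * of_real t)" and ?g = "\<lambda>t. cnj (g t * exp (\<i> * of_real \<gamma> * of_real t))"
    have 1: "fourier f \<gamma> * cnj (fourier g \<gamma>) = (\<integral>p. ?f (fst p) * ?g (snd p) \<partial>?M)"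
      unfolding fourier_def Bochner_Integration.integral_cnj[symmetric]
      by (rule product_integral(2)[symmetric]) (intro fourier_integrable integrable_cnj f g)+
    have 2: "?f (fst p) * ?g (snd p) * ?w \<gamma> = K p \<gamma>" for p
    proof -
      have "cnj (\<i> * of_real \<gamma> * of_real (snd p)) = - (\<i> * of_real \<gamma> * of_real (snd p))"
        by (simp only: complex_cnj_mult complex_cnj_i complex_cnj_complex_of_real mult_minus_left)
      then have "\<i> * of_real \<gamma> * of_real (fst p) + cnj (\<i> * of_real \<gamma> * of_real (snd p)) = \<i> * of_real \<gamma> * of_real (fst p - snd p)"
        by (simp only: of_real_diff right_diff_distrib add_uminus_conv_diff)
      then have eq: "exp (\<i> * of_real \<gamma> * of_real (fst p)) * cnj (exp (\<i> * of_real \<gamma> * of_real (snd p))) =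
          exp (\<i> * of_real \<gamma> * of_real (fst p - snd p))"
        by (simp only: exp_cnj exp_add[symmetric])
      show ?thesis
        unfolding K_def H_def eq[symmetric] complex_cnj_mult by (simp only: mult_ac)
    qed
    show "fourier f \<gamma> * cnj (fourier g \<gamma>) * ?w \<gamma> = (\<integral>p. K p \<gamma> \<partial>?M)"
      unfolding 1 integral_mult_left_zero[symmetric] 2 ..
  qed
  also have "\<dots> = (\<integral>p. (\<integral>\<gamma>. K p \<gamma> \<partial>lborel) \<partial>?M)"
    by (rule P.Fubini_integral[OF Kint])
  also have "\<dots> = (\<integral>p. H p * of_real (2 * pi * normal_density 0 \<sigma> (fst p - snd p)) \<partial>?M)"
    unfolding K_def integral_mult_right_zero gaussian_fourier[OF \<sigma>] ..
  finally show ?thesis unfolding H_def .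
qed

text \<open>The normal density in the regularised identity integrates to 1 in each variable, so
  |f(t) f(s)| \<le> (|f(t)|^2 + |f(s)|^2) / 2 gives the bound with factor 2 pi, uniformly in
  \<sigma>. Fatou's lemma removes the weight.\<close>

lemma plancherel_le:
  assumes f: "integrable lborel f" "f \<in> L2 lborel"
  shows "(\<integral>\<^sup>+\<gamma>. ennreal ((cmod (fourier f \<gamma>))\<^sup>2) \<partial>lborel) \<le> ennreal (2 * pi) * (\<integral>\<^sup>+t. ennreal ((cmod (f t))\<^sup>2) \<partial>lborel)"
    (is "_ \<le> _ * ?N")
proof -
  have [measurable]: "f \<in> borel_measurable borel" using f by auto
  let ?M = "lborel \<Otimes>\<^sub>M lborel :: (real \<times> real) measure"
  let ?w = "\<lambda>\<sigma> \<gamma>. exp (- (\<sigma> * \<gamma>)\<^sup>2 / 2)"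
  let ?u = "\<lambda>\<sigma> \<gamma>. (cmod (fourier f \<gamma>))\<^sup>2 * ?w \<sigma> \<gamma>"
  have le: "(\<integral>\<^sup>+\<gamma>. ennreal (?u \<sigma> \<gamma>) \<partial>lborel) \<le> ennreal (2 * pi) * ?N" if \<sigma>: "\<sigma> > 0" for \<sigma>
  proof -
    define k where "k p = normal_density 0 \<sigma> (fst p - snd p)" for p :: "real \<times> real"
    have [measurable]: "k \<in> borel_measurable ?M" unfolding k_def normal_density_def by measurable
    have k0: "k p \<ge> 0" for p by (simp add: k_def normal_density_nonneg)
    \<comment> \<open>By symmetry either variable can be read as the mean.\<close>
    have k: "k (t, s) = normal_density t \<sigma> s" "k (t, s) = normal_density s \<sigma> t" for t s
      by (simp_all add: k_def normal_density_def power2_commute)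
    have k1: "(\<integral>\<^sup>+s. ennreal (normal_density t \<sigma> s) \<partial>lborel) = 1" for t
      using \<sigma> by (subst nn_integral_eq_integral) (auto simp: normal_density_nonneg)
    let ?a = "\<lambda>t. ennreal ((cmod (f t))\<^sup>2)"
    have N1: "(\<integral>\<^sup>+p. ?a (fst p) * ennreal (k p) \<partial>?M) = ?N"
      by (subst lborel.nn_integral_fst[symmetric]) (simp_all add: nn_integral_cmult k(1) k1)
    have N2: "(\<integral>\<^sup>+p. ?a (snd p) * ennreal (k p) \<partial>?M) = ?N"
      by (subst lborel_pair.nn_integral_snd[symmetric]) (simp_all add: nn_integral_cmult k(2) k1)
    have int: "integrable lborel (?u \<sigma>)"
    proof (rule Bochner_Integration.integrable_bound)
      show "integrable lborel (\<lambda>\<gamma>. (\<integral>t. cmod (f t) \<partial>lborel)\<^sup>2 * ?w \<sigma> \<gamma>)"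
        by (intro integrable_mult_right integrable_gaussian_weight \<sigma>)
      show "AE \<gamma> in lborel. norm (?u \<sigma> \<gamma>) \<le> norm ((\<integral>t. cmod (f t) \<partial>lborel)\<^sup>2 * ?w \<sigma> \<gamma>)"
        using cmod_fourier_le by (auto intro!: mult_right_mono power_mono simp: abs_mult)
    qed simp
    let ?h = "\<lambda>p. f (fst p) * cnj (f (snd p)) * of_real (2 * pi * k p)"
    have eq: "complex_of_real (\<integral>\<gamma>. ?u \<sigma> \<gamma> \<partial>lborel) = (\<integral>p. ?h p \<partial>?M)"
      unfolding integral_complex_of_real[symmetric] of_real_mult complex_norm_square k_def
      using fourier_gaussian_identity[OF f(1) f(1) \<sigma>] by simp
    have "(\<integral>\<gamma>. ?u \<sigma> \<gamma> \<partial>lborel) \<le> cmod (\<integral>p. ?h p \<partial>?M)"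
      unfolding eq[symmetric] norm_of_real by (rule abs_ge_self)
    then have "(\<integral>\<^sup>+\<gamma>. ennreal (?u \<sigma> \<gamma>) \<partial>lborel) \<le> ennreal (cmod (\<integral>p. ?h p \<partial>?M))"
      by (subst nn_integral_eq_integral[OF int]) (auto intro: ennreal_leI)
    also have "\<dots> \<le> (\<integral>\<^sup>+p. ennreal (cmod (?h p)) \<partial>?M)"
    \<comment> \<open>A Bochner integral that fails to exist is 0 by convention, and the bound is
      then trivial.\<close>
    proof (cases "integrable ?M ?h")
      case False
      then have "(\<integral>p. ?h p \<partial>?M) = 0" by (rule not_integrable_integral_eq)
      then show ?thesis by (simp only: norm_zero ennreal_0 zero_le)
    qed (rule integral_norm_bound_ennreal)
    also have "\<dots> \<le> (\<integral>\<^sup>+p. ennreal pi * (?a (fst p) * ennreal (k p) + ?a (snd p) * ennreal (k p)) \<partial>?M)"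
    proof (rule nn_integral_mono)
      fix p :: "real \<times> real"
      let ?x = "cmod (f (fst p))" and ?y = "cmod (f (snd p))"
      have "pi * k p * (2 * ?x * ?y) \<le> pi * k p * (?x\<^sup>2 + ?y\<^sup>2)"
        by (intro mult_left_mono sum_squares_bound) (simp add: k0)
      then have "cmod (?h p) \<le> pi * (?x\<^sup>2 * k p + ?y\<^sup>2 * k p)"
        unfolding norm_mult norm_of_real complex_mod_cnj
        by (simp add: abs_mult k0 algebra_simps del: of_real_mult)
      then have "ennreal (cmod (?h p)) \<le> ennreal (pi * (?x\<^sup>2 * k p + ?y\<^sup>2 * k p))"
        by (rule ennreal_leI)
      then show "ennreal (cmod (?h p)) \<le> ennreal pi * (?a (fst p) * ennreal (k p) + ?a (snd p) * ennreal (k p))"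
        by (simp add: ennreal_mult ennreal_plus k0)
    qed
    also have "\<dots> = ennreal pi * (?N + ?N)"
      by (simp add: nn_integral_cmult nn_integral_add N1 N2)
    also have "\<dots> = (ennreal pi + ennreal pi) * ?N" by (simp only: distrib_left distrib_right)
    also have "ennreal pi + ennreal pi = ennreal (2 * pi)" by (simp flip: ennreal_plus)
    finally show ?thesis .
  qed
  have "(\<integral>\<^sup>+\<gamma>. ennreal ((cmod (fourier f \<gamma>))\<^sup>2) \<partial>lborel) = (\<integral>\<^sup>+\<gamma>. liminf (\<lambda>n. ennreal (?u (1 / Suc n) \<gamma>)) \<partial>lborel)"
  proof (rule nn_integral_cong)
    fix \<gamma> :: real
    have "(\<lambda>n. ?u (1 / Suc n) \<gamma>) \<longlonglongrightarrow> ?u 0 \<gamma>"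
      by (intro tendsto_intros LIMSEQ_inverse_Suc) auto
    then have "(\<lambda>n. ennreal (?u (1 / Suc n) \<gamma>)) \<longlonglongrightarrow> ennreal ((cmod (fourier f \<gamma>))\<^sup>2)"
      by (intro tendsto_ennrealI) simp
    then show "ennreal ((cmod (fourier f \<gamma>))\<^sup>2) = liminf (\<lambda>n. ennreal (?u (1 / Suc n) \<gamma>))"
      by (intro lim_imp_Liminf[symmetric]) auto
  qed
  also have "\<dots> \<le> liminf (\<lambda>n. \<integral>\<^sup>+\<gamma>. ennreal (?u (1 / Suc n) \<gamma>) \<partial>lborel)"
    by (rule nn_integral_liminf) simp
  finally show ?thesis
  proof (rule order_trans[OF _ Liminf_le])
    show "\<forall>\<^sub>F n in sequentially. (\<integral>\<^sup>+\<gamma>. ennreal (?u (1 / Suc n) \<gamma>) \<partial>lborel) \<le> ennreal (2 * pi) * ?N"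
      by (intro always_eventually allI le) simp
  qed simp
qed

text \<open>From exp (- u) \<le> 1 / u at u = \<tau>^2 / (2 \<sigma>^2) and sqrt (2 pi) \<ge> 2.
  Away from 0 the density thus tends to 0 linearly in \<sigma>.\<close>

lemma normal_density_le:
  assumes "\<sigma> > 0" "\<tau> \<noteq> 0"
  shows "normal_density 0 \<sigma> \<tau> \<le> \<sigma> / \<tau>\<^sup>2"
proof -
  let ?u = "\<tau>\<^sup>2 / (2 * \<sigma>\<^sup>2)"
  have u: "?u > 0" using assms by simp
  have "2 * \<sigma> \<le> sqrt (2 * pi * \<sigma>\<^sup>2)"
    using pi_gt3 assms by (intro real_le_rsqrt) (simp add: power_mult_distrib)
  then have 1: "1 / sqrt (2 * pi * \<sigma>\<^sup>2) \<le> 1 / (2 * \<sigma>)" using assms by (intro divide_left_mono) auto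
  have "?u \<le> exp ?u" using exp_ge_add_one_self[of ?u] by linarith
  then have 2: "exp (- ?u) \<le> 1 / ?u"
    unfolding exp_minus inverse_eq_divide using u by (intro frac_le) auto
  have "normal_density 0 \<sigma> \<tau> = (1 / sqrt (2 * pi * \<sigma>\<^sup>2)) * exp (- ?u)" by (simp add: normal_density_def)
  also have "\<dots> \<le> (1 / (2 * \<sigma>)) * (1 / ?u)" by (intro mult_mono 1 2) (use assms in auto)
  also have "\<dots> = \<sigma> / \<tau>\<^sup>2" using assms by (simp add: power2_eq_square)
  finally show ?thesis .
qed

text \<open>Wherever f(t) g(s) is nonzero, |t - s| \<ge> a, so the density is at most \<sigma> / a^2
  and the right side of the regularised identity vanishes in the limit. The left side converges to
  the inner product, dominated by the integrable product of the transforms.\<close>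

lemma fourier_separated_supports_orthogonal:
  assumes f: "integrable lborel f" "\<And>t. t > - a \<Longrightarrow> f t = 0"
    and g: "integrable lborel g" "\<And>t. t < 0 \<Longrightarrow> g t = 0" and a: "a > 0"
    and fg: "integrable lborel (\<lambda>\<gamma>. fourier f \<gamma> * cnj (fourier g \<gamma>))"
  shows "L2_inner lborel (fourier f) (fourier g) = 0"
proof -
  let ?M = "lborel \<Otimes>\<^sub>M lborel :: (real \<times> real) measure"
  let ?\<sigma> = "\<lambda>n. 1 / real (Suc n)"
  let ?G = "\<lambda>n \<gamma>. fourier f \<gamma> * cnj (fourier g \<gamma>) * of_real (exp (- (?\<sigma> n * \<gamma>)\<^sup>2 / 2))"
  have [measurable]: "f \<in> borel_measurable borel" "g \<in> borel_measurable borel" using f g by auto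
  have "(\<lambda>n. \<integral>\<gamma>. ?G n \<gamma> \<partial>lborel) \<longlonglongrightarrow> L2_inner lborel (fourier f) (fourier g)"
    unfolding L2_inner_def
  proof (rule integral_dominated_convergence[OF _ _ integrable_norm[OF fg]])
    show "AE \<gamma> in lborel. norm (?G n \<gamma>) \<le> norm (fourier f \<gamma> * cnj (fourier g \<gamma>))" for n
      by (auto simp: norm_mult intro!: mult_left_le)
    show "AE \<gamma> in lborel. (\<lambda>n. ?G n \<gamma>) \<longlonglongrightarrow> fourier f \<gamma> * cnj (fourier g \<gamma>)"
    proof (intro AE_I2)
      fix \<gamma> :: real
      have "(\<lambda>n. ?G n \<gamma>) \<longlonglongrightarrow> fourier f \<gamma> * cnj (fourier g \<gamma>) * of_real (exp (- (0 * \<gamma>)\<^sup>2 / 2))"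
        by (intro tendsto_intros LIMSEQ_inverse_Suc) auto
      then show "(\<lambda>n. ?G n \<gamma>) \<longlonglongrightarrow> fourier f \<gamma> * cnj (fourier g \<gamma>)" by simp
    qed
  qed auto
  moreover have "(\<lambda>n. \<integral>\<gamma>. ?G n \<gamma> \<partial>lborel) \<longlonglongrightarrow> 0"
  proof (rule Lim_null_comparison)
    let ?C = "\<integral>p. cmod (f (fst p) * g (snd p)) \<partial>?M"
    have "norm (\<integral>\<gamma>. ?G n \<gamma> \<partial>lborel) \<le> 2 * pi / a\<^sup>2 * ?C * ?\<sigma> n" for n
    proof -
      let ?h = "\<lambda>p. f (fst p) * cnj (g (snd p)) * of_real (2 * pi * normal_density 0 (?\<sigma> n) (fst p - snd p))"
      have le: "norm (?h p) \<le> 2 * pi / a\<^sup>2 * ?\<sigma> n * cmod (f (fst p) * g (snd p))" for p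
      proof (cases "fst p \<le> - a \<and> snd p \<ge> 0")
        case True
        then have "a\<^sup>2 \<le> (fst p - snd p)\<^sup>2" using a by (subst abs_le_square_iff[symmetric]) auto
        then have "?\<sigma> n / (fst p - snd p)\<^sup>2 \<le> ?\<sigma> n / a\<^sup>2" using a by (intro frac_le) auto
        moreover have "normal_density 0 (?\<sigma> n) (fst p - snd p) \<le> ?\<sigma> n / (fst p - snd p)\<^sup>2"
          using True a by (intro normal_density_le) auto
        ultimately have "normal_density 0 (?\<sigma> n) (fst p - snd p) \<le> ?\<sigma> n / a\<^sup>2" by linarith
        then have "cmod (f (fst p) * g (snd p)) * (2 * pi * normal_density 0 (?\<sigma> n) (fst p - snd p)) \<le>
            cmod (f (fst p) * g (snd p)) * (2 * pi * (?\<sigma> n / a\<^sup>2))"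
          by (intro mult_left_mono) auto
        then show ?thesis by (simp add: norm_mult abs_mult normal_density_nonneg mult_ac)
      next
        case False
        then have "f (fst p) = 0 \<or> g (snd p) = 0" using f(2)[of "fst p"] g(2)[of "snd p"] by auto
        then show ?thesis by auto
      qed
      have fg_int: "integrable ?M (\<lambda>p. f (fst p) * g (snd p))"
        by (rule product_integral(1)[OF f(1) g(1)])
      have "integrable ?M (\<lambda>p. 2 * pi / a\<^sup>2 * ?\<sigma> n * cmod (f (fst p) * g (snd p)))"
        by (rule integrable_mult_right[OF integrable_norm[OF fg_int]])
      then have "(\<integral>p. norm (?h p) \<partial>?M) \<le> (\<integral>p. 2 * pi / a\<^sup>2 * ?\<sigma> n * cmod (f (fst p) * g (snd p)) \<partial>?M)"
        using le by (rule integral_mono') simp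
      moreover have "norm (\<integral>p. ?h p \<partial>?M) \<le> (\<integral>p. norm (?h p) \<partial>?M)" by (rule integral_norm_bound)
      moreover have "(\<integral>\<gamma>. ?G n \<gamma> \<partial>lborel) = (\<integral>p. ?h p \<partial>?M)"
        by (rule fourier_gaussian_identity[OF f(1) g(1)]) simp
      moreover have "(\<integral>p. 2 * pi / a\<^sup>2 * ?\<sigma> n * cmod (f (fst p) * g (snd p)) \<partial>?M) = 2 * pi / a\<^sup>2 * ?C * ?\<sigma> n"
        by (simp only: integral_mult_right_zero) (simp only: mult_ac)
      ultimately show ?thesis by (simp only:)
    qed
    then show "\<forall>\<^sub>F n in sequentially. norm (\<integral>\<gamma>. ?G n \<gamma> \<partial>lborel) \<le> 2 * pi / a\<^sup>2 * ?C * ?\<sigma> n" by simp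
    show "(\<lambda>n. 2 * pi / a\<^sup>2 * ?C * ?\<sigma> n) \<longlonglongrightarrow> 0"
      using tendsto_mult_left[OF LIMSEQ_inverse_Suc, of "2 * pi / a\<^sup>2 * ?C"] by simp
  qed
  ultimately show ?thesis by (rule LIMSEQ_unique)
qed

text \<open>Translating \<open>f\<close> to the left opens a gap between the supports, outside which the Gaussian kernel
  tends to \<open>0\<close> uniformly.\<close>

lemma fourier_opposite_supports_orthogonal:
  assumes f: "integrable lborel f" "\<And>t. t > 0 \<Longrightarrow> f t = 0"
    and g: "integrable lborel g" "\<And>t. t < 0 \<Longrightarrow> g t = 0"
    and fg: "fourier f \<in> L2 lborel" "fourier g \<in> L2 lborel"
  shows "L2_inner lborel (fourier f) (fourier g) = 0"
proof -
  let ?a = "\<lambda>n. 1 / real (Suc n)"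
  let ?E = "\<lambda>n \<gamma>. exp (- (\<i> * complex_of_real \<gamma> * of_real (?a n)))"
  have [measurable]: "f \<in> borel_measurable borel" "g \<in> borel_measurable borel" using f g by auto
  \<comment> \<open>Translation in time becomes a unimodular factor, which tends to 1 as the gap
    closes.\<close>
  have shift: "fourier (\<lambda>t. f (t + ?a n)) \<gamma> = ?E n \<gamma> * fourier f \<gamma>" for n \<gamma>
  proof -
    have "fourier (\<lambda>t. f (t + ?a n)) \<gamma> = (\<integral>t. ?E n \<gamma> * (f t * exp (\<i> * of_real \<gamma> * of_real t)) \<partial>lborel)"
      unfolding fourier_def
      by (subst lborel_integral_real_affine[where c = 1 and t = "- ?a n"])
        (simp_all add: algebra_simps exp_diff exp_minus divide_inverse)
    then show ?thesis by (simp add: fourier_def)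
  qed
  have E1: "cmod (?E n \<gamma>) = 1" for n \<gamma> by (simp add: norm_exp_eq_Re)
  have int: "integrable lborel (\<lambda>\<gamma>. fourier f \<gamma> * cnj (fourier g \<gamma>))" by (rule L2_inner_integrable[OF fg])
  have zero: "L2_inner lborel (\<lambda>\<gamma>. ?E n \<gamma> * fourier f \<gamma>) (fourier g) = 0" for n
  proof -
    have "L2_inner lborel (fourier (\<lambda>t. f (t + ?a n))) (fourier g) = 0"
    proof (rule fourier_separated_supports_orthogonal[where a = "?a n", OF _ _ g])
      show "?a n > 0" by simp
      show "integrable lborel (\<lambda>t. f (t + ?a n))"
        using lborel_integrable_real_affine[OF f(1), of 1 "?a n"] by (simp add: add.commute)
      show "f (t + ?a n) = 0" if "t > - ?a n" for t using that by (intro f(2)) linarith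
      show "integrable lborel (\<lambda>\<gamma>. fourier (\<lambda>t. f (t + ?a n)) \<gamma> * cnj (fourier g \<gamma>))"
        unfolding shift by (rule Bochner_Integration.integrable_bound[OF int]) (auto simp: norm_mult E1)
    qed
    then show ?thesis unfolding shift[abs_def] .
  qed
  have "(\<lambda>n. L2_inner lborel (\<lambda>\<gamma>. ?E n \<gamma> * fourier f \<gamma>) (fourier g)) \<longlonglongrightarrow> L2_inner lborel (fourier f) (fourier g)"
    unfolding L2_inner_def
  proof (rule integral_dominated_convergence[OF _ _ integrable_norm[OF int]])
    show "AE \<gamma> in lborel. (\<lambda>n. ?E n \<gamma> * fourier f \<gamma> * cnj (fourier g \<gamma>)) \<longlonglongrightarrow> fourier f \<gamma> * cnj (fourier g \<gamma>)"
    proof (intro AE_I2)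
      fix \<gamma> :: real
      have "(\<lambda>n. ?E n \<gamma> * fourier f \<gamma> * cnj (fourier g \<gamma>)) \<longlonglongrightarrow>
          exp (- (\<i> * complex_of_real \<gamma> * of_real 0)) * fourier f \<gamma> * cnj (fourier g \<gamma>)"
        by (intro tendsto_intros LIMSEQ_inverse_Suc)
      then show "(\<lambda>n. ?E n \<gamma> * fourier f \<gamma> * cnj (fourier g \<gamma>)) \<longlonglongrightarrow> fourier f \<gamma> * cnj (fourier g \<gamma>)" by simp
    qed
  qed (auto simp: norm_mult E1)
  then show ?thesis unfolding zero by (simp add: LIMSEQ_const_iff)
qed

section \<open>The L2 transform as a limit of truncations\<close>

definition trunc :: "(real \<Rightarrow> complex) \<Rightarrow> nat \<Rightarrow> real \<Rightarrow> complex" where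
  "trunc f N t = indicator {- real N..real N} t * f t"

lemma trunc_L2: "f \<in> L2 lborel \<Longrightarrow> trunc f N \<in> L2 lborel"
  by (rule L2_bound[where w = "\<lambda>t. (cmod (f t))\<^sup>2"])
    (auto simp: trunc_def[abs_def] indicator_def L2_integrable dest!: L2_measurable)

lemma trunc_measurable: "f \<in> L2 lborel \<Longrightarrow> trunc f N \<in> borel_measurable borel"
  using L2_measurable[OF trunc_L2] by simp

text \<open>On a bounded interval |f| \<le> 1 + |f|^2 gives integrability from square
  integrability.\<close>

lemma trunc_integrable:
  assumes f: "f \<in> L2 lborel"
  shows "integrable lborel (trunc f N)"
proof (rule Bochner_Integration.integrable_bound)
  have "integrable lborel (indicator {- real N..real N} :: real \<Rightarrow> real)"
    by (simp add: integrable_indicator_iff emeasure_lborel_Icc_eq)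
  then show "integrable lborel (\<lambda>t. indicator {- real N..real N} t + (cmod (f t))\<^sup>2)"
    using L2_integrable[OF f] by (rule Bochner_Integration.integrable_add)
  show "trunc f N \<in> borel_measurable lborel" using trunc_L2[OF f] by (rule L2_measurable)
  show "AE t in lborel. norm (trunc f N t) \<le> norm (indicator {- real N..real N} t + (cmod (f t))\<^sup>2)"
  proof (intro AE_I2)
    fix t
    have "2 * 1 * cmod (f t) \<le> 1\<^sup>2 + (cmod (f t))\<^sup>2" by (rule sum_squares_bound)
    then have "cmod (f t) \<le> 1 + (cmod (f t))\<^sup>2" using norm_ge_zero[of "f t"] by (simp only: one_power2 mult_1_right)
    then show "norm (trunc f N t) \<le> norm (indicator {- real N..real N} t + (cmod (f t))\<^sup>2)"
      by (auto simp: trunc_def indicator_def)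
  qed
qed

lemma trunc_tendsto:
  assumes f: "f \<in> L2 lborel"
  shows "(\<lambda>N. L2_dist_sq lborel f (trunc f N)) \<longlonglongrightarrow> 0"
proof (rule L2_dominated(2))
  show "AE t in lborel. (cmod (trunc f N t))\<^sup>2 \<le> (cmod (f t))\<^sup>2" for N
    by (auto simp: trunc_def indicator_def)
  show "AE t in lborel. (\<lambda>N. trunc f N t) \<longlonglongrightarrow> f t"
  proof (intro AE_I2 tendsto_eventually)
    fix t :: real
    obtain N where "\<bar>t\<bar> \<le> real N" using real_arch_simple by blast
    then have "trunc f n t = f t" if "n \<ge> N" for n using that by (auto simp: trunc_def indicator_def)
    then show "\<forall>\<^sub>F N in sequentially. trunc f N t = f t" by (auto simp: eventually_sequentially)
  qed
qed (use f in \<open>auto simp: L2_integrable trunc_measurable dest: L2_measurable\<close>)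

lemma fourier_in_L2:
  assumes f: "integrable lborel f" "f \<in> L2 lborel"
  shows "fourier f \<in> L2 lborel"
  unfolding L2_iff
proof
  show "fourier f \<in> borel_measurable lborel" using f by auto
  have "(\<integral>\<^sup>+t. ennreal ((cmod (f t))\<^sup>2) \<partial>lborel) < \<infinity>" using f(2) by (simp add: L2_iff)
  then have "ennreal (2 * pi) * (\<integral>\<^sup>+t. ennreal ((cmod (f t))\<^sup>2) \<partial>lborel) < \<infinity>"
    by (simp add: ennreal_mult_less_top)
  with plancherel_le[OF f] show "(\<integral>\<^sup>+\<gamma>. ennreal ((cmod (fourier f \<gamma>))\<^sup>2) \<partial>lborel) < \<infinity>"
    by (rule le_less_trans)
qed

lemma fourier_dist_le:
  assumes "integrable lborel f" "f \<in> L2 lborel" "integrable lborel g" "g \<in> L2 lborel"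
  shows "L2_dist_sq lborel (fourier f) (fourier g) \<le> ennreal (2 * pi) * L2_dist_sq lborel f g"
  using plancherel_le[of "\<lambda>t. f t - g t"] assms
  by (simp add: L2_dist_sq_def fourier_diff L2_diff)

text \<open>By Plancherel's inequality the transforms of the truncations form a Cauchy sequence, so
  the choice in the definition of \<open>fourier_L2\<close> has a witness.\<close>

lemma fourier_L2_limit:
  assumes f: "f \<in> L2 lborel"
  shows "fourier_L2 f \<in> L2 lborel"
    and "(\<lambda>N. L2_dist_sq lborel (fourier (trunc f N)) (fourier_L2 f)) \<longlonglongrightarrow> 0"
proof -
  have [measurable]: "f \<in> borel_measurable borel" "trunc f N \<in> borel_measurable borel" for N
    using f by (auto simp: trunc_measurable dest: L2_measurable)
  have "\<exists>F\<in>L2 lborel. (\<lambda>N. L2_dist_sq lborel (fourier (trunc f N)) F) \<longlonglongrightarrow> 0"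
  proof (rule L2_complete)
    show "fourier (trunc f n) \<in> L2 lborel" for n
      by (intro fourier_in_L2 trunc_integrable trunc_L2 f)
    fix \<epsilon> :: ennreal assume \<epsilon>: "\<epsilon> > 0"
    \<comment> \<open>The Lipschitz constant for squared distances. Dividing \<epsilon> by it, and
      by 4 for the squared triangle inequality, determines N.\<close>
    define a where "a = ennreal (2 * pi)"
    have a: "a > 0" "a < top" by (auto simp: a_def)
    have "\<epsilon> / a > 0" using \<epsilon> a by (simp add: ennreal_zero_less_divide)
    then have "\<epsilon> / a / 4 > 0" by (simp add: ennreal_zero_less_divide)
    from order_tendstoD(2)[OF trunc_tendsto[OF f] this]
    obtain N where N: "\<And>n. n \<ge> N \<Longrightarrow> L2_dist_sq lborel f (trunc f n) < \<epsilon> / a / 4"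
      by (auto simp: eventually_sequentially)
    have "L2_dist_sq lborel (fourier (trunc f m)) (fourier (trunc f n)) < \<epsilon>" if "m \<ge> N" "n \<ge> N" for m n
    proof -
      have "L2_dist_sq lborel (fourier (trunc f m)) (fourier (trunc f n)) \<le> a * L2_dist_sq lborel (trunc f m) (trunc f n)"
        unfolding a_def by (intro fourier_dist_le trunc_integrable trunc_L2 f)
      also have "L2_dist_sq lborel (trunc f m) (trunc f n) \<le>
          2 * L2_dist_sq lborel (trunc f m) f + 2 * L2_dist_sq lborel f (trunc f n)"
        by (rule L2_dist_sq_triangle) auto
      also have "\<dots> < \<epsilon> / a"
        using N[OF that(1)] N[OF that(2)] \<open>\<epsilon> / a > 0\<close>
        by (intro ennreal_quarter_bound) (auto simp: L2_dist_sq_commute[of _ "trunc f m"])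
      also have "a * (\<epsilon> / a) = \<epsilon>" using a by (simp add: ennreal_times_divide mult.commute ennreal_mult_divide_eq)
      finally show ?thesis using a by (simp add: ennreal_mult_strict_left_mono mult_left_mono)
    qed
    then show "\<exists>N. \<forall>m\<ge>N. \<forall>n\<ge>N. L2_dist_sq lborel (fourier (trunc f m)) (fourier (trunc f n)) < \<epsilon>" by blast
  qed
  then have "\<exists>F. F \<in> L2 lborel \<and> (\<lambda>N. L2_dist_sq lborel (fourier (trunc f N)) F) \<longlonglongrightarrow> 0" by blast
  then have "fourier_L2 f \<in> L2 lborel \<and> (\<lambda>N. L2_dist_sq lborel (fourier (trunc f N)) (fourier_L2 f)) \<longlonglongrightarrow> 0"
    unfolding fourier_L2_def trunc_def[abs_def] by (rule someI_ex)
  then show "fourier_L2 f \<in> L2 lborel" "(\<lambda>N. L2_dist_sq lborel (fourier (trunc f N)) (fourier_L2 f)) \<longlonglongrightarrow> 0"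
    by auto
qed

text \<open>Both sides are limits of the transforms of the truncations, and L2 limits are unique up
  to null sets.\<close>

lemma fourier_L2_eq_fourier:
  assumes f: "integrable lborel f" "f \<in> L2 lborel"
  shows "AE \<gamma> in lborel. fourier_L2 f \<gamma> = fourier f \<gamma>"
proof (rule L2_limit_unique[OF _ _ _ fourier_L2_limit(2)[OF f(2)]])
  show "fourier (trunc f n) \<in> L2 lborel" for n
    by (intro fourier_in_L2 trunc_integrable trunc_L2 f)
  show "fourier_L2 f \<in> L2 lborel" by (rule fourier_L2_limit(1)[OF f(2)])
  show "fourier f \<in> L2 lborel" by (rule fourier_in_L2[OF f])
  show "(\<lambda>n. L2_dist_sq lborel (fourier (trunc f n)) (fourier f)) \<longlonglongrightarrow> 0"
  proof (rule tendsto_sandwich[OF _ _ tendsto_const, rotated 2])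
    show "\<forall>\<^sub>F n in sequentially. L2_dist_sq lborel (fourier (trunc f n)) (fourier f) \<le>
        ennreal (2 * pi) * L2_dist_sq lborel f (trunc f n)"
      unfolding L2_dist_sq_commute[of lborel f]
      by (intro always_eventually allI fourier_dist_le trunc_integrable trunc_L2 f)
    show "(\<lambda>n. ennreal (2 * pi) * L2_dist_sq lborel f (trunc f n)) \<longlonglongrightarrow> 0"
      using ennreal_tendsto_cmult[OF _ trunc_tendsto[OF f(2)], of "ennreal (2 * pi)"] by simp
  qed simp
qed

section \<open>The lower Hardy space and the negative half of the rational basis\<close>

lemma hardy_lower_orthogonal:
  assumes F: "F \<in> hardy_lower"
    and g: "integrable lborel g" "g \<in> L2 lborel" "\<And>t. t < 0 \<Longrightarrow> g t = 0"
  shows "L2_inner lborel F (fourier g) = 0"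
proof -
  obtain f where f: "f \<in> L2 lborel" "\<And>t. t > 0 \<Longrightarrow> f t = 0" and FL: "F \<in> L2 lborel"
      and eq: "AE \<gamma> in lborel. F \<gamma> = fourier_L2 f \<gamma>"
    using F unfolding hardy_lower_def by auto
  \<comment> \<open>Truncation keeps the support of f and makes it integrable, so orthogonality
    holds along the sequence that defines the transform.\<close>
  have zero: "L2_inner lborel (fourier (trunc f N)) (fourier g) = 0" for N
    by (rule fourier_opposite_supports_orthogonal)
      (use g f in \<open>auto intro!: trunc_integrable fourier_in_L2 trunc_L2 simp: trunc_def\<close>)
  have "(\<lambda>N. L2_inner lborel (fourier (trunc f N)) (fourier g)) \<longlonglongrightarrow> L2_inner lborel (fourier_L2 f) (fourier g)"
    by (intro L2_inner_tendsto fourier_in_L2 trunc_integrable trunc_L2 fourier_L2_limit f g) simp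
  then have "L2_inner lborel (fourier_L2 f) (fourier g) = 0" by (simp add: zero LIMSEQ_const_iff)
  moreover have "L2_inner lborel F (fourier g) = L2_inner lborel (fourier_L2 f) (fourier g)"
    using eq FL fourier_L2_limit(1)[OF f(1)] fourier_in_L2[OF g(1,2)]
    by (intro L2_inner_cong_AE) (auto dest: L2_measurable)
  ultimately show ?thesis by simp
qed

lemma fourier_in_hardy_lower:
  assumes "integrable lborel f" "f \<in> L2 lborel" "\<And>t. t > 0 \<Longrightarrow> f t = 0"
  shows "fourier f \<in> hardy_lower"
  using assms fourier_L2_eq_fourier[OF assms(1,2)] fourier_in_L2[OF assms(1,2)]
  unfolding hardy_lower_def by (auto intro!: bexI[of _ f] elim: eventually_mono)

text \<open>The density of the gamma law of shape k + 1 and rate 1. Its transform is a power of 1 /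
  (1 - \<i> \<gamma>), the building block of the \<open>e n\<close> with n \<ge> 0.\<close>

definition gamma_kernel :: "nat \<Rightarrow> real \<Rightarrow> complex" where
  "gamma_kernel k t = (if t > 0 then of_real (t ^ k * exp (- t) / fact k) else 0)"

text \<open>t^k / k! is one term of the series of exp t. The bound 1 makes the square of the kernel
  smaller than the kernel, hence integrable.\<close>

lemma gamma_kernel_bound: "cmod (gamma_kernel k t) \<le> 1"
proof (cases "t > 0")
  case True
  have "(\<Sum>n\<in>{k}. t ^ n /\<^sub>R fact n) \<le> (\<Sum>n. t ^ n /\<^sub>R fact n)"
    by (rule sum_le_suminf[OF summable_exp_generic]) (use True in auto)
  then have "t ^ k / fact k \<le> exp t" by (simp add: exp_def divide_inverse mult.commute)
  then have "t ^ k / fact k * exp (- t) \<le> exp t * exp (- t)" by (intro mult_right_mono) auto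
  then show ?thesis using True by (simp add: gamma_kernel_def exp_minus_inverse norm_mult norm_divide norm_power)
qed (simp add: gamma_kernel_def)

lemma gamma_kernel_integrable: "integrable lborel (gamma_kernel k)"
proof -
  have "integrable lborel (\<lambda>x. of_real (x^k * exp (-x) * indicator {0 <..} x / fact k) :: complex)"
    using has_bochner_integral_I0i_power_exp_m[of k]
    by (intro integrable_of_real integrable_divide) (auto simp: has_bochner_integral_iff)
  moreover have "gamma_kernel k = (\<lambda>x. of_real (x^k * exp (-x) * indicator {0 <..} x / fact k))"
    by (auto simp: gamma_kernel_def fun_eq_iff indicator_def)
  ultimately show ?thesis by simp
qed

lemma bounded_integrable_L2:
  assumes "integrable lborel f" "\<And>t. cmod (f t) \<le> 1"
  shows "f \<in> L2 lborel"
proof (rule L2_bound)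
  show "integrable lborel (\<lambda>t. cmod (f t))" using assms by simp
  show "AE t in lborel. (cmod (f t))\<^sup>2 \<le> cmod (f t)"
    by (intro AE_I2) (use mult_left_le[OF assms(2) norm_ge_zero] in \<open>simp add: power2_eq_square\<close>)
qed (use assms in auto)

text \<open>With c = 1 - \<i> \<gamma>, the derivative of G (k + 1) is G k - c G (k + 1), and G (k +
  1) vanishes at both ends of the half-line; so each step divides the transform by c. The initial
  value 1 / c comes from G 0 being 1 at 0.\<close>

lemma fourier_gamma_kernel: "fourier (gamma_kernel k) \<gamma> = (1 / (1 - \<i> * of_real \<gamma>)) ^ (k + 1)"
proof -
  define c where "c = 1 - \<i> * complex_of_real \<gamma>"
  have c0: "c \<noteq> 0" by (simp add: c_def)
  define G where "G k t = complex_of_real (t ^ k / fact k) * exp (- (c * of_real t))" for k t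
  have normG: "cmod (G k t) = \<bar>t\<bar> ^ k / fact k * exp (- t)" for k t
    by (simp add: G_def norm_mult c_def norm_divide norm_power norm_exp_eq_Re)
  have GK: "gamma_kernel k t * exp (\<i> * of_real \<gamma> * of_real t) = indicator {0<..} t *\<^sub>R G k t" for k t
    by (simp add: gamma_kernel_def G_def c_def indicator_def algebra_simps exp_diff exp_minus_inverse
        exp_of_real[symmetric] flip: exp_add)
  have fourier_G: "fourier (gamma_kernel k) \<gamma> = (LBINT t=0..\<infinity>. G k t)" for k
    unfolding fourier_def GK
    by (simp add: interval_lebesgue_integral_def set_lebesgue_integral_def zero_ereal_def)
  have intG: "set_integrable lborel (einterval 0 \<infinity>) (G k)" for k
    using fourier_integrable[OF gamma_kernel_integrable[of k], of \<gamma>]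
    by (simp add: GK set_integrable_def zero_ereal_def)
  have isContG: "isCont (G k) t" for k t
    unfolding G_def by (intro continuous_intros) auto
  have derivG: "(G 0 has_vector_derivative - c * G 0 t) (at t)"
    "(G (Suc k) has_vector_derivative G k t - c * G (Suc k) t) (at t)" for k t
  proof -
    have "((\<lambda>w. w ^ Suc k / fact (Suc k) * exp (- (c * w))) has_field_derivative
        (of_real t ^ k / fact k * exp (- (c * of_real t)) - c * (of_real t ^ Suc k / fact (Suc k) * exp (- (c * of_real t))))) (at (of_real t))"
      by (auto intro!: derivative_eq_intros simp del: power_Suc fact_Suc simp: field_simps)
         (simp add: field_simps)
    from has_vector_derivative_real_field[OF this]
    show "(G (Suc k) has_vector_derivative G k t - c * G (Suc k) t) (at t)"
      by (simp add: G_def[abs_def])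
    have "((\<lambda>w. exp (- (c * w))) has_field_derivative (- c * exp (- (c * of_real t)))) (at (of_real t))"
      by (auto intro!: derivative_eq_intros)
    from has_vector_derivative_real_field[OF this]
    show "(G 0 has_vector_derivative - c * G 0 t) (at t)" by (simp add: G_def[abs_def])
  qed
  have lim0: "((G k \<circ> real_of_ereal) \<longlongrightarrow> G k 0) (at_right 0)" for k
    unfolding zero_ereal_def ereal_tendsto_simps
    using isContG[of 0 k] unfolding isCont_def by (rule tendsto_mono[OF at_le[OF subset_UNIV]])
  have limtop: "((G k \<circ> real_of_ereal) \<longlongrightarrow> 0) (at_left \<infinity>)" for k
    unfolding ereal_tendsto_simps
  proof (rule Lim_null_comparison)
    show "\<forall>\<^sub>F t in at_top. norm (G k t) \<le> (t ^ k / exp t) / fact k"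
      using eventually_ge_at_top[of 0] by eventually_elim (simp add: normG exp_minus divide_inverse mult_ac)
    show "((\<lambda>t::real. (t ^ k / exp t) / fact k) \<longlongrightarrow> 0) at_top"
    proof -
      have "((\<lambda>t::real. (t ^ k / exp t) / fact k) \<longlongrightarrow> 0 / fact k) at_top"
        by (intro tendsto_divide tendsto_power_div_exp_0 tendsto_const) simp
      then show ?thesis by (simp only: div_0)
    qed
  qed
  have "fourier (gamma_kernel k) \<gamma> = (1 / c) ^ (k + 1)"
  proof (induction k)
    case 0
    have icG: "set_integrable lborel (einterval 0 \<infinity>) (\<lambda>t. - c * G 0 t)"
      using intG[of 0] by (intro set_integrable_mult_right) auto
    have "(LBINT t=0..\<infinity>. - c * G 0 t) = 0 - G 0 0"
      by (rule interval_integral_FTC_integrable[where F = "G 0"])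
        (use derivG(1) isContG lim0 limtop icG in \<open>auto intro!: continuous_intros\<close>)
    then have "c * fourier (gamma_kernel 0) \<gamma> = 1"
      unfolding fourier_G interval_lebesgue_integral_mult_right by (simp add: G_def[of 0 0])
    then show ?case using c0 by (simp add: field_simps)
  next
    case (Suc k)
    have "(LBINT t=0..\<infinity>. G k t - c * G (Suc k) t) = 0 - G (Suc k) 0"
      by (rule interval_integral_FTC_integrable[where F = "G (Suc k)"])
        (use derivG(2) isContG lim0 limtop intG in \<open>auto intro!: continuous_intros set_integral_diff set_integrable_mult_right\<close>)
    moreover have "(LBINT t=0..\<infinity>. G k t - c * G (Suc k) t) = (LBINT t=0..\<infinity>. G k t) - (LBINT t=0..\<infinity>. c * G (Suc k) t)"
      by (rule interval_lebesgue_integral_diff(2))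
        (use intG in \<open>auto simp: interval_lebesgue_integrable_def intro!: set_integrable_mult_right\<close>)
    ultimately have "fourier (gamma_kernel k) \<gamma> - c * fourier (gamma_kernel (Suc k)) \<gamma> = 0"
      unfolding fourier_G interval_lebesgue_integral_mult_right by (simp add: G_def[of _ 0])
    then have "fourier (gamma_kernel (Suc k)) \<gamma> = fourier (gamma_kernel k) \<gamma> / c" using c0 by (simp add: field_simps)
    then show ?case using Suc by simp
  qed
  then show ?thesis by (simp add: c_def)
qed

lemma fourier_reflect: "fourier (\<lambda>t. f (- t)) \<gamma> = fourier f (- \<gamma>)"
  unfolding fourier_def
  by (subst lborel_integral_real_affine[where c = "-1" and t = 0]) auto

text \<open>Binomial expansion of \<open>cayley\<close> as 2 r - 1 with r = 1 / (1 - \<i> \<gamma>).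
  The further factor r in \<open>e n\<close> makes every exponent at least 1, so each term is a
  multiple of the transform of a gamma kernel.\<close>

lemma e_nonneg_expansion:
  "e (int n) \<gamma> = (\<Sum>j\<le>n. (1 / of_real (sqrt pi) * of_nat (n choose j) * 2 ^ j * (- 1) ^ (n - j)) *
    (1 / (1 - \<i> * of_real \<gamma>)) ^ (j + 1))"
proof -
  let ?r = "1 / (1 - \<i> * complex_of_real \<gamma>)"
  have "cayley \<gamma> = 2 * ?r + (-1)"
    by (simp add: cayley_def divide_simps)
  then have "cayley \<gamma> ^ n = (\<Sum>j\<le>n. of_nat (n choose j) * (2 * ?r) ^ j * (- 1) ^ (n - j))"
    by (simp only: binomial_ring)
  then have "e (int n) \<gamma> = 1 / of_real (sqrt pi) * ?r * (\<Sum>j\<le>n. of_nat (n choose j) * (2 * ?r) ^ j * (- 1) ^ (n - j))"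
    by (simp only: e_eq power_int_of_nat)
  also have "\<dots> = (\<Sum>j\<le>n. (1 / of_real (sqrt pi) * of_nat (n choose j) * 2 ^ j * (- 1) ^ (n - j)) * ?r ^ (j + 1))"
    unfolding sum_distrib_left by (intro sum.cong refl) (simp only: power_mult_distrib power_add power_one_right mult_ac)
  finally show ?thesis .
qed

text \<open>Reflection inverts \<open>cayley\<close>. The offset -1 arises because it also turns 1 /
  (1 - \<i> \<gamma>) into 1 / (1 + \<i> \<gamma>), which is 1 / (1 - \<i> \<gamma>) times the
  inverse of \<open>cayley\<close>.\<close>

lemma e_reflect: "e (- 1 - n) \<gamma> = e n (- \<gamma>)"
proof -
  have "cayley (- \<gamma>) = inverse (cayley \<gamma>)" by (simp add: cayley_def)
  then have "cayley (- \<gamma>) powi n = inverse (cayley \<gamma> powi n)" by (simp add: power_int_inverse)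
  moreover have "cayley \<gamma> powi (- 1 - n) = inverse (cayley \<gamma>) * inverse (cayley \<gamma> powi n)"
    by (simp add: power_int_diff divide_inverse)
  ultimately show ?thesis by (simp add: e_eq) (simp add: cayley_def)
qed

text \<open>An element of \<open>hardy_lower\<close> is orthogonal to every \<open>e n\<close> with
  n \<ge> 0, and these terms drop out of its approximations. Conversely, S supplies closedness, so
  only generators matter: by reflection, an \<open>e n\<close> with n < 0 is a combination of
  transforms of gamma kernels on the negative half-line.\<close>

lemma hardy_lower_eq_e_span:
  assumes hl: "hardy_lower = L2_closed_span lborel S" and S: "S \<subseteq> L2 lborel"
  shows "hardy_lower = L2_closed_span lborel (e ` {n. n < 0})"
proof
  have gL2: "gamma_kernel k \<in> L2 lborel" for k
    by (rule bounded_integrable_L2[OF gamma_kernel_integrable gamma_kernel_bound])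
  show "hardy_lower \<subseteq> L2_closed_span lborel (e ` {n. n < 0})"
  proof
    fix F assume F: "F \<in> hardy_lower"
    then have FL: "F \<in> L2 lborel" by (simp add: hardy_lower_def)
    have orth: "L2_inner lborel F (e i) = 0" if i: "i \<ge> 0" for i
    proof -
      obtain n where n: "i = int n" using i zero_le_imp_eq_int by blast
      have "L2_inner lborel F (e i) = L2_inner lborel F (\<lambda>\<gamma>. \<Sum>j\<le>n. (1 / of_real (sqrt pi) * of_nat (n choose j) * 2 ^ j * (- 1) ^ (n - j)) *
            fourier (gamma_kernel j) \<gamma>)"
        unfolding n fourier_gamma_kernel e_nonneg_expansion[symmetric] ..
      also have "\<dots> = 0"
        using FL gL2
        by (subst L2_inner_sum_right)
          (auto intro!: sum.neutral fourier_in_L2 gamma_kernel_integrable hardy_lower_orthogonal[OF F]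
             simp: gamma_kernel_def)
      finally show ?thesis .
    qed
    show "F \<in> L2_closed_span lborel (e ` {n. n < 0})"
    proof (rule L2_closed_span_orthonormal_restrict[OF e_L2 e_orthonormal])
      show "F \<in> L2_closed_span lborel (e ` UNIV)" using FL e_span_eq_L2 by simp
    qed (use orth in auto)
  qed
  show "L2_closed_span lborel (e ` {n. n < 0}) \<subseteq> hardy_lower"
    unfolding hl
  proof (rule L2_closed_span_minimal[OF S], clarify)
    fix i :: int assume "i < 0"
    then obtain n where "- 1 - i = int n" using zero_le_imp_eq_int[of "- 1 - i"] by auto
    then have n: "i = - 1 - int n" by simp
    have refl: "integrable lborel (\<lambda>t. gamma_kernel j (- t))" for j
      using lborel_integrable_real_affine[OF gamma_kernel_integrable[of j], of "-1" 0] by simp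
    have reflL2: "(\<lambda>t. gamma_kernel j (- t)) \<in> L2 lborel" for j
      by (rule bounded_integrable_L2[OF refl gamma_kernel_bound])
    have "e i = (\<lambda>\<gamma>. \<Sum>j\<le>n. (1 / of_real (sqrt pi) * of_nat (n choose j) * 2 ^ j * (- 1) ^ (n - j)) *
            fourier (\<lambda>t. gamma_kernel j (- t)) \<gamma>)"
      by (rule ext) (simp only: n e_reflect e_nonneg_expansion fourier_reflect fourier_gamma_kernel)
    moreover have "fourier (\<lambda>t. gamma_kernel j (- t)) \<in> L2_closed_span lborel S" for j
      unfolding hl[symmetric] by (rule fourier_in_hardy_lower[OF refl reflL2]) (simp add: gamma_kernel_def)
    ultimately show "e i \<in> L2_closed_span lborel S" by (simp only: L2_closed_span_sum[OF S])
  qed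
qed

section \<open>The past in the frequency domain\<close>

lemma cmod_iexp_minus_1_le: "cmod (exp (\<i> * of_real x) - 1) \<le> \<bar>x\<bar>"
  using iexp_approx1[of x 0] by simp

lemma cmod_iexp_minus_1_le_2: "cmod (exp (\<i> * of_real x) - 1) \<le> 2"
  using norm_triangle_ineq4[of "exp (\<i> * of_real x)" 1] by simp

lemma z_zero [simp]: "z t 0 = 0" "z 0 \<gamma> = 0"
  by (simp_all add: z_def)

lemma cmod_z: "cmod (z t \<gamma>) = cmod (exp (\<i> * of_real (\<gamma> * t)) - 1) / \<bar>\<gamma>\<bar>"
  by (simp add: z_def norm_divide norm_mult mult.assoc)

lemma cmod_z_le: "cmod (z t \<gamma>) \<le> \<bar>t\<bar>"
  using cmod_iexp_minus_1_le[of "\<gamma> * t"]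
  by (cases "\<gamma> = 0") (auto simp: cmod_z abs_mult divide_simps mult.commute)

lemma cmod_z_le': "cmod (z t \<gamma>) * \<bar>\<gamma>\<bar> \<le> 2"
  using cmod_iexp_minus_1_le_2[of "\<gamma> * t"] by (cases "\<gamma> = 0") (auto simp: cmod_z)

lemma borel_measurable_z [measurable]: "z t \<in> borel_measurable borel"
  unfolding z_def[abs_def] by measurable

text \<open>Boundedness near 0 and decay like 1 / |\<gamma>| combine to a multiple of 1 / (1 +
  \<gamma>^2), the weight against which the spectral density is integrable.\<close>

lemma z_sq_le: "(cmod (z t \<gamma>))\<^sup>2 * (1 + \<gamma>\<^sup>2) \<le> t\<^sup>2 + 4"
proof -
  have "(cmod (z t \<gamma>))\<^sup>2 \<le> \<bar>t\<bar>\<^sup>2" using cmod_z_le by (intro power_mono) auto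
  moreover have "(cmod (z t \<gamma>) * \<bar>\<gamma>\<bar>)\<^sup>2 \<le> 2\<^sup>2" using cmod_z_le' by (intro power_mono) auto
  ultimately show ?thesis by (simp add: power_mult_distrib algebra_simps)
qed

text \<open>At \<gamma> = 0 the transform is t, while \<open>z\<close> takes the default value 0 of
  division; hence the exclusion.\<close>

lemma fourier_signed_indicator:
  assumes "\<gamma> \<noteq> 0"
  shows "fourier (signed_indicator t) \<gamma> = z t \<gamma>"
proof -
  have I: "(\<integral>s. indicator {a..b} s *\<^sub>R exp (\<i> * of_real \<gamma> * of_real s) \<partial>lborel) =
      exp (\<i> * of_real \<gamma> * of_real b) / (\<i> * of_real \<gamma>) - exp (\<i> * of_real \<gamma> * of_real a) / (\<i> * of_real \<gamma>)"
    if "a \<le> b" for a b :: real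
  proof (rule integral_FTC_Icc[OF that])
    fix x :: real
    have "((\<lambda>w. exp (\<i> * of_real \<gamma> * w) / (\<i> * of_real \<gamma>)) has_field_derivative exp (\<i> * of_real \<gamma> * of_real x)) (at (of_real x))"
      using assms by (auto intro!: derivative_eq_intros)
    from has_vector_derivative_real_field[OF this]
    show "((\<lambda>x. exp (\<i> * of_real \<gamma> * of_real x) / (\<i> * of_real \<gamma>)) has_vector_derivative exp (\<i> * of_real \<gamma> * of_real x)) (at x within {a..b})"
      by (rule has_vector_derivative_at_within)
  qed (intro continuous_intros)
  have "signed_indicator t s * c = (if t \<ge> 0 then indicator {0..t} s *\<^sub>R c else - (indicator {t..0} s *\<^sub>R c))" for s c
    by (simp add: signed_indicator_def indicator_def)
  then show ?thesis
    unfolding fourier_def by (cases "t \<ge> 0") (simp_all add: I z_def diff_divide_distrib)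
qed

lemma signed_indicator_integrable: "integrable lborel (signed_indicator t)"
proof -
  have "integrable lborel (indicator {a..b} :: real \<Rightarrow> complex)" for a b :: real
    using integrable_of_real[OF integrable_real_indicator[of "{a..b}" lborel], where ?'a = complex]
    by (simp add: of_real_indicator emeasure_lborel_Icc_eq)
  then show ?thesis by (auto simp: signed_indicator_def)
qed

lemma signed_indicator_L2: "signed_indicator t \<in> L2 lborel"
proof (rule L2_bound)
  show "integrable lborel (\<lambda>s. cmod (signed_indicator t s))"
    using signed_indicator_integrable by (rule integrable_norm)
  show "AE s in lborel. (cmod (signed_indicator t s))\<^sup>2 \<le> cmod (signed_indicator t s)"
    by (auto simp: signed_indicator_def indicator_def)
qed (use signed_indicator_integrable in auto)

lemma fourier_L2_signed_indicator: "AE \<gamma> in lborel. fourier_L2 (signed_indicator t) \<gamma> = z t \<gamma>"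
  using fourier_L2_eq_fourier[OF signed_indicator_integrable signed_indicator_L2] AE_lborel_singleton[of 0]
  by eventually_elim (simp add: fourier_signed_indicator)

text \<open>The derivative of - exp (- c w) at w = 0, along w = 1/(n+1).\<close>

lemma exp_difference_quotient_LIMSEQ:
  fixes c :: complex
  shows "(\<lambda>n. (1 - exp (- (c * of_real (1 / real (Suc n))))) / of_real (1 / real (Suc n))) \<longlonglongrightarrow> c"
proof -
  have "((\<lambda>w. - exp (- (c * w))) has_field_derivative c) (at 0)"
    by (auto intro!: derivative_eq_intros)
  from DERIV_LIMSEQ[OF this] show ?thesis by (simp add: minus_divide_left[symmetric])
qed

text \<open>The frequency-side form of stationary increments; it makes the span of the weighted
  \<open>z t\<close> with t \<le> 0 invariant under shifts into the past.\<close>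

lemma z_add: "exp (\<i> * of_real \<gamma> * of_real t) * z r \<gamma> = z (t + r) \<gamma> - z t \<gamma>"
  by (simp add: z_def distrib_left exp_add right_diff_distrib flip: diff_divide_distrib)

text \<open>The resolvent is the Laplace transform \<open>\<integral>\<^sub>0\<^sup>\<infinity> exp (- \<epsilon> s) exp (- \<i> \<gamma> s) ds\<close>, approximated here by
  geometric sums.\<close>

lemma multiplier_resolvent:
  assumes S: "S \<subseteq> L2 lborel"
    and inv: "\<And>t. t \<le> 0 \<Longrightarrow> multiplier lborel (L2_closed_span lborel S) (\<lambda>\<gamma>. exp (\<i> * of_real \<gamma> * of_real t))"
    and \<epsilon>: "(\<epsilon>::real) > 0"
  shows "multiplier lborel (L2_closed_span lborel S) (\<lambda>\<gamma>. 1 / (of_real \<epsilon> + \<i> * of_real \<gamma>))"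
proof -
  let ?E = "L2_closed_span lborel S"
  define \<delta> where "\<delta> n = 1 / real (Suc n)" for n
  have \<delta>: "\<delta> n > 0" "\<delta> n \<le> 1" for n by (auto simp: \<delta>_def)
  \<comment> \<open>The ratio of the geometric sum with mesh \<delta> n; \<delta> n times the sum of
    its powers is a Riemann sum of the Laplace integral.\<close>
  define q where "q n \<gamma> = exp (- ((of_real \<epsilon> + \<i> * complex_of_real \<gamma>) * of_real (\<delta> n)))" for n \<gamma>
  have q_power: "q n \<gamma> ^ k = of_real (exp (- (\<epsilon> * \<delta> n)) ^ k) * exp (\<i> * of_real \<gamma> * of_real (- (real k * \<delta> n)))" for n k \<gamma>
    by (simp add: q_def exp_of_real[symmetric] algebra_simps flip: exp_of_nat_mult exp_add)
  have cq: "cmod (q n \<gamma>) = exp (- (\<epsilon> * \<delta> n))" for n \<gamma>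
    by (simp add: q_def norm_exp_eq_Re)
  have c1: "exp (- (\<epsilon> * \<delta> n)) < 1" for n using \<epsilon> \<delta>[of n] by simp
  have sums: "(\<lambda>k. q n \<gamma> ^ k) sums (1 / (1 - q n \<gamma>))" for n \<gamma>
    by (rule geometric_sums) (simp only: cq c1)
  have partial: "multiplier lborel ?E (\<lambda>\<gamma>. \<Sum>k<N. q n \<gamma> ^ k)" for n N
  proof (induction N)
    case (Suc N)
    have "multiplier lborel ?E (\<lambda>\<gamma>. q n \<gamma> ^ N)"
      unfolding q_power using \<delta>[of n] by (intro multiplier_mult multiplier_const S inv) simp
    then show ?case using multiplier_add[OF S Suc.IH] by simp
  qed (use multiplier_const[OF S, of 0] in simp)
  have quotient: "multiplier lborel ?E (\<lambda>\<gamma>. 1 / (1 - q n \<gamma>))" for n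
  proof (rule multiplier_lim[OF S partial, where B = "1 / (1 - exp (- (\<epsilon> * \<delta> n)))"])
    show "(\<lambda>N. \<Sum>k<N. q n \<gamma> ^ k) \<longlonglongrightarrow> 1 / (1 - q n \<gamma>)" for \<gamma>
      using sums by (simp add: sums_def)
    fix N \<gamma>
    have "cmod (\<Sum>k<N. q n \<gamma> ^ k) \<le> (\<Sum>k<N. exp (- (\<epsilon> * \<delta> n)) ^ k)"
      by (rule order_trans[OF norm_sum]) (simp only: norm_power cq order_refl)
    also have "\<dots> \<le> (\<Sum>k. exp (- (\<epsilon> * \<delta> n)) ^ k)"
      by (intro sum_le_suminf summable_geometric) (use c1 in auto)
    finally show "cmod (\<Sum>k<N. q n \<gamma> ^ k) \<le> 1 / (1 - exp (- (\<epsilon> * \<delta> n)))"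
      using c1[of n] by (simp only: suminf_geometric real_norm_def abs_exp_cancel)
  qed
  show ?thesis
  proof (rule multiplier_lim[OF S multiplier_mult[OF multiplier_const[OF S] quotient], where B = "(1 + \<epsilon>) / \<epsilon>"])
    fix \<gamma> :: real
    have "(\<lambda>n. 1 / ((1 - q n \<gamma>) / of_real (\<delta> n))) \<longlonglongrightarrow> 1 / (of_real \<epsilon> + \<i> * of_real \<gamma>)"
      unfolding q_def \<delta>_def using \<epsilon>
      by (intro tendsto_divide tendsto_const exp_difference_quotient_LIMSEQ) (simp add: complex_eq_iff)
    then show "(\<lambda>n. of_real (\<delta> n) * (1 / (1 - q n \<gamma>))) \<longlonglongrightarrow> 1 / (of_real \<epsilon> + \<i> * of_real \<gamma>)"
      by simp
    fix n
    let ?x = "\<epsilon> * \<delta> n"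
    have x: "?x > 0" "?x \<le> \<epsilon>" using \<epsilon> \<delta>[of n] by auto
    \<comment> \<open>With x = \<epsilon> \<delta> n \<le> \<epsilon>, the chain |1 - q| \<ge> 1 -
      exp (- x) \<ge> x / (1 + x) leads to a bound independent of n and \<gamma>.\<close>
    have "exp (- ?x) \<le> 1 / (1 + ?x)"
      unfolding exp_minus inverse_eq_divide using x by (intro divide_left_mono exp_ge_add_one_self) auto
    then have "?x / (1 + ?x) \<le> 1 - exp (- ?x)" using x by (simp add: field_simps)
    also have "\<dots> \<le> cmod (1 - q n \<gamma>)" using norm_triangle_ineq2[of 1 "q n \<gamma>"] by (simp add: cq)
    finally have "\<delta> n * (1 / cmod (1 - q n \<gamma>)) \<le> \<delta> n * (1 / (?x / (1 + ?x)))"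
      using x \<delta>[of n] by (intro mult_left_mono divide_left_mono) (auto intro!: mult_pos_pos divide_pos_pos elim: less_le_trans[rotated])
    also have "\<dots> \<le> (1 + \<epsilon>) / \<epsilon>" using x \<epsilon> \<delta>[of n] by (simp add: field_simps)
    finally show "cmod (of_real (\<delta> n) * (1 / (1 - q n \<gamma>))) \<le> (1 + \<epsilon>) / \<epsilon>"
      using \<delta>[of n] by (simp add: norm_mult norm_divide)
  qed
qed

definition weighted_z :: "(real \<Rightarrow> complex) \<Rightarrow> real \<Rightarrow> real \<Rightarrow> complex" where
  "weighted_z h t \<gamma> = z t \<gamma> * (of_real \<gamma> - \<i>) * cnj (h \<gamma>)"

context
  fixes h :: "real \<Rightarrow> complex"
  assumes h: "h \<in> L2 lborel"
    and outer: "hardy_lower =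
      L2_closed_span lborel {\<lambda>\<gamma>. exp (\<i> * of_real \<gamma> * of_real t) * cnj (h \<gamma>) |t. t < 0}"
begin

private abbreviation (input) "Z \<equiv> weighted_z h"
private abbreviation (input) "\<psi> t \<gamma> \<equiv> exp (\<i> * complex_of_real \<gamma> * complex_of_real t)"

lemma cmod_z_mult_le: "cmod (z t \<gamma> * (of_real \<gamma> - \<i>)) \<le> \<bar>t\<bar> + 2"
proof -
  have "cmod (of_real \<gamma> - \<i>) \<le> \<bar>\<gamma>\<bar> + 1" using norm_triangle_ineq4[of "complex_of_real \<gamma>" \<i>] by simp
  then have "cmod (z t \<gamma>) * cmod (of_real \<gamma> - \<i>) \<le> cmod (z t \<gamma>) * (\<bar>\<gamma>\<bar> + 1)"
    by (intro mult_left_mono) auto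
  moreover have "cmod (z t \<gamma>) * (\<bar>\<gamma>\<bar> + 1) = cmod (z t \<gamma>) * \<bar>\<gamma>\<bar> + cmod (z t \<gamma>)" by (simp only: distrib_left mult_1_right)
  ultimately show ?thesis unfolding norm_mult using cmod_z_le[of t \<gamma>] cmod_z_le'[of t \<gamma>] by linarith
qed

lemma weighted_z_L2: "Z t \<in> L2 lborel"
  unfolding weighted_z_def[abs_def] by (rule L2_bounded_mult[OF L2_cnj[OF h] _ cmod_z_mult_le]) simp

lemma borel_measurable_exp_i [measurable]:
  "(\<lambda>\<gamma>. \<psi> t \<gamma>) \<in> borel_measurable borel"
  by measurable

lemma cmod_exp_i [simp]: "cmod (\<psi> t \<gamma>) = 1"
  using norm_exp_i_times[of "\<gamma> * t"] by (simp add: mult.assoc)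

lemma exp_h_L2: "(\<lambda>\<gamma>. \<psi> t \<gamma> * cnj (h \<gamma>)) \<in> L2 lborel"
  by (rule L2_bounded_mult[OF L2_cnj[OF h], where B = 1]) auto

text \<open>Each inclusion first establishes that the larger span is invariant under shifts into the
  past, which brings in the resolvents, and then produces the generators of the other side.\<close>

lemma weighted_z_span_eq_hardy_lower: "L2_closed_span lborel (Z ` {..0}) = hardy_lower"
proof
  let ?S = "{\<lambda>\<gamma>. \<psi> t \<gamma> * cnj (h \<gamma>) |t. t < 0}"
  let ?E = "L2_closed_span lborel (Z ` {..0})" and ?H = "L2_closed_span lborel ?S"
  let ?\<delta> = "\<lambda>n. 1 / real (Suc n)"
  have S: "?S \<subseteq> L2 lborel" using exp_h_L2 by auto
  have ZS: "Z ` {..0} \<subseteq> L2 lborel" using weighted_z_L2 by auto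
  have \<psi>_add: "\<psi> t \<gamma> * \<psi> r \<gamma> = \<psi> (t + r) \<gamma>" for t r \<gamma>
    by (simp add: distrib_left exp_add)
  show "?E \<subseteq> hardy_lower"
    unfolding outer
  proof (rule L2_closed_span_minimal[OF S], clarify)
    fix t :: real assume t: "t \<le> 0"
    have gen: "(\<lambda>\<gamma>. \<psi> r \<gamma> * cnj (h \<gamma>)) \<in> ?H" if "r < 0" for r
      by (rule L2_closed_span_superset[OF S]) (use that in auto)
    have inv: "multiplier lborel ?H (\<psi> r)" if r: "r \<le> 0" for r
    proof (rule multiplier_of_generators[OF S, where B = 1])
      fix s assume "s \<in> ?S"
      then obtain r' where "s = (\<lambda>\<gamma>. \<psi> r' \<gamma> * cnj (h \<gamma>))" "r' < 0" by auto
      then show "(\<lambda>\<gamma>. \<psi> r \<gamma> * s \<gamma>) \<in> ?H"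
        using gen[of "r + r'"] r by (simp only: \<psi>_add mult.assoc[symmetric])
    qed simp_all
    \<comment> \<open>The generators have t < 0 strictly; cnj h itself is their limit as t increases
      to 0.\<close>
    have "(\<lambda>\<gamma>. 1 * cnj (h \<gamma>)) \<in> ?H"
    proof (rule L2_closed_span_bounded_lim[OF S L2_cnj[OF h] _ _ _ _ gen, where B = 1])
      show "AE \<gamma> in lborel. (\<lambda>n. \<psi> (- ?\<delta> n) \<gamma>) \<longlonglongrightarrow> 1"
      proof (intro AE_I2)
        fix \<gamma> :: real
        have "(\<lambda>n. \<psi> (- ?\<delta> n) \<gamma>) \<longlonglongrightarrow> \<psi> (- 0) \<gamma>" by (intro tendsto_intros LIMSEQ_inverse_Suc)
        then show "(\<lambda>n. \<psi> (- ?\<delta> n) \<gamma>) \<longlonglongrightarrow> 1" by simp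
      qed
    qed (simp_all only: cmod_exp_i order_refl borel_measurable_exp_i measurable_lborel2 borel_measurable_const, simp)
    \<comment> \<open>Formally \<open>z t\<close> is exp (\<i> \<gamma> t) - 1 times the resolvent
      at \<epsilon> = 0. With \<epsilon> > 0 the products stay bounded by |t| and converge to it,
      also at \<gamma> = 0 where all of them are 0.\<close>
    moreover have "multiplier lborel ?H (z t)"
    proof (rule multiplier_lim[OF S multiplier_mult[OF multiplier_diff[OF S inv[OF t] multiplier_const[OF S, of 1]]
          multiplier_resolvent[OF S inv]], where B = "\<bar>t\<bar>"])
      fix \<gamma> :: real
      show "(\<lambda>n. (\<psi> t \<gamma> - 1) * (1 / (of_real (?\<delta> n) + \<i> * of_real \<gamma>))) \<longlonglongrightarrow> z t \<gamma>"
      proof (cases "\<gamma> = 0")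
        case False
        have "(\<lambda>n. (\<psi> t \<gamma> - 1) * (1 / (of_real (?\<delta> n) + \<i> * of_real \<gamma>))) \<longlonglongrightarrow> (\<psi> t \<gamma> - 1) * (1 / (of_real 0 + \<i> * of_real \<gamma>))"
          by (intro tendsto_intros LIMSEQ_inverse_Suc) (use False in simp)
        then show ?thesis by (simp add: z_def)
      qed simp
      fix n
      have "\<bar>\<gamma>\<bar> \<le> cmod (of_real (?\<delta> n) + \<i> * of_real \<gamma>)"
        using abs_Im_le_cmod[of "of_real (?\<delta> n) + \<i> * of_real \<gamma>"] by simp
      then have "cmod (\<psi> t \<gamma> - 1) * (1 / cmod (of_real (?\<delta> n) + \<i> * of_real \<gamma>)) \<le> cmod (\<psi> t \<gamma> - 1) * (1 / \<bar>\<gamma>\<bar>)" if "\<gamma> \<noteq> 0"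
        using that by (intro mult_left_mono divide_left_mono) (auto intro!: mult_pos_pos elim: less_le_trans[rotated])
      then have "cmod ((\<psi> t \<gamma> - 1) * (1 / (of_real (?\<delta> n) + \<i> * of_real \<gamma>))) \<le> cmod (z t \<gamma>)"
        by (cases "\<gamma> = 0") (simp_all add: z_def norm_mult norm_divide)
      then show "cmod ((\<psi> t \<gamma> - 1) * (1 / (of_real (?\<delta> n) + \<i> * of_real \<gamma>))) \<le> \<bar>t\<bar>"
        using cmod_z_le by (rule order_trans)
    qed auto
    \<comment> \<open>This is z t (\<gamma> - \<i>) with the unbounded factor removed, since
      \<gamma> z t = - \<i> (exp (\<i> \<gamma> t) - 1).\<close>
    then have "multiplier lborel ?H (\<lambda>\<gamma>. - \<i> * (\<psi> t \<gamma> - 1 + z t \<gamma>))"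
      by (intro multiplier_mult multiplier_add multiplier_diff multiplier_const S inv t)
    ultimately have "(\<lambda>\<gamma>. - \<i> * (\<psi> t \<gamma> - 1 + z t \<gamma>) * (1 * cnj (h \<gamma>))) \<in> ?H"
      by (rule multiplierD[rotated])
    moreover have "- \<i> * (\<psi> t \<gamma> - 1 + z t \<gamma>) = z t \<gamma> * (of_real \<gamma> - \<i>)" for \<gamma>
      by (cases "\<gamma> = 0") (simp_all add: z_def field_simps)
    ultimately show "Z t \<in> ?H"
      by (simp only: weighted_z_def[abs_def] mult_1_left)
  qed
  show "hardy_lower \<subseteq> ?E"
    unfolding outer
  proof (rule L2_closed_span_minimal[OF ZS], clarify)
    fix t :: real assume t: "t < 0"
    have gen: "Z r \<in> ?E" if "r \<le> 0" for r
      by (rule L2_closed_span_superset[OF ZS]) (use that in auto)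
    have inv: "multiplier lborel ?E (\<psi> r)" if r: "r \<le> 0" for r
    proof (rule multiplier_of_generators[OF ZS, where B = 1])
      fix s assume "s \<in> Z ` {..0}"
      then obtain r' where s: "s = Z r'" "r' \<le> 0" by auto
      have "(\<lambda>\<gamma>. \<psi> r \<gamma> * s \<gamma>) = (\<lambda>\<gamma>. Z (r + r') \<gamma> - Z r \<gamma>)"
        by (simp only: s weighted_z_def mult.assoc[symmetric] z_add left_diff_distrib)
      then show "(\<lambda>\<gamma>. \<psi> r \<gamma> * s \<gamma>) \<in> ?E"
        using r s by (simp add: L2_closed_span_diff[OF ZS gen gen])
    qed simp_all
    have "(\<lambda>\<gamma>. 1 * (\<psi> t \<gamma> * cnj (h \<gamma>))) \<in> ?E"
    \<comment> \<open>For \<gamma> \<noteq> 0 the factor m n is the mean of exp (\<i> \<gamma> s)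
      over s between -1/(n+1) and 0, so it is bounded by 1 and tends to 1.\<close>
    proof (rule L2_closed_span_bounded_lim[OF ZS exp_h_L2, where m = "\<lambda>n \<gamma>. - z (- ?\<delta> n) \<gamma> / of_real (?\<delta> n)" and B = 1])
      show "AE \<gamma> in lborel. (\<lambda>n. - z (- ?\<delta> n) \<gamma> / of_real (?\<delta> n)) \<longlonglongrightarrow> 1"
        using AE_lborel_singleton[of 0]
      proof eventually_elim
        case (elim \<gamma>)
        have "(\<lambda>n. (1 - exp (- (\<i> * of_real \<gamma> * of_real (?\<delta> n)))) / of_real (?\<delta> n) / (\<i> * of_real \<gamma>)) \<longlonglongrightarrow> \<i> * of_real \<gamma> / (\<i> * of_real \<gamma>)"
          by (intro tendsto_divide tendsto_const exp_difference_quotient_LIMSEQ) (use elim in simp)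
        moreover have "(1 - exp (- (\<i> * of_real \<gamma> * of_real d))) / of_real d / (\<i> * of_real \<gamma>) = - z (- d) \<gamma> / of_real d" for d
          by (simp add: z_def minus_divide_left)
        moreover have "\<i> * of_real \<gamma> / (\<i> * complex_of_real \<gamma>) = 1" using elim by simp
        ultimately show ?case by (simp only:)
      qed
      fix n
      have "cmod (- z (- d) \<gamma> / of_real d) \<le> 1" if "d > 0" for d \<gamma>
        using cmod_z_le[of "- d" \<gamma>] that by (simp add: norm_divide)
      then show "cmod (- z (- ?\<delta> n) \<gamma> / of_real (?\<delta> n)) \<le> 1" for \<gamma> by (auto simp del: norm_divide of_real_divide)
      \<comment> \<open>As \<gamma> - \<i> = - \<i> (1 + \<i> \<gamma>), \<i> times the resolvent at
        \<epsilon> = 1 cancels the weight in Z, and the increment of Z ending at t leaves the wanted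
        factor times exp (\<i> \<gamma> t) cnj h.\<close>
      have "multiplier lborel ?E (\<lambda>\<gamma>. \<i> / of_real (?\<delta> n) * (1 / (of_real 1 + \<i> * of_real \<gamma>)))"
        by (intro multiplier_mult multiplier_const ZS multiplier_resolvent inv) auto
      moreover have "(\<lambda>\<gamma>. Z t \<gamma> - Z (t + - ?\<delta> n) \<gamma>) \<in> ?E"
        using t by (intro L2_closed_span_diff[OF ZS] gen add_nonpos_nonpos) auto
      ultimately have "(\<lambda>\<gamma>. \<i> / of_real (?\<delta> n) * (1 / (of_real 1 + \<i> * of_real \<gamma>)) * (Z t \<gamma> - Z (t + - ?\<delta> n) \<gamma>)) \<in> ?E"
        by (rule multiplierD)
      moreover have "\<i> / d * (1 / (of_real 1 + \<i> * of_real \<gamma>)) * (Z t \<gamma> - Z (t + r) \<gamma>) = - z r \<gamma> / d * (\<psi> t \<gamma> * cnj (h \<gamma>))" for d r \<gamma>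
      proof -
        have ne: "1 + \<i> * complex_of_real \<gamma> \<noteq> 0" by (simp add: complex_eq_iff)
        have "Z t \<gamma> - Z (t + r) \<gamma> = - (\<psi> t \<gamma> * z r \<gamma>) * (- \<i> * (1 + \<i> * of_real \<gamma>)) * cnj (h \<gamma>)"
          unfolding z_add weighted_z_def by (simp add: algebra_simps)
        then show ?thesis using ne by (simp only: of_real_1) (simp add: mult_ac)
      qed
      ultimately show "(\<lambda>\<gamma>. - z (- ?\<delta> n) \<gamma> / of_real (?\<delta> n) * (\<psi> t \<gamma> * cnj (h \<gamma>))) \<in> ?E"
        by (simp only:)
    qed auto
    then show "(\<lambda>\<gamma>. \<psi> t \<gamma> * cnj (h \<gamma>)) \<in> ?E" by simp
  qed
qed

end

section \<open>Conditional expectation of Gaussian variables\<close>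

lemma process_sigma_space [simp]: "space (process_sigma P X T) = space P"
  by (simp add: process_sigma_def space_measure_of_conv)

lemma process_sigma_sets:
  "sets (process_sigma P X T) = sigma_sets (space P) {X t -` B \<inter> space P |t B. t \<in> T \<and> B \<in> sets borel}"
  unfolding process_sigma_def by (rule sets_measure_of) auto

lemma process_sigma_measurable: "t \<in> T \<Longrightarrow> X t \<in> borel_measurable (process_sigma P X T)"
  by (rule measurableI) (auto simp: process_sigma_sets intro!: sigma_sets.Basic)

lemma process_sigma_subalgebra:
  assumes "\<And>t. X t \<in> borel_measurable P"
  shows "subalgebra P (process_sigma P X T)"
  unfolding subalgebra_def process_sigma_sets
  using assms by (auto intro!: sets.sigma_sets_subset)

lemma (in prob_space) integrable_of_square:
  fixes D :: "'a \<Rightarrow> 'b :: {banach, second_countable_topology}"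
  assumes [measurable]: "D \<in> borel_measurable M" and D2: "integrable M (\<lambda>x. (norm (D x))\<^sup>2)"
  shows "integrable M D"
proof (rule Bochner_Integration.integrable_bound)
  show "integrable M (\<lambda>x. 1 + (norm (D x))\<^sup>2)" using D2 by simp
  show "AE x in M. norm (D x) \<le> norm (1 + (norm (D x))\<^sup>2)"
  proof (intro AE_I2)
    fix x
    have "2 * 1 * norm (D x) \<le> 1\<^sup>2 + (norm (D x))\<^sup>2" by (rule sum_squares_bound)
    then have "norm (D x) \<le> 1 + (norm (D x))\<^sup>2" using norm_ge_zero[of "D x"] unfolding one_power2 by linarith
    then show "norm (D x) \<le> norm (1 + (norm (D x))\<^sup>2)" by simp
  qed
qed simp

text \<open>Multiplication by \<open>exp (\<i> b X\<^sub>t)\<close> preserves the closed span of these exponentials, hence so does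
  multiplication by \<open>sin ((X\<^sub>t - c) / m)\<close>, whose sign is that of \<open>X\<^sub>t - c\<close> for large \<open>m\<close>, and by the
  indicator of any event of the \<open>\<sigma>\<close>-field.\<close>

lemma complex_cond_exp_eq_zero:
  assumes P: "prob_space P" and X [measurable]: "\<And>t. X t \<in> borel_measurable P" and W: "W \<in> L2 P"
    and orth: "\<And>K a. finite K \<Longrightarrow> K \<subseteq> T \<Longrightarrow> L2_inner P W (\<lambda>x. iexp (\<Sum>t\<in>K. a t * X t x)) = 0"
  shows "AE x in P. complex_cond_exp P (process_sigma P X T) W x = 0"
proof -
  interpret prob_space P by fact
  let ?F = "process_sigma P X T"
  have sub: "subalgebra P ?F" using X by (rule process_sigma_subalgebra)
  interpret finite_measure_subalgebra P ?F
    by (intro finite_measure_subalgebra.intro finite_measure_subalgebra_axioms.intro sub finite_measure_axioms)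
  define S where "S = {\<lambda>x. iexp (\<Sum>t\<in>K. a t * X t x) |K a. finite K \<and> K \<subseteq> T}"
  let ?E = "L2_closed_span P S"
  have S: "S \<subseteq> L2 P" by (auto simp: S_def L2_def)
  have shift: "(\<lambda>x. iexp (b * X j x) * s x) \<in> S" if s: "s \<in> S" and j: "j \<in> T" for s b j
  proof -
    obtain K a where K: "s = (\<lambda>x. iexp (\<Sum>t\<in>K. a t * X t x))" "finite K" "K \<subseteq> T" using s unfolding S_def by blast
    let ?a = "\<lambda>t. (if t \<in> K then a t else 0) + (if t \<in> {j} then b else 0)"
    have "iexp (b * X j x) * s x = iexp (\<Sum>t\<in>K \<union> {j}. ?a t * X t x)" for x
      unfolding sum_Un_coefficients[OF K(2) finite.insertI[OF finite.emptyI]] by (simp add: K(1) distrib_left exp_add mult.commute)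
    then show ?thesis
      unfolding S_def using K(2,3) j by (intro CollectI exI[of _ "K \<union> {j}"] exI[of _ ?a]) auto
  qed
  have iexp: "multiplier P ?E (\<lambda>x. iexp (b * X t x))" if "t \<in> T" for b t
  proof (rule multiplier_of_generators[OF S, where B = 1])
    show "(\<lambda>x. iexp (b * X t x) * s x) \<in> ?E" if "s \<in> S" for s
      by (intro L2_closed_span_superset[OF S] shift that \<open>t \<in> T\<close>)
  qed simp_all
  have sin: "multiplier P ?E (\<lambda>x. of_real (sin ((X t x - c) / m)))" if "t \<in> T" for t c m
  proof (rule multiplier_cong[OF S])
    \<comment> \<open>Euler's formula, with the constant phase c / m split off so that only
      exponentials of multiples of X t remain.\<close>
    show "multiplier P ?E (\<lambda>x. (- \<i> / 2) * (iexp (- c / m) * iexp (1 / m * X t x)) - (- \<i> / 2) * (iexp (c / m) * iexp (- 1 / m * X t x)))"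
      by (intro multiplier_diff multiplier_mult multiplier_const S iexp that)
    fix x
    have "iexp (- c / m) * iexp (1 / m * X t x) = iexp ((X t x - c) / m)"
      "iexp (c / m) * iexp (- 1 / m * X t x) = iexp (- ((X t x - c) / m))"
      by (simp_all add: algebra_simps diff_divide_distrib flip: exp_add)
    then show "(- \<i> / 2) * (iexp (- c / m) * iexp (1 / m * X t x)) - (- \<i> / 2) * (iexp (c / m) * iexp (- 1 / m * X t x)) = of_real (sin ((X t x - c) / m))"
      by (simp only: cis_conv_exp[symmetric]) (simp add: complex_eq_iff)
  qed
  have half: "multiplier P ?E (indicator (X t -` {..c} \<inter> space P))" if t: "t \<in> T" for t c
  proof (rule multiplier_lim[OF S multiplier_indicator_nonpos[OF S sin[OF t]], where B = 1])
    fix x assume x: "x \<in> space P"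
    have "(\<lambda>n. (X t x - c) * (1 / real (Suc n))) \<longlonglongrightarrow> (X t x - c) * 0"
      by (intro tendsto_mult tendsto_const LIMSEQ_inverse_Suc)
    then have "\<forall>\<^sub>F n in sequentially. (X t x - c) / Suc n \<in> {- pi<..<pi}"
      by (intro topological_tendstoD) auto
    then have "\<forall>\<^sub>F n in sequentially. indicator {x. sin ((X t x - c) / Suc n) \<le> 0} x = (indicator (X t -` {..c} \<inter> space P) x :: complex)"
    proof eventually_elim
      case (elim n)
      have "sin ((X t x - c) / Suc n) \<le> 0 \<longleftrightarrow> (X t x - c) / Suc n \<le> 0"
        using elim sin_gt_zero[of "(X t x - c) / Suc n"] sin_ge_zero[of "- ((X t x - c) / Suc n)"] by fastforce
      then show ?case using x by (simp add: indicator_def divide_le_0_iff)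
    qed
    then show "(\<lambda>n. indicator {x. sin ((X t x - c) / Suc n) \<le> 0} x) \<longlonglongrightarrow> (indicator (X t -` {..c} \<inter> space P) x :: complex)"
      by (rule tendsto_eventually)
  qed (simp add: indicator_def)
  have int: "integrable P W"
    by (rule integrable_of_square) (use L2_measurable[OF W] L2_integrable[OF W] in auto)
  have zero: "(\<integral>x. indicator A x *\<^sub>R W x \<partial>P) = 0" if "A \<in> sets ?F" for A
  proof -
    have "multiplier P ?E (indicator A)"
      using that unfolding process_sigma_sets
      by (rule multiplier_sigma_sets[OF S]) (auto intro: multiplier_vimage[OF S half])
    \<comment> \<open>The exponential of the empty sum. Multiplied by the indicator it puts the
      indicator itself into the span, to which W is orthogonal.\<close>
    moreover have "(\<lambda>x. 1) \<in> ?E"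
      by (rule L2_closed_span_superset[OF S]) (auto simp: S_def intro!: exI[of _ "{}"])
    ultimately have "(\<lambda>x. indicator A x * 1) \<in> ?E" by (rule multiplierD)
    from L2_closed_span_inner_zero[OF W S _ this]
    have "L2_inner P W (\<lambda>x. indicator A x * 1) = 0" using orth by (auto simp: S_def)
    moreover have "W x * cnj (indicator A x * 1) = indicator A x *\<^sub>R W x" for x by (simp add: indicator_def)
    ultimately show ?thesis by (simp only: L2_inner_def)
  qed
  have i: "integrable P (\<lambda>x. indicator A x *\<^sub>R W x)" if "A \<in> sets ?F" for A
    using that sub by (intro integrable_mult_indicator[OF _ int]) (auto simp: subalgebra_def)
  \<comment> \<open>A general real-linear l treats real and imaginary parts at once.\<close>
  have "AE x in P. real_cond_exp P ?F (\<lambda>x. l (W x)) x = 0" if l: "bounded_linear l" for l :: "complex \<Rightarrow> real"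
  proof (rule real_cond_exp_charact)
    interpret l: bounded_linear l by fact
    show "(LINT x:A|P. l (W x)) = (LINT x:A|P. 0)" if "A \<in> sets ?F" for A
      using integral_bounded_linear[OF l i[OF that]] zero[OF that] by (simp add: set_lebesgue_integral_def l.scaleR l.zero)
    show "integrable P (\<lambda>x. l (W x))" by (rule integrable_bounded_linear[OF l int])
  qed auto
  from this[OF bounded_linear_Re] this[OF bounded_linear_Im] show ?thesis
    unfolding complex_cond_exp_def by eventually_elim (simp add: complex_eq_iff)
qed

text \<open>An almost surely constant variable has no normal density; mean 0 makes the constant 0,
  and both claims are trivial. Otherwise the variable is rescaled to the standard normal
  law.\<close>

lemma gaussian_char:
  assumes P: "prob_space P" and V: "gaussian_rv P V" and mean: "prob_space.expectation P V = 0"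
  shows "integrable P (\<lambda>\<omega>. (V \<omega>)\<^sup>2)"
    and "(\<integral>\<omega>. iexp (V \<omega>) \<partial>P) = of_real (exp (- (\<integral>\<omega>. (V \<omega>)\<^sup>2 \<partial>P) / 2))"
proof -
  interpret prob_space P by fact
  have [measurable]: "V \<in> borel_measurable P" using V by (simp add: gaussian_rv_def)
  have "integrable P (\<lambda>\<omega>. (V \<omega>)\<^sup>2) \<and> (\<integral>\<omega>. iexp (V \<omega>) \<partial>P) = of_real (exp (- (\<integral>\<omega>. (V \<omega>)\<^sup>2 \<partial>P) / 2))"
    using V unfolding gaussian_rv_def
  proof (elim conjE disjE exE)
    fix \<mu> assume ae: "AE \<omega> in P. V \<omega> = \<mu>"
    have "expectation V = (\<integral>\<omega>. \<mu> \<partial>P)" by (rule integral_cong_AE) (use ae in auto)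
    then have "\<mu> = 0" using mean by (simp add: prob_space)
    with ae have ae0: "AE \<omega> in P. V \<omega> = 0" by simp
    have "integrable P (\<lambda>\<omega>. (V \<omega>)\<^sup>2) \<longleftrightarrow> integrable P (\<lambda>\<omega>. 0 :: real)"
      by (rule integrable_cong_AE) (use ae0 in auto)
    moreover have "(\<integral>\<omega>. (V \<omega>)\<^sup>2 \<partial>P) = (\<integral>\<omega>. 0 \<partial>P)"
      by (rule integral_cong_AE) (use ae0 in auto)
    moreover have "(\<integral>\<omega>. iexp (V \<omega>) \<partial>P) = (\<integral>\<omega>. 1 \<partial>P)"
      by (rule integral_cong_AE) (use ae0 in auto)
    ultimately show ?thesis by (simp add: prob_space)
  next
    fix \<mu> \<sigma> :: real assume \<sigma>: "0 < \<sigma>" and D: "distributed P lborel V (\<lambda>x. ennreal (normal_density \<mu> \<sigma> x))"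
    have "\<mu> = 0" using normal_distributed_expectation[OF \<sigma> D] mean by simp
    with D have D: "distributed P lborel V (\<lambda>x. ennreal (normal_density 0 \<sigma> x))" by simp
    have var: "(\<integral>\<omega>. (V \<omega>)\<^sup>2 \<partial>P) = \<sigma>\<^sup>2"
      using normal_distributed_variance[OF \<sigma> D] mean by simp
    have "integrable lborel (\<lambda>x. normal_density 0 \<sigma> x * x\<^sup>2)"
      using normal_moment_even[OF \<sigma>, of 0 1] by (auto simp: has_bochner_integral_iff)
    then have sq: "integrable P (\<lambda>\<omega>. (V \<omega>)\<^sup>2)"
      using distributed_integrable[OF D, of "\<lambda>x. x\<^sup>2"] by (simp add: normal_density_nonneg)
    have D1: "distributed P lborel (\<lambda>\<omega>. V \<omega> / \<sigma>) (\<lambda>x. ennreal (std_normal_density x))"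
      using D normal_standard_normal_convert[OF \<sigma>, of V 0] by simp
    have "(\<integral>\<omega>. iexp (V \<omega>) \<partial>P) = (\<integral>\<omega>. iexp (\<sigma> * (V \<omega> / \<sigma>)) \<partial>P)" using \<sigma> by simp
    also have "\<dots> = (\<integral>x. iexp (\<sigma> * x) \<partial>distr P lborel (\<lambda>\<omega>. V \<omega> / \<sigma>))"
      by (rule integral_distr[symmetric]) auto
    also have "distr P lborel (\<lambda>\<omega>. V \<omega> / \<sigma>) = std_normal_distribution"
      by (rule distributed_distr_eq_density[OF D1])
    also have "(\<integral>x. iexp (\<sigma> * x) \<partial>std_normal_distribution) = char std_normal_distribution \<sigma>"
      by (simp add: char_def)
    finally show ?thesis using sq var by (simp add: char_std_normal_distribution)
  qed
  then show "integrable P (\<lambda>\<omega>. (V \<omega>)\<^sup>2)" "(\<integral>\<omega>. iexp (V \<omega>) \<partial>P) = of_real (exp (- (\<integral>\<omega>. (V \<omega>)\<^sup>2 \<partial>P) / 2))" by auto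
qed

text \<open>Gaussian integration by parts, from differentiating E exp (\<i> (s Y + Z)) at s = 0 in
  two ways: under the expectation the derivative is \<i> E[Y exp (\<i> Z)], while the explicit
  characteristic function gives - E[Y Z] exp (- E[Z^2] / 2).\<close>

lemma gaussian_expectation_iexp:
  assumes P: "prob_space P"
    and Y [measurable]: "Y \<in> borel_measurable P" and Y2: "integrable P (\<lambda>x. (Y x)\<^sup>2)"
    and Z [measurable]: "Z \<in> borel_measurable P" and Z2: "integrable P (\<lambda>x. (Z x)\<^sup>2)"
    and gauss: "\<And>s. gaussian_rv P (\<lambda>x. s * Y x + Z x)"
    and mean: "\<And>s. prob_space.expectation P (\<lambda>x. s * Y x + Z x) = 0"
  shows "(\<integral>x. of_real (Y x) * iexp (Z x) \<partial>P) = \<i> * of_real (exp (- (\<integral>x. (Z x)\<^sup>2 \<partial>P) / 2) * (\<integral>x. Y x * Z x \<partial>P))"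
proof -
  interpret prob_space P by fact
  define vY vZ c where "vY = (\<integral>x. (Y x)\<^sup>2 \<partial>P)" and "vZ = (\<integral>x. (Z x)\<^sup>2 \<partial>P)" and "c = (\<integral>x. Y x * Z x \<partial>P)"
  define A where "A = (\<integral>x. of_real (Y x) * iexp (Z x) \<partial>P)"
  let ?s = "\<lambda>n. 1 / real (Suc n)"
  let ?\<phi> = "\<lambda>s. exp (- (s\<^sup>2 * vY + 2 * s * c + vZ) / 2)"
  have Yi: "integrable P Y" by (rule integrable_of_square) (use Y2 in auto)
  have YZ: "integrable P (\<lambda>x. Y x * Z x)"
  proof -
    have "(\<lambda>x. complex_of_real (Y x)) \<in> L2 P" "(\<lambda>x. complex_of_real (Z x)) \<in> L2 P"
      using Y2 Z2 by (simp_all add: L2_def)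
    from integrable_Re[OF L2_inner_integrable[OF this]] show ?thesis by simp
  qed
  have char: "(\<integral>x. iexp (s * Y x + Z x) \<partial>P) = of_real (?\<phi> s)" for s
  proof -
    have "(\<integral>x. (s * Y x + Z x)\<^sup>2 \<partial>P) = (\<integral>x. s\<^sup>2 * (Y x)\<^sup>2 + 2 * s * (Y x * Z x) + (Z x)\<^sup>2 \<partial>P)"
      by (simp add: power2_eq_square algebra_simps)
    also have "\<dots> = s\<^sup>2 * vY + 2 * s * c + vZ"
      using Y2 Z2 YZ by (simp add: vY_def vZ_def c_def)
    finally show ?thesis using gaussian_char(2)[OF P gauss mean, of s] by simp
  qed
  \<comment> \<open>The Taylor remainder of the exponential in s Y is at most (s Y)^2 / 2, which
    controls the interchange of derivative and expectation.\<close>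
  have bound: "cmod ((of_real (?\<phi> s) - of_real (?\<phi> 0)) / of_real s - \<i> * A) \<le> s * vY / 2" if s: "s > 0" for s
  proof -
    let ?d = "\<lambda>x. iexp (s * Y x + Z x) - iexp (Z x) - \<i> * of_real s * (of_real (Y x) * iexp (Z x))"
    have i1: "integrable P (\<lambda>x. iexp (s * Y x + Z x))" "integrable P (\<lambda>x. iexp (Z x))"
      by (rule integrable_const_bound[of _ 1]; auto)+
    have i2: "integrable P (\<lambda>x. \<i> * of_real s * (of_real (Y x) * iexp (Z x)))"
      by (rule Bochner_Integration.integrable_bound[of _ "\<lambda>x. s * Y x"]) (use Yi s in \<open>auto simp: norm_mult\<close>)
    have "cmod (\<integral>x. ?d x \<partial>P) \<le> (\<integral>x. s\<^sup>2 / 2 * (Y x)\<^sup>2 \<partial>P)"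
    proof (rule order_trans[OF integral_norm_bound integral_mono])
      show "integrable P (\<lambda>x. cmod (?d x))"
        by (intro integrable_norm Bochner_Integration.integrable_diff i1 i2)
      show "integrable P (\<lambda>x. s\<^sup>2 / 2 * (Y x)\<^sup>2)" using Y2 by simp
      fix x
      have "?d x = (iexp (s * Y x) - (1 + \<i> * of_real (s * Y x))) * iexp (Z x)"
        by (simp add: algebra_simps flip: exp_add)
      also have "cmod \<dots> = cmod (iexp (s * Y x) - (1 + \<i> * of_real (s * Y x)))" by (simp add: norm_mult)
      also have "\<dots> \<le> (s * Y x)\<^sup>2 / 2"
        using iexp_approx1[of "s * Y x" 1] by (simp add: numeral_2_eq_2)
      finally show "cmod (?d x) \<le> s\<^sup>2 / 2 * (Y x)\<^sup>2" by (simp add: power_mult_distrib)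
    qed
    moreover have "(\<integral>x. ?d x \<partial>P) = of_real (?\<phi> s) - of_real (?\<phi> 0) - \<i> * of_real s * A"
      using i1 i2 char[of s] char[of 0] unfolding A_def by (simp add: Bochner_Integration.integral_diff)
    moreover have "a - \<i> * of_real s * A = of_real s * (a / of_real s - \<i> * A)" for a
      using s by (simp add: right_diff_distrib)
    ultimately have "s * cmod ((of_real (?\<phi> s) - of_real (?\<phi> 0)) / of_real s - \<i> * A) \<le> s * (s * vY / 2)"
      using s by (simp only: norm_mult norm_of_real) (simp add: vY_def power2_eq_square)
    then show ?thesis using s by simp
  qed
  have "(\<lambda>n. (complex_of_real (?\<phi> (?s n)) - of_real (?\<phi> 0)) / of_real (?s n)) \<longlonglongrightarrow> \<i> * A"
  proof (rule LIM_zero_cancel, rule Lim_null_comparison)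
    show "\<forall>\<^sub>F n in sequentially. norm ((complex_of_real (?\<phi> (?s n)) - of_real (?\<phi> 0)) / of_real (?s n) - \<i> * A) \<le> ?s n * vY / 2"
      by (intro always_eventually allI bound) simp
    show "(\<lambda>n. ?s n * vY / 2) \<longlonglongrightarrow> 0"
      using tendsto_mult_right[OF LIMSEQ_inverse_Suc, of "vY / 2"] by simp
  qed
  moreover have "(\<lambda>n. complex_of_real ((?\<phi> (?s n) - ?\<phi> 0) / ?s n)) \<longlonglongrightarrow> of_real (- c * exp (- vZ / 2))"
  proof (rule tendsto_of_real)
    have "(?\<phi> has_field_derivative - c * exp (- vZ / 2)) (at 0)"
      by (auto intro!: derivative_eq_intros)
    from DERIV_LIMSEQ[OF this] show "(\<lambda>n. (?\<phi> (?s n) - ?\<phi> 0) / ?s n) \<longlonglongrightarrow> - c * exp (- vZ / 2)" by simp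
  qed
  ultimately have "\<i> * A = of_real (- c * exp (- vZ / 2))"
    by (intro LIMSEQ_unique) (simp_all only: of_real_diff of_real_divide)
  then have "\<i> * (\<i> * A) = \<i> * of_real (- c * exp (- vZ / 2))" by (simp only:)
  then show ?thesis by (simp add: A_def c_def vZ_def mult.commute)
qed

lemma gaussian_process_square_integrable:
  assumes P: "prob_space P" and X: "gaussian_process P X" "\<And>t. prob_space.expectation P (X t) = 0"
  shows "integrable P (\<lambda>\<omega>. (X t \<omega>)\<^sup>2)"
proof (rule gaussian_char(1)[OF P _ X(2)])
  have "gaussian_rv P (\<lambda>\<omega>. \<Sum>t\<in>J. a t * X t \<omega>)" if "finite J" for J a
    using X(1) that by (simp add: gaussian_process_def)
  from this[of "{t}" "\<lambda>_. 1"] show "gaussian_rv P (X t)" by simp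
qed

lemma gaussian_process_combination:
  assumes P: "prob_space P" and X: "gaussian_process P X" "\<And>t. prob_space.expectation P (X t) = 0"
    and J: "finite J"
  shows "gaussian_rv P (\<lambda>\<omega>. \<Sum>t\<in>J. a t * X t \<omega>)"
    and "(\<integral>\<omega>. (\<Sum>t\<in>J. a t * X t \<omega>) \<partial>P) = 0"
    and "integrable P (\<lambda>\<omega>. (\<Sum>t\<in>J. a t * X t \<omega>)\<^sup>2)"
proof -
  interpret prob_space P by fact
  have [measurable]: "X t \<in> borel_measurable P" for t using X(1) by (simp add: gaussian_process_def)
  show g: "gaussian_rv P (\<lambda>\<omega>. \<Sum>t\<in>J. a t * X t \<omega>)"
    using X(1) J by (simp add: gaussian_process_def)
  have "integrable P (X t)" for t
    using integrable_of_square[of "X t"] gaussian_process_square_integrable[OF P X] by simp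
  then show m: "(\<integral>\<omega>. (\<Sum>t\<in>J. a t * X t \<omega>) \<partial>P) = 0"
    using X(2) by (simp add: Bochner_Integration.integral_sum)
  show "integrable P (\<lambda>\<omega>. (\<Sum>t\<in>J. a t * X t \<omega>)\<^sup>2)"
    by (rule gaussian_char(1)[OF P g m])
qed

text \<open>For \<open>Z\<close> in the span of the \<open>X\<^sub>t\<close>, some multiple of \<open>Z\<close> has the same inner products with all
  \<open>X\<^sub>s\<close> as \<open>exp (\<i> Z)\<close>, hence with all elements of the closed span.\<close>

lemma process_span_orthogonal_complex_cond_exp:
  assumes P: "prob_space P" and X: "gaussian_process P X" "\<And>t. prob_space.expectation P (X t) = 0"
    and W: "W \<in> process_span P X UNIV"
    and orth: "\<And>t. t \<in> T \<Longrightarrow> L2_inner P W (\<lambda>x. of_real (X t x)) = 0"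
  shows "AE x in P. complex_cond_exp P (process_sigma P X T) W x = 0"
proof -
  interpret prob_space P by fact
  have Xm [measurable]: "X t \<in> borel_measurable P" for t using X(1) by (simp add: gaussian_process_def)
  have WL: "W \<in> L2 P" using W L2_closed_span_subset by (auto simp: process_span_def)
  note X2 = gaussian_process_square_integrable[OF P X] and comb = gaussian_process_combination[OF P X]
  have XL: "(\<lambda>x. complex_of_real (X t x)) \<in> L2 P" for t using X2 by (simp add: L2_def)
  show ?thesis
  proof (rule complex_cond_exp_eq_zero[OF P Xm WL])
    fix K b assume K: "finite K" "K \<subseteq> T"
    define Z where "Z x = (\<Sum>t\<in>K. b t * X t x)" for x
    have [measurable]: "Z \<in> borel_measurable P" unfolding Z_def[abs_def] by measurable
    have Z2: "integrable P (\<lambda>x. (Z x)\<^sup>2)" unfolding Z_def by (rule comb(3)[OF K(1)])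
    \<comment> \<open>c is the expectation of exp (\<i> Z), and \<i> c Z is the multiple of Z that
      has the same inner products with the process as exp (\<i> Z).\<close>
    define c where "c = exp (- (\<integral>x. (Z x)\<^sup>2 \<partial>P) / 2)"
    let ?e = "\<lambda>x. iexp (Z x)" and ?Z = "\<lambda>x. \<Sum>t\<in>K. \<i> * of_real (c * b t) * of_real (X t x)"
    have Z_eq: "?Z x = \<i> * of_real (c * Z x)" for x
      by (simp add: Z_def sum_distrib_left mult_ac)
    have eL: "?e \<in> L2 P" by (simp add: L2_def)
    have ZL: "?Z \<in> L2 P" by (rule L2_sum) (rule XL)
    have "L2_inner P (\<lambda>x. ?e x - ?Z x) (\<lambda>x. of_real (X s x)) = 0" for s
    proof -
      \<comment> \<open>Adjoining a multiple of X s leaves a combination of process values, again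
        Gaussian of mean 0, so integration by parts applies to X s and Z.\<close>
      have shift: "r * X s x + Z x = (\<Sum>t\<in>K \<union> {s}. ((if t \<in> K then b t else 0) + (if t \<in> {s} then r else 0)) * X t x)" for r x
        unfolding sum_Un_coefficients[OF K(1) finite.insertI[OF finite.emptyI]] by (simp add: Z_def)
      have "(\<integral>x. of_real (X s x) * ?e x \<partial>P) = \<i> * of_real (c * (\<integral>x. X s x * Z x \<partial>P))"
        unfolding c_def
        by (rule gaussian_expectation_iexp[OF P Xm X2 \<open>Z \<in> borel_measurable P\<close> Z2])
          (auto simp only: shift intro!: comb K(1) finite_UnI finite.insertI finite.emptyI)
      also have "\<dots> = (\<integral>x. ?Z x * cnj (of_real (X s x)) \<partial>P)"
      proof -
        have "?Z x * cnj (of_real (X s x)) = \<i> * of_real (c * (X s x * Z x))" for x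
          unfolding Z_eq by (simp add: mult_ac)
        then show ?thesis by (simp only: integral_mult_right_zero integral_complex_of_real)
      qed
      finally show ?thesis
        unfolding L2_inner_diff_left[OF eL ZL XL] by (simp add: L2_inner_def mult.commute)
    qed
    with L2_closed_span_inner_zero[OF L2_diff[OF eL ZL] _ _ W[unfolded process_span_def]] XL
    have "L2_inner P (\<lambda>x. ?e x - ?Z x) W = 0" by auto
    then have "L2_inner P W ?e = L2_inner P W ?Z"
      using L2_inner_diff_right[OF eL ZL WL] by (subst (asm) L2_inner_commute) simp
    also have "\<dots> = 0"
      by (subst L2_inner_sum_right) (use WL XL orth K(2) in \<open>auto intro!: sum.neutral\<close>)
    finally show "L2_inner P W (\<lambda>x. iexp (\<Sum>t\<in>K. b t * X t x)) = 0" by (simp only: Z_def)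
  qed
qed

text \<open>W is only almost everywhere equal to a variable measurable in the sub-\<sigma>-field.
  Completeness is therefore applied to the restricted measure; the limit G found there is measurable
  in the smaller field, agrees with W almost everywhere, and is its own conditional
  expectation.\<close>

lemma process_span_cond_exp_self:
  assumes P: "prob_space P" and X: "\<And>t. X t \<in> borel_measurable P" and X2: "\<And>t. integrable P (\<lambda>\<omega>. (X t \<omega>)\<^sup>2)"
    and W: "W \<in> process_span P X T"
  shows "AE \<omega> in P. complex_cond_exp P (process_sigma P X T) W \<omega> = W \<omega>"
proof -
  interpret prob_space P by fact
  let ?F = "process_sigma P X T"
  have sub: "subalgebra P ?F" using X by (rule process_sigma_subalgebra)
  interpret finite_measure_subalgebra P ?F
    by (intro finite_measure_subalgebra.intro finite_measure_subalgebra_axioms.intro sub finite_measure_axioms)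
  let ?N = "restr_to_subalg P ?F"
  have XL: "(\<lambda>\<omega>. complex_of_real (X t \<omega>)) \<in> L2 P" for t using X X2 by (simp add: L2_def)
  have WL: "W \<in> L2 P" using W L2_closed_span_subset by (auto simp: process_span_def)
  obtain J c where J: "\<And>n. J n \<subseteq> T"
    and lim': "(\<lambda>n. L2_dist_sq P W (\<lambda>\<omega>. \<Sum>t\<in>J n. c n t * of_real (X t \<omega>))) \<longlonglongrightarrow> 0"
    using W unfolding process_span_def by (elim L2_closed_span_sequence) blast
  define s where "s n \<omega> = (\<Sum>t\<in>J n. c n t * complex_of_real (X t \<omega>))" for n \<omega>
  have sL: "s n \<in> L2 P" for n unfolding s_def[abs_def] by (rule L2_sum) (rule XL)
  have sF: "s n \<in> borel_measurable ?F" for n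
    unfolding s_def[abs_def] using J[of n] process_sigma_measurable[of _ T X P]
    by (intro borel_measurable_sum borel_measurable_times borel_measurable_const borel_measurable_of_real) auto
  \<comment> \<open>Integrals of functions measurable in the smaller field agree under P and its
    restriction, so Cauchy sequences and limits move between the two.\<close>
  have dist_N: "L2_dist_sq ?N f g = L2_dist_sq P f g" if "f \<in> borel_measurable ?F" "g \<in> borel_measurable ?F" for f g
    unfolding L2_dist_sq_def using that by (intro nn_integral_subalgebra2[OF sub]) measurable
  have FN: "f \<in> borel_measurable ?N \<longleftrightarrow> f \<in> borel_measurable ?F" for f :: "_ \<Rightarrow> complex"
    using measurable_cong_sets[OF sets_restr_to_subalg[OF sub] refl] by blast
  have L2_N: "f \<in> L2 ?N \<longleftrightarrow> f \<in> L2 P" if "f \<in> borel_measurable ?F" for f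
    using that dist_N[OF that, of "\<lambda>_. 0"] measurable_from_subalg[OF sub that]
    by (simp add: L2_iff FN L2_dist_sq_def)
  have lim: "(\<lambda>n. L2_dist_sq P (s n) W) \<longlonglongrightarrow> 0"
    using lim' by (simp add: L2_dist_sq_commute[of P _ W] s_def[abs_def])
  have "\<exists>G\<in>L2 ?N. (\<lambda>n. L2_dist_sq ?N (s n) G) \<longlonglongrightarrow> 0"
  proof (rule L2_complete)
    show "s n \<in> L2 ?N" for n using sL sF L2_N by blast
    fix \<epsilon> :: ennreal assume \<epsilon>: "\<epsilon> > 0"
    then have "\<epsilon> / 4 > 0" by (simp add: ennreal_zero_less_divide)
    from order_tendstoD(2)[OF lim this]
    obtain K where K: "\<And>n. n \<ge> K \<Longrightarrow> L2_dist_sq P (s n) W < \<epsilon> / 4" by (auto simp: eventually_sequentially)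
    have "L2_dist_sq ?N (s m) (s n) < \<epsilon>" if "m \<ge> K" "n \<ge> K" for m n
    proof -
      have "L2_dist_sq ?N (s m) (s n) = L2_dist_sq P (s m) (s n)" by (rule dist_N[OF sF sF])
      also have "\<dots> \<le> 2 * L2_dist_sq P (s m) W + 2 * L2_dist_sq P W (s n)"
        using sL WL by (intro L2_dist_sq_triangle) (auto dest: L2_measurable)
      also have "\<dots> < \<epsilon>"
        by (rule ennreal_quarter_bound) (use K that \<epsilon> in \<open>auto simp: L2_dist_sq_commute[of P W]\<close>)
      finally show ?thesis .
    qed
    then show "\<exists>N. \<forall>m\<ge>N. \<forall>n\<ge>N. L2_dist_sq ?N (s m) (s n) < \<epsilon>" by blast
  qed
  then obtain G where G: "G \<in> L2 ?N" "(\<lambda>n. L2_dist_sq ?N (s n) G) \<longlonglongrightarrow> 0" by blast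
  have GF: "G \<in> borel_measurable ?F" using L2_measurable[OF G(1)] FN by blast
  have GL: "G \<in> L2 P" using G(1) L2_N[OF GF] by blast
  have "(\<lambda>n. L2_dist_sq P (s n) G) \<longlonglongrightarrow> 0" using G(2) by (simp only: dist_N[OF sF GF])
  then have ae: "AE \<omega> in P. W \<omega> = G \<omega>"
    by (rule L2_limit_unique[OF sL WL GL lim])
  have [measurable]: "W \<in> borel_measurable P" "G \<in> borel_measurable P"
    using WL GL by (auto dest: L2_measurable)
  have int: "integrable P G" by (rule integrable_of_square) (use L2_integrable[OF GL] in auto)
  have "AE \<omega> in P. real_cond_exp P ?F (\<lambda>\<omega>. Re (W \<omega>)) \<omega> = real_cond_exp P ?F (\<lambda>\<omega>. Re (G \<omega>)) \<omega>"
    "AE \<omega> in P. real_cond_exp P ?F (\<lambda>\<omega>. Im (W \<omega>)) \<omega> = real_cond_exp P ?F (\<lambda>\<omega>. Im (G \<omega>)) \<omega>"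
    using ae by (intro real_cond_exp_cong; auto)+
  moreover have "AE \<omega> in P. real_cond_exp P ?F (\<lambda>\<omega>. Re (G \<omega>)) \<omega> = Re (G \<omega>)"
    "AE \<omega> in P. real_cond_exp P ?F (\<lambda>\<omega>. Im (G \<omega>)) \<omega> = Im (G \<omega>)"
    using int GF by (intro real_cond_exp_F_meas; auto)+
  ultimately show ?thesis
    using ae unfolding complex_cond_exp_def by eventually_elim (simp add: complex_eq_iff)
qed

section \<open>The spectral isometry\<close>

lemma sets_spectral_measure [measurable_cong, simp]: "sets (spectral_measure D) = sets borel"
  by (simp add: spectral_measure_def)

lemma AE_spectral_measure:
  assumes "D \<in> borel_measurable borel" "AE \<gamma> in lborel. Q \<gamma>"
  shows "AE \<gamma> in spectral_measure D. Q \<gamma>"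
  unfolding spectral_measure_def using assms by (subst AE_density) auto

text \<open>\<open>neg_part_ln\<close> is infinite at 0, so a finite logarithmic integral excludes
  zeros on a set of positive measure. This later makes h nonzero almost everywhere, as division by
  cnj h requires.\<close>

lemma spectral_density_pos:
  assumes "spectral_density D"
  shows "AE \<gamma> in lborel. D \<gamma> > 0"
proof -
  have [measurable]: "D \<in> borel_measurable borel" using assms by (simp add: spectral_density_def)
  have "(\<lambda>\<gamma>. neg_part_ln (D \<gamma>) / ennreal (1 + \<gamma>\<^sup>2)) \<in> borel_measurable lborel"
    unfolding neg_part_ln_def by measurable
  moreover have "(\<integral>\<^sup>+\<gamma>. neg_part_ln (D \<gamma>) / ennreal (1 + \<gamma>\<^sup>2) \<partial>lborel) \<noteq> \<infinity>"
    using assms unfolding spectral_density_def by auto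
  ultimately have "AE \<gamma> in lborel. neg_part_ln (D \<gamma>) / ennreal (1 + \<gamma>\<^sup>2) \<noteq> \<infinity>"
    by (rule nn_integral_PInf_AE)
  then show ?thesis
    by eventually_elim (auto simp: neg_part_ln_def ennreal_top_divide not_le[symmetric])
qed

text \<open>Continuity of the inner product shows that the sequence in \<open>L_inner\<close>
  converges, so \<open>lim\<close> has its intended meaning.\<close>

lemma L_inner_eq_L2_inner:
  assumes "\<xi> \<in> L_space D" "\<eta> \<in> L_space D" "L_fourier D \<xi> F" "L_fourier D \<eta> G"
  shows "L_inner D \<xi> \<eta> = L2_inner (spectral_measure D) F G"
  unfolding L_inner_def pre_inner_def
  by (rule limI, rule L2_inner_tendsto) (use assms in \<open>auto simp: L_space_def pre_L_def L_fourier_def\<close>)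

lemma L_embed_signed_indicator:
  assumes D: "spectral_density D"
  shows "L_embed (signed_indicator t) \<in> L_space D"
    and "L_fourier D (L_embed (signed_indicator t)) (z t)"
proof -
  let ?\<Delta> = "spectral_measure D"
  have [measurable]: "D \<in> borel_measurable borel" and D0: "\<And>\<gamma>. D \<gamma> \<ge> 0"
    and Di: "integrable lborel (\<lambda>\<gamma>. D \<gamma> / (1 + \<gamma>\<^sup>2))"
    using D by (auto simp: spectral_density_def)
  have zL: "z t \<in> L2 ?\<Delta>"
  proof -
    have "integrable lborel (\<lambda>\<gamma>. D \<gamma> *\<^sub>R (cmod (z t \<gamma>))\<^sup>2)"
    proof (rule Bochner_Integration.integrable_bound)
      show "integrable lborel (\<lambda>\<gamma>. (t\<^sup>2 + 4) * (D \<gamma> / (1 + \<gamma>\<^sup>2)))" using Di by (rule integrable_mult_right)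
      show "AE \<gamma> in lborel. norm (D \<gamma> *\<^sub>R (cmod (z t \<gamma>))\<^sup>2) \<le> norm ((t\<^sup>2 + 4) * (D \<gamma> / (1 + \<gamma>\<^sup>2)))"
      proof (intro AE_I2)
        fix \<gamma> :: real
        have p: "1 + \<gamma>\<^sup>2 > 0" using zero_le_power2[of \<gamma>] by linarith
        have "(cmod (z t \<gamma>))\<^sup>2 \<le> (t\<^sup>2 + 4) / (1 + \<gamma>\<^sup>2)" using z_sq_le[of t \<gamma>] p by (simp add: pos_le_divide_eq)
        then have "D \<gamma> * (cmod (z t \<gamma>))\<^sup>2 \<le> D \<gamma> * ((t\<^sup>2 + 4) / (1 + \<gamma>\<^sup>2))" using D0 by (rule mult_left_mono)
        then show "norm (D \<gamma> *\<^sub>R (cmod (z t \<gamma>))\<^sup>2) \<le> norm ((t\<^sup>2 + 4) * (D \<gamma> / (1 + \<gamma>\<^sup>2)))"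
          using D0[of \<gamma>] p by (simp add: abs_mult mult.commute)
      qed
    qed simp
    then have "integrable ?\<Delta> (\<lambda>\<gamma>. (cmod (z t \<gamma>))\<^sup>2)"
      unfolding spectral_measure_def using D0 by (subst integrable_density) auto
    then show ?thesis by (simp add: L2_def)
  qed
  have fm: "fourier_L2 f \<in> borel_measurable ?\<Delta>" if "f \<in> L2 lborel" for f
    using L2_measurable[OF fourier_L2_limit(1)[OF that]] by simp
  have ae: "AE \<gamma> in ?\<Delta>. fourier_L2 (signed_indicator t) \<gamma> = z t \<gamma>"
    by (rule AE_spectral_measure[OF _ fourier_L2_signed_indicator]) simp
  have sL: "fourier_L2 (signed_indicator t) \<in> L2 ?\<Delta>"
    by (rule L2_cong_AE[OF zL fm[OF signed_indicator_L2]]) (use ae in auto)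
  \<comment> \<open>The Cauchy condition for a constant sequence concerns the transform of 0, and
    \<open>fourier_L2\<close> is determined only up to null sets.\<close>
  have "AE \<gamma> in lborel. fourier_L2 (\<lambda>t. 0) \<gamma> = 0"
    using fourier_L2_eq_fourier[of "\<lambda>t. 0"] by (simp add: fourier_def[of "\<lambda>t. 0"])
  then have "AE \<gamma> in ?\<Delta>. fourier_L2 (\<lambda>t. 0) \<gamma> = 0" by (rule AE_spectral_measure[rotated]) simp
  then have "pre_norm_sq D (\<lambda>t. 0) = (\<integral>\<^sup>+\<gamma>. 0 \<partial>?\<Delta>)"
    unfolding pre_norm_sq_def by (intro nn_integral_cong_AE) auto
  then show "L_embed (signed_indicator t) \<in> L_space D"
    using sL by (simp add: L_space_def L_embed_def pre_L_def signed_indicator_L2)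
  have "L2_dist_sq ?\<Delta> (fourier_L2 (signed_indicator t)) (z t) = L2_dist_sq ?\<Delta> (z t) (z t)"
    by (rule L2_dist_sq_cong_AE) (use ae in auto)
  then show "L_fourier D (L_embed (signed_indicator t)) (z t)"
    using zL by (simp add: L_fourier_def L_embed_def)
qed

text \<open>For m = (\<gamma> - \<i>) cnj h one has |m|^2 = (1 + \<gamma>^2) |h|^2 = D almost
  everywhere, so the density is absorbed into the two factors. Equality with F' and G' is only
  almost everywhere because h may vanish on a null set.\<close>

lemma spectral_inner_eq:
  assumes D: "spectral_density D" and h: "h \<in> borel_measurable borel"
    and Dh: "AE \<gamma> in lborel. D \<gamma> / (1 + \<gamma>\<^sup>2) = (cmod (h \<gamma>))\<^sup>2"
    and F [measurable]: "F \<in> borel_measurable borel" "F' \<in> borel_measurable borel" "AE \<gamma> in lborel. F \<gamma> * ((of_real \<gamma> - \<i>) * cnj (h \<gamma>)) = F' \<gamma>"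
    and G [measurable]: "G \<in> borel_measurable borel" "G' \<in> borel_measurable borel" "AE \<gamma> in lborel. G \<gamma> * ((of_real \<gamma> - \<i>) * cnj (h \<gamma>)) = G' \<gamma>"
  shows "L2_inner (spectral_measure D) F G = L2_inner lborel F' G'"
proof -
  have [measurable]: "D \<in> borel_measurable borel" and D0: "\<And>\<gamma>. D \<gamma> \<ge> 0"
    using D by (auto simp: spectral_density_def)
  have "L2_inner (spectral_measure D) F G = (\<integral>\<gamma>. D \<gamma> *\<^sub>R (F \<gamma> * cnj (G \<gamma>)) \<partial>lborel)"
    unfolding L2_inner_def spectral_measure_def using D0 by (intro integral_density) auto
  also have "\<dots> = (\<integral>\<gamma>. F' \<gamma> * cnj (G' \<gamma>) \<partial>lborel)"
  proof (rule integral_cong_AE)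
    show "AE \<gamma> in lborel. D \<gamma> *\<^sub>R (F \<gamma> * cnj (G \<gamma>)) = F' \<gamma> * cnj (G' \<gamma>)"
      using Dh F(3) G(3)
    proof eventually_elim
      case (elim \<gamma>)
      let ?m = "(of_real \<gamma> - \<i>) * cnj (h \<gamma>)"
      have p: "1 + \<gamma>\<^sup>2 > 0" using zero_le_power2[of \<gamma>] by linarith
      have "(cmod ?m)\<^sup>2 = (1 + \<gamma>\<^sup>2) * (cmod (h \<gamma>))\<^sup>2"
        by (simp add: norm_mult power_mult_distrib cmod_power2[of "of_real \<gamma> - \<i>"])
      also have "\<dots> = D \<gamma>" unfolding elim(1)[symmetric] using p by simp
      finally have "of_real (D \<gamma>) = ?m * cnj ?m" by (simp only: complex_norm_square[symmetric])
      moreover have "F' \<gamma> * cnj (G' \<gamma>) = (?m * cnj ?m) * (F \<gamma> * cnj (G \<gamma>))"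
        unfolding elim(2,3)[symmetric] by (simp add: mult_ac)
      ultimately show ?case by (simp add: scaleR_conv_of_real)
    qed
  qed auto
  finally show ?thesis by (simp add: L2_inner_def)
qed

section \<open>Transfer from the frequency domain to the process\<close>

theorem theorem4p2:
  fixes D :: "real \<Rightarrow> real" and h :: "real \<Rightarrow> complex"
    and P :: "'w measure" and X :: "real \<Rightarrow> 'w \<Rightarrow> real"
    and I :: "(nat \<Rightarrow> real \<Rightarrow> complex) \<Rightarrow> 'w \<Rightarrow> complex"
    and \<xi> :: "int \<Rightarrow> nat \<Rightarrow> real \<Rightarrow> complex"
  assumes "spectral_density D"
    and "outer_function h"
    and "AE \<gamma> in lborel. D \<gamma> / (1 + \<gamma>\<^sup>2) = (cmod (h \<gamma>))\<^sup>2"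
    and "AE \<gamma> in lborel. h (- \<gamma>) = - cnj (h \<gamma>)"
    and "prob_space P"
    and "gaussian_process P X"
    and "stationary_increments P X"
    and "\<And>t. prob_space.expectation P (X t) = 0"
    and "\<And>t s. of_real (prob_space.expectation P (\<lambda>\<omega>. X t \<omega> * X s \<omega>)) =
           (\<integral>\<gamma>. z t \<gamma> * cnj (z s \<gamma>) \<partial>spectral_measure D)"
    and "stochastic_integral D P X I"
    and "\<And>n. \<xi> n \<in> L_space D"
    and "\<And>n. L_fourier D (\<xi> n) (\<lambda>\<gamma>. e n \<gamma> / ((of_real \<gamma> - \<i>) * cnj (h \<gamma>)))"
  shows "orthonormal_basis_of P (process_span P X UNIV) (\<lambda>n. I (\<xi> n)) \<and>
    (\<forall>n. AE \<omega> in P. complex_cond_exp P (process_sigma P X {..0}) (I (\<xi> n)) \<omega> =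
       (if n < 0 then I (\<xi> n) \<omega> else 0)) \<and>
    L2_closed_span P ((\<lambda>n. I (\<xi> n)) ` {n. n < 0}) = process_span P X {..0} \<and>
    L2_closed_span P ((\<lambda>n. I (\<xi> n)) ` {n. n \<ge> 0}) =
      orthogonal_complement_in P (process_span P X UNIV) (process_span P X {..0})"
proof -
  note D = assms(1) and Dh = assms(3) and P = assms(5) and X = assms(6,8)
  interpret prob_space P by fact
  let ?\<Delta> = "spectral_measure D"
  let ?X = "\<lambda>t \<omega>. complex_of_real (X t \<omega>)"
  let ?Y = "\<lambda>n. I (\<xi> n)"
  let ?Z = "weighted_z h"
  let ?F = "\<lambda>n \<gamma>. e n \<gamma> / ((of_real \<gamma> - \<i>) * cnj (h \<gamma>))"
  let ?S = "{\<lambda>\<gamma>. exp (\<i> * of_real \<gamma> * of_real t) * cnj (h \<gamma>) |t. t < 0}"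
  have hL: "h \<in> L2 lborel" and outer: "hardy_lower = L2_closed_span lborel ?S"
    using assms(2) by (auto simp: outer_function_def hardy_upper_def)
  have hm [measurable]: "h \<in> borel_measurable borel" using L2_measurable[OF hL] by simp
  have S: "?S \<subseteq> L2 lborel" using exp_h_L2[OF hL outer] by auto
  have past: "hardy_lower = L2_closed_span lborel (e ` {n. n < 0})"
    by (rule hardy_lower_eq_e_span[OF outer S])
  have pastZ: "L2_closed_span lborel (?Z ` {..0}) = hardy_lower"
    by (rule weighted_z_span_eq_hardy_lower[OF hL outer])

  have Xm: "X t \<in> borel_measurable P" for t using X(1) by (simp add: gaussian_process_def)
  have X2: "integrable P (\<lambda>\<omega>. (X t \<omega>)\<^sup>2)" for t by (rule gaussian_process_square_integrable[OF P X])
  have XL: "?X t \<in> L2 P" for t using Xm X2 by (simp add: L2_def)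
  have XS: "?X ` T \<subseteq> L2 P" for T using XL by auto
  have unitary: "unitary_onto D P (process_span P X UNIV) I"
    and IX: "AE \<omega> in P. I (L_embed (signed_indicator t)) \<omega> = ?X t \<omega>" for t
    using assms(10) by (auto simp: stochastic_integral_def)
  have Imem: "I \<eta> \<in> process_span P X UNIV" if "\<eta> \<in> L_space D" for \<eta>
    using unitary that by (simp add: unitary_onto_def)
  have Iinner: "L2_inner P (I \<eta>) (I \<zeta>) = L_inner D \<eta> \<zeta>" if "\<eta> \<in> L_space D" "\<zeta> \<in> L_space D" for \<eta> \<zeta>
    using unitary that by (simp add: unitary_onto_def)
  have IL: "I \<eta> \<in> L2 P" if "\<eta> \<in> L_space D" for \<eta>
    using Imem[OF that] L2_closed_span_subset by (auto simp: process_span_def)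
  have YL: "?Y n \<in> L2 P" for n by (rule IL[OF assms(11)])
  have YS: "?Y ` N \<subseteq> L2 P" for N using YL by auto
  note embed = L_embed_signed_indicator[OF D]

  have h0: "AE \<gamma> in lborel. h \<gamma> \<noteq> 0"
    using Dh spectral_density_pos[OF D]
  proof eventually_elim
    case (elim \<gamma>)
    have "1 + \<gamma>\<^sup>2 > 0" using zero_le_power2[of \<gamma>] by linarith
    then show ?case using elim by auto
  qed
  have Fm: "?F n \<in> borel_measurable borel" for n by measurable
  have Fe: "AE \<gamma> in lborel. ?F n \<gamma> * ((of_real \<gamma> - \<i>) * cnj (h \<gamma>)) = e n \<gamma>" for n
    using h0 by eventually_elim (auto simp: complex_eq_iff)
  have Zm: "?Z t \<in> borel_measurable borel" for t using L2_measurable[OF weighted_z_L2[OF hL outer]] by simp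
  have zZ: "AE \<gamma> in lborel. z t \<gamma> * ((of_real \<gamma> - \<i>) * cnj (h \<gamma>)) = ?Z t \<gamma>" for t
    by (simp add: weighted_z_def mult.assoc)
  have XX: "L2_inner P (?X t) (?X s) = L2_inner lborel (?Z t) (?Z s)" for t s
  proof -
    have "L2_inner P (?X t) (?X s) = of_real (expectation (\<lambda>\<omega>. X t \<omega> * X s \<omega>))"
      by (simp add: L2_inner_def flip: integral_complex_of_real)
    also have "\<dots> = L2_inner ?\<Delta> (z t) (z s)" unfolding assms(9) L2_inner_def ..
    also have "\<dots> = L2_inner lborel (?Z t) (?Z s)"
      by (rule spectral_inner_eq[OF D hm Dh borel_measurable_z Zm zZ borel_measurable_z Zm zZ])
    finally show ?thesis .
  qed
  have YX: "L2_inner P (?Y n) (?X t) = L2_inner lborel (e n) (?Z t)" for n t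
  proof -
    \<comment> \<open>The stochastic integral of an indicator is X t only almost surely.\<close>
    have "L2_inner P (?Y n) (?X t) = L2_inner P (?Y n) (I (L_embed (signed_indicator t)))"
      using IX[of t] L2_measurable[OF YL] L2_measurable[OF XL] L2_measurable[OF IL[OF embed(1)]]
      by (intro L2_inner_cong_AE) auto
    also have "\<dots> = L_inner D (\<xi> n) (L_embed (signed_indicator t))"
      by (rule Iinner[OF assms(11) embed(1)])
    also have "\<dots> = L2_inner ?\<Delta> (?F n) (z t)"
      by (rule L_inner_eq_L2_inner[OF assms(11) embed(1) assms(12) embed(2)])
    also have "\<dots> = L2_inner lborel (e n) (?Z t)"
      by (rule spectral_inner_eq[OF D hm Dh Fm borel_measurable_e Fe borel_measurable_z Zm zZ])
    finally show ?thesis .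
  qed
  have YY: "L2_inner P (?Y n) (?Y k) = L2_inner lborel (e n) (e k)" for n k
  proof -
    have "L2_inner P (?Y n) (?Y k) = L_inner D (\<xi> n) (\<xi> k)" by (rule Iinner[OF assms(11) assms(11)])
    also have "\<dots> = L2_inner ?\<Delta> (?F n) (?F k)"
      by (rule L_inner_eq_L2_inner[OF assms(11) assms(11) assms(12) assms(12)])
    also have "\<dots> = L2_inner lborel (e n) (e k)"
      by (rule spectral_inner_eq[OF D hm Dh Fm borel_measurable_e Fe Fm borel_measurable_e Fe])
    finally show ?thesis .
  qed
  have on: "L2_inner P (?Y n) (?Y k) = (if n = k then 1 else 0)" for n k
    unfolding YY by (rule e_orthonormal)

  \<comment> \<open>Joining both systems in one family makes its Gram matrix contain the mixed
    products. Membership of an X t in a span of the I (\<xi> n), or the reverse, then becomes a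
    statement about \<open>weighted_z h t\<close> and \<open>e n\<close>.\<close>
  define b where "b = case_sum ?X ?Y"
  define b' where "b' = case_sum ?Z e"
  have b: "b i \<in> L2 P" for i using XL YL by (cases i) (auto simp: b_def)
  have b': "b' i \<in> L2 lborel" for i using weighted_z_L2[OF hL outer] e_L2 by (cases i) (auto simp: b'_def)
  have XY: "L2_inner P (?X t) (?Y n) = L2_inner lborel (?Z t) (e n)" for n t
    using YX[of n t] by (subst (1 2) L2_inner_commute) simp
  have gram: "L2_inner P (b i) (b j) = L2_inner lborel (b' i) (b' j)" for i j
    by (cases i; cases j) (simp_all only: b_def b'_def sum.case XX XY YX YY)
  note transfer = L2_closed_span_gram_transfer[of b P b' lborel, OF b b' gram]
  have bX: "b ` Inl ` T = ?X ` T" and b'Z: "b' ` Inl ` T = ?Z ` T" for T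
    by (auto simp: b_def b'_def image_image)
  have bY: "b ` Inr ` N = ?Y ` N" and b'e: "b' ` Inr ` N = e ` N" for N
    by (auto simp: b_def b'_def image_image)
  have X_in: "?X t \<in> L2_closed_span P (?Y ` N) \<longleftrightarrow> ?Z t \<in> L2_closed_span lborel (e ` N)" for t N
    using transfer[of "Inl t" "Inr ` N"] unfolding bY b'e by (simp add: b_def b'_def)
  have Y_in: "?Y n \<in> L2_closed_span P (?X ` T) \<longleftrightarrow> e n \<in> L2_closed_span lborel (?Z ` T)" for n T
    using transfer[of "Inr n" "Inl ` T"] unfolding bX b'Z by (simp add: b_def b'_def)

  \<comment> \<open>Completeness of the \<open>e n\<close> puts every weighted \<open>z t\<close>
    into their closed span.\<close>
  have all: "L2_closed_span P (range ?Y) = process_span P X UNIV"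
  proof
    show "L2_closed_span P (range ?Y) \<subseteq> process_span P X UNIV"
      unfolding process_span_def
      by (rule L2_closed_span_minimal[OF XS]) (use Imem[OF assms(11)] in \<open>auto simp: process_span_def\<close>)
    show "process_span P X UNIV \<subseteq> L2_closed_span P (range ?Y)"
      unfolding process_span_def
    proof (rule L2_closed_span_minimal[OF YS], clarify)
      fix t
      show "?X t \<in> L2_closed_span P (range ?Y)"
        unfolding X_in e_span_eq_L2 by (rule weighted_z_L2[OF hL outer])
    qed
  qed
  \<comment> \<open>Both inclusions reduce to generators, and in the frequency domain the two
    generating systems have the same closed span \<open>hardy_lower\<close>.\<close>
  have negative: "L2_closed_span P (?Y ` {n. n < 0}) = process_span P X {..0}"
  proof
    show "L2_closed_span P (?Y ` {n. n < 0}) \<subseteq> process_span P X {..0}"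
      unfolding process_span_def
    proof (rule L2_closed_span_minimal[OF XS], clarify)
      fix n :: int assume "n < 0"
      then have "e n \<in> L2_closed_span lborel (e ` {n. n < 0})"
        by (intro L2_closed_span_superset) (use e_L2 in auto)
      then show "?Y n \<in> L2_closed_span P (?X ` {..0})"
        unfolding Y_in pastZ past .
    qed
    show "process_span P X {..0} \<subseteq> L2_closed_span P (?Y ` {n. n < 0})"
      unfolding process_span_def
    proof (rule L2_closed_span_minimal[OF YS], clarify)
      fix t :: real assume "t \<le> 0"
      then have "?Z t \<in> L2_closed_span lborel (?Z ` {..0})"
        by (intro L2_closed_span_superset) (use weighted_z_L2[OF hL outer] in auto)
      then show "?X t \<in> L2_closed_span P (?Y ` {n. n < 0})"
        unfolding X_in past[symmetric] pastZ .
    qed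
  qed
  have orth_past: "L2_inner P (?Y n) g = 0" if "n \<ge> 0" "g \<in> process_span P X {..0}" for n g
    by (rule L2_closed_span_inner_zero[OF YL YS _ that(2)[folded negative]]) (use on that(1) in auto)
  have complement: "L2_closed_span P (?Y ` {n. n \<ge> 0}) =
      orthogonal_complement_in P (process_span P X UNIV) (process_span P X {..0})"
  proof
    show "L2_closed_span P (?Y ` {n. n \<ge> 0}) \<subseteq> orthogonal_complement_in P (process_span P X UNIV) (process_span P X {..0})"
    proof
      fix f assume f: "f \<in> L2_closed_span P (?Y ` {n. n \<ge> 0})"
      have "f \<in> process_span P X UNIV"
        using L2_closed_span_mono[OF YS, of "?Y ` {n. n \<ge> 0}" UNIV] f unfolding all by auto
      moreover have "L2_inner P f g = 0" if g: "g \<in> process_span P X {..0}" for g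
      proof -
        have gL: "g \<in> L2 P" using g L2_closed_span_subset by (auto simp: process_span_def)
        have "L2_inner P g f = 0"
        proof (rule L2_closed_span_inner_zero[OF gL YS _ f])
          fix k assume "k \<in> ?Y ` {n. n \<ge> 0}"
          then have "L2_inner P k g = 0" using orth_past g by auto
          then show "L2_inner P g k = 0" by (subst L2_inner_commute) simp
        qed
        then show ?thesis by (subst L2_inner_commute) simp
      qed
      ultimately show "f \<in> orthogonal_complement_in P (process_span P X UNIV) (process_span P X {..0})"
        by (simp add: orthogonal_complement_in_def)
    qed
    show "orthogonal_complement_in P (process_span P X UNIV) (process_span P X {..0}) \<subseteq> L2_closed_span P (?Y ` {n. n \<ge> 0})"
    proof
      fix f assume f: "f \<in> orthogonal_complement_in P (process_span P X UNIV) (process_span P X {..0})"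
      have neg: "?Y n \<in> process_span P X {..0}" if "n < 0" for n
        unfolding negative[symmetric] by (rule L2_closed_span_superset[OF YS]) (use that in auto)
      show "f \<in> L2_closed_span P (?Y ` {n. n \<ge> 0})"
      \<comment> \<open>f lies in the span of all I (\<xi> n) and is orthogonal to those with n < 0,
        which belong to the past; its approximations can drop these terms.\<close>
      proof (rule L2_closed_span_orthonormal_restrict[OF YL on])
        show "f \<in> L2_closed_span P (range ?Y)"
          using f unfolding all by (simp add: orthogonal_complement_in_def)
        show "L2_inner P f (?Y n) = 0" if "n \<in> UNIV - {n. n \<ge> 0}" for n
          using f neg[of n] that by (simp add: orthogonal_complement_in_def)
      qed
    qed
  qed
  have "AE \<omega> in P. complex_cond_exp P (process_sigma P X {..0}) (?Y n) \<omega> = (if n < 0 then ?Y n \<omega> else 0)" for n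
  proof (cases "n < 0")
    case True
    then have "?Y n \<in> process_span P X {..0}"
      unfolding negative[symmetric] by (intro L2_closed_span_superset[OF YS]) auto
    from process_span_cond_exp_self[OF P Xm X2 this] True show ?thesis by simp
  next
    case False
    \<comment> \<open>Gaussianity upgrades orthogonality to the single variables X t with t \<le> 0
      to a vanishing conditional expectation.\<close>
    have "L2_inner P (?Y n) (?X t) = 0" if "t \<in> {..0}" for t
      using False that L2_closed_span_superset[OF XS, of "?X t" "{..0}"]
      by (intro orth_past) (auto simp: process_span_def)
    from process_span_orthogonal_complex_cond_exp[where T = "{..0}", OF P X Imem[OF assms(11)] this] False
    show ?thesis by simp
  qed
  moreover have "orthonormal_basis_of P (process_span P X UNIV) ?Y"
    using all on Imem[OF assms(11)] by (simp add: orthonormal_basis_of_def)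
  ultimately show ?thesis using negative complement by blast
qed

end
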